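(* Let $0<\alpha<n$, let $1<p<n/\alpha$, let $q$ be defined by the equation $1/q=1/p-\alpha/n$, and let $w\in A_{p,q}$. Then $$\|I_\alpha\|_{L^p(w^p)\to L^q(w^q)}\le c\,[w]_{A_{p,q}}^{(1-\frac{\alpha}{n})\max\{1,\frac{p'}{q}\}},$$ where the constant $c$ is independent of $w$. Furthermore this estimate is sharp: for no $\beta<(1-\frac{\alpha}{n})\max\{1,\frac{p'}{q}\}$ is there a constant $c$ such that $\|I_\alpha\|_{L^p(w^p)\to L^q(w^q)}\le c\,[w]_{A_{p,q}}^{\beta}$ for all $w\in A_{p,q}$.
   Context: For $0<\alpha<n$, the fractional integral operator (Riesz potential) is $I_\alpha f(x)=\int_{\mathbb{R}^n}\frac{f(y)}{|x-y|^{n-\alpha}}\,dy$. A weight is a non-negative locally integrable function on $\mathbb{R}^n$; $p'$ is defined by $1/p+1/p'=1$; $L^p(v)$ is the $L^p$ space of the measure $v\,dx$. For $1<p\le q<\infty$, a weight $w$ belongs to $A_{p,q}$ if $$[w]_{A_{p,q}}=\sup_Q\left(\frac1{|Q|}\int_Q w^q\,dx\right)\left(\frac1{|Q|}\int_Q w^{-p'}\,dx\right)^{q/p'}<\infty,$$ the supremum being over all cubes $Q\subset\mathbb{R}^n$ with sides parallel to the axes. *)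

theory Defs
  imports "HOL-Analysis.Analysis"
begin

section \<open>Real powers and \<open>L\<^sup>p\<close> norms with values in \<open>[0, \<infinity>]\<close>\<close>

text \<open>Real powers on \<open>[0, \<infinity>]\<close>, with \<open>0\<close> to a negative power equal to \<open>\<infinity>\<close>
  and \<open>\<infinity>\<close> to a negative power equal to \<open>0\<close>.  (The real \<open>powr\<close> sends base \<open>0\<close> to \<open>0\<close> for
  every exponent, which would be wrong for \<open>w\<^bsup>-p'\<^esup>\<close> where \<open>w\<close> vanishes.)\<close>

definition epowr :: "ennreal \<Rightarrow> real \<Rightarrow> ennreal"  (infixr \<open>epowr\<close> 80) where
  "x epowr r =
    (if r = 0 then 1
     else if x = 0 then (if r > 0 then 0 else \<infinity>)
     else if x = \<infinity> then (if r > 0 then \<infinity> else 0)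
     else ennreal (enn2real x powr r))"

definition conj_exponent :: "real \<Rightarrow> real" where
  "conj_exponent p = p / (p - 1)"

lemma conj_exponent: "1 < p \<Longrightarrow> 1 / p + 1 / conj_exponent p = 1"
  by (simp add: conj_exponent_def field_simps)

definition Lp_norm :: "real \<Rightarrow> 'a measure \<Rightarrow> ('a \<Rightarrow> real) \<Rightarrow> ennreal" where
  "Lp_norm p M f = (\<integral>\<^sup>+ x. ennreal \<bar>f x\<bar> epowr p \<partial>M) epowr (1 / p)"

text \<open>Elements are functions, not classes; a bound \<open>\<parallel>T f\<parallel> \<le> C \<parallel>f\<parallel>\<close> for all of them makes a linear
  \<open>T\<close> compatible with a.e. equality.\<close>

definition Lp_space :: "real \<Rightarrow> 'a measure \<Rightarrow> ('a \<Rightarrow> real) set" where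
  "Lp_space p M = {f \<in> borel_measurable M. Lp_norm p M f < \<infinity>}"

section \<open>Weights and the class \<open>A\<^bsub>p,q\<^esub>\<close>\<close>

definition weight :: "(real ^ 'n \<Rightarrow> real) \<Rightarrow> bool" where
  "weight w \<longleftrightarrow> (\<forall>x. 0 \<le> w x) \<and> (\<forall>K. compact K \<longrightarrow> w absolutely_integrable_on K)"

definition weighted_measure :: "(real ^ 'n \<Rightarrow> real) \<Rightarrow> (real ^ 'n) measure" where
  "weighted_measure v = density lebesgue (\<lambda>x. ennreal (v x))"

definition cubes :: "(real ^ 'n) set set" where
  "cubes = {cbox a (a + h *\<^sub>R One) | a h. 0 < h}"

definition average :: "(real ^ 'n) set \<Rightarrow> (real ^ 'n \<Rightarrow> ennreal) \<Rightarrow> ennreal" where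
  "average Q g = (\<integral>\<^sup>+ x \<in> Q. g x \<partial>lebesgue) / emeasure lebesgue Q"

text \<open>If \<open>w\<close> vanishes on a set of positive measure without vanishing a.e., some cube gives the
  value \<open>\<infinity>\<close>.  For \<open>w = 0\<close> a.e. the convention \<open>0 \<cdot> \<infinity> = 0\<close> gives \<open>[w] = 0\<close>; then both weighted
  \<open>L\<^sup>p\<close> spaces are trivial.  Every other weight in the class is positive a.e.\<close>

definition Apq_const :: "real \<Rightarrow> real \<Rightarrow> (real ^ 'n \<Rightarrow> real) \<Rightarrow> ennreal" where
  "Apq_const p q w =
    (SUP Q \<in> cubes.
       average Q (\<lambda>x. ennreal (w x) epowr q) *
       average Q (\<lambda>x. ennreal (w x) epowr (- conj_exponent p)) epowr (q / conj_exponent p))"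

definition Apq :: "real \<Rightarrow> real \<Rightarrow> (real ^ 'n \<Rightarrow> real) set" where
  "Apq p q = {w. weight w \<and> Apq_const p q w < \<infinity>}"

section \<open>The fractional integral operator\<close>

definition riesz_integrand :: "real \<Rightarrow> (real ^ 'n \<Rightarrow> real) \<Rightarrow> real ^ 'n \<Rightarrow> real ^ 'n \<Rightarrow> real" where
  "riesz_integrand \<alpha> f x y = f y / norm (x - y) powr (real CARD('n) - \<alpha>)"

definition riesz_potential :: "real \<Rightarrow> (real ^ 'n \<Rightarrow> real) \<Rightarrow> real ^ 'n \<Rightarrow> real" where
  "riesz_potential \<alpha> f x = (\<integral> y. riesz_integrand \<alpha> f x y \<partial>lebesgue)"

text \<open>The norm of \<open>I\<^sub>\<alpha>\<close> from \<open>L\<^sup>p(\<mu>)\<close> to \<open>L\<^sup>q(\<nu>)\<close>: the least admissible bound, \<open>\<infinity>\<close> if there is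
  none.  Since the Bochner integral is \<open>0\<close> for non-integrable functions, a bound is admissible only
  if, for every \<open>f\<close> in \<open>L\<^sup>p(\<mu>)\<close>, the integral defining \<open>I\<^sub>\<alpha> f\<close> converges absolutely
  \<open>\<nu>\<close>-almost everywhere.\<close>

definition riesz_norm ::
    "real \<Rightarrow> real \<Rightarrow> (real ^ 'n) measure \<Rightarrow> real \<Rightarrow> (real ^ 'n) measure \<Rightarrow> ennreal" where
  "riesz_norm \<alpha> p \<mu> q \<nu> =
    Inf {C. \<forall>f \<in> Lp_space p \<mu>.
           (AE x in \<nu>. integrable lebesgue (riesz_integrand \<alpha> f x)) \<and>
           Lp_norm q \<nu> (riesz_potential \<alpha> f) \<le> C * Lp_norm p \<mu> f}"

end

theory Submission
  imports Defs
begin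

text \<open>Write \<open>n\<close> for the dimension, \<open>p'\<close> for the conjugate exponent, \<open>u = w\<^sup>q\<close>, \<open>\<sigma> = w\<^bsup>-p'\<^esup>\<close>,
  \<open>r = 1 - \<alpha>/n = 1/q + 1/p'\<close> and \<open>K = [w]\<^bsup>1/q\<^esup>\<close>.  Then \<open>K\<close> is the least constant with
  \<open>u(Q)\<^bsup>1/q\<^esup> \<sigma>(Q)\<^bsup>1/p'\<^esup> \<le> K |Q|\<^sup>r\<close> for all cubes, the situation is symmetric under
  \<open>(q, u) \<leftrightarrow> (p', \<sigma>)\<close>, and the exponent to be proved is \<open>r max q p'\<close>, as a power of \<open>K\<close>.

  \<^bold>\<open>Upper bound.\<close>  The kernel \<open>|x - y|\<^bsup>\<alpha>-n\<^esup> = |x - y|\<^bsup>-nr\<^esup>\<close> is dominated by a sum over \<open>2\<^sup>n\<close> translated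
  dyadic grids of \<open>\<Sum> |Q|\<^bsup>-r\<^esup>\<close>, the sum running over the cubes \<open>Q\<close> of the grid that contain \<open>x\<close> and \<open>y\<close>
  (lemma \<open>exists_common_cell\<close>).  Between two fixed scales and in a bounded region such a dyadic operator
  only sees the masses that \<open>u\<close>, \<open>\<sigma>\<close> and the function give to the finitely many smallest cubes.  So
  the bound becomes an inequality for finite sums, with a constant that depends neither on the
  number of cubes nor on the weight (lemma \<open>strong\<close>); the potential is recovered
  by monotone convergence (lemma \<open>riesz_bound\<close>).

  The finite inequality has two parts.  First, a positive dyadic operator is bounded as soon as it is
  bounded, together with its adjoint, on the indicator functions of cubes: in the bilinear form each
  cube is assigned to a stopping cube of either function, on which that function has an almost
  constant average, and the pairs of stopping cubes are separated by inclusion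
  (lemmas \<open>corona_half\<close> and \<open>bilinear\<close>).  Second, the testing condition has to be
  verified with the right power of \<open>K\<close> (lemma \<open>testing\<close>).  The \<open>q\<close>-th power of
  \<open>\<Sum> |Q|\<^bsup>-r\<^esup> \<sigma>(Q) 1\<^sub>Q\<close> over \<open>Q \<subseteq> R\<close> is expanded along the chains of cubes through a point.  Inner sums
  over subcubes converge geometrically because \<open>r < 1\<close>, and what remains is
  \<open>K\<^sup>q \<Sum> \<sigma>(Q)\<^bsup>q/p\<^esup>\<close> over \<open>Q \<subseteq> R\<close>.  A child of \<open>Q\<close> misses at least a fixed fraction of the volume of \<open>Q\<close>,
  hence by Hoelder's inequality it misses a fraction of order \<open>K\<^bsup>-p'\<^esup>\<close> of the mass \<open>\<sigma>(Q)\<close>.  Since \<open>q > p\<close>, the last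
  sum is therefore at most a multiple of \<open>K\<^bsup>p'\<^esup> \<sigma>(R)\<^bsup>q/p\<^esup>\<close>.  The testing constant is thus
  of order \<open>K\<^bsup>1 + p'/q\<^esup> = K\<^bsup>r p'\<^esup>\<close>, that of the adjoint \<open>K\<^bsup>1 + q/p'\<^esup> = K\<^bsup>r q\<^esup>\<close>, and the larger one wins.

  \<^bold>\<open>Sharpness.\<close>  Radial powers are extremal.  The averages of \<open>|x|\<^bsup>\<delta>-n\<^esup>\<close> and \<open>|x|\<^bsup>(n-\<delta>)s\<^esup>\<close> over a cube
  multiply, with the second raised to \<open>1/s\<close>, to at most a multiple of \<open>1/\<delta>\<close> (lemma \<open>power_weight_cube\<close>).
  If \<open>p' \<ge> q\<close>, take the weight with \<open>\<sigma> = |x|\<^bsup>\<delta>-n\<^esup>\<close>; otherwise the one with \<open>u = |x|\<^bsup>\<delta>-n\<^esup>\<close>.  In both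
  cases an explicit radial function shows that the norm is at least a multiple of \<open>\<delta>\<^bsup>-r\<^esup>\<close>
  (lemmas \<open>growing_family\<close> and \<open>singular_family\<close>), while \<open>[w]\<close> is at most a multiple of \<open>\<delta>\<^bsup>-q/p'\<^esup>\<close>
  and \<open>\<delta>\<^bsup>-1\<^esup>\<close> respectively.  Letting \<open>\<delta> \<rightarrow> 0\<close> excludes every smaller power.\<close>

section \<open>Inequalities for finite sums\<close>

lemma weighted_mean_ineq:
  fixes a b t :: real
  assumes "0 \<le> a" "0 \<le> b" "0 < t" "t < 1"
  shows "a powr t * b powr (1 - t) \<le> t * a + (1 - t) * b"
proof (cases "a = 0 \<or> b = 0")
  case False
  then show ?thesis using assms by (intro Youngs_inequality_0) auto
qed (use assms in auto)

text \<open>Hoelder's inequality in the form used below: normalise both sums to 1 and apply the weighted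
  inequality of arithmetic and geometric means to each summand.\<close>
lemma geometric_mean_sum_le:
  fixes a b :: "'a \<Rightarrow> real"
  assumes "finite X" and "\<And>x. x \<in> X \<Longrightarrow> 0 \<le> a x" and "\<And>x. x \<in> X \<Longrightarrow> 0 \<le> b x"
    and "0 < t" "t < 1"
  shows "(\<Sum>x\<in>X. a x powr t * b x powr (1 - t)) \<le> (\<Sum>x\<in>X. a x) powr t * (\<Sum>x\<in>X. b x) powr (1 - t)"
proof -
  let ?A = "\<Sum>x\<in>X. a x" and ?B = "\<Sum>x\<in>X. b x"
  have A0: "0 \<le> ?A" and B0: "0 \<le> ?B" using assms by (auto intro: sum_nonneg)
  show ?thesis
  proof (cases "?A = 0 \<or> ?B = 0")
    case True
    then have "(\<forall>x\<in>X. a x = 0) \<or> (\<forall>x\<in>X. b x = 0)"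
      using assms by (auto simp: sum_nonneg_eq_0_iff)
    then have "(\<Sum>x\<in>X. a x powr t * b x powr (1 - t)) = 0"
      by (auto intro: sum.neutral)
    then show ?thesis by simp
  next
    case False
    with A0 B0 have A: "0 < ?A" and B: "0 < ?B" by auto
    have "(\<Sum>x\<in>X. (a x / ?A) powr t * (b x / ?B) powr (1 - t))
        \<le> (\<Sum>x\<in>X. t * (a x / ?A) + (1 - t) * (b x / ?B))"
      using assms A B by (intro sum_mono weighted_mean_ineq) auto
    also have "\<dots> = t * (?A / ?A) + (1 - t) * (?B / ?B)"
      unfolding sum.distrib sum_distrib_left[symmetric] sum_divide_distrib[symmetric] ..
    also have "\<dots> = 1" using A B by simp
    finally have "(\<Sum>x\<in>X. (a x / ?A) powr t * (b x / ?B) powr (1 - t)) \<le> 1" .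
    moreover have "(\<Sum>x\<in>X. (a x / ?A) powr t * (b x / ?B) powr (1 - t))
        = (\<Sum>x\<in>X. a x powr t * b x powr (1 - t)) / (?A powr t * ?B powr (1 - t))"
      unfolding sum_divide_distrib using assms A B by (intro sum.cong) (auto simp: powr_divide)
    ultimately show ?thesis using A B by (simp add: divide_le_eq)
  qed
qed

lemma sum_powr_le_powr_sum:
  fixes a :: "'a \<Rightarrow> real"
  assumes "finite X" and "\<And>x. x \<in> X \<Longrightarrow> 0 \<le> a x" and "1 \<le> t"
  shows "(\<Sum>x\<in>X. a x powr t) \<le> (\<Sum>x\<in>X. a x) powr t"
proof -
  let ?A = "\<Sum>x\<in>X. a x"
  have "(\<Sum>x\<in>X. a x powr t) \<le> (\<Sum>x\<in>X. a x * ?A powr (t - 1))"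
  proof (rule sum_mono)
    fix x assume x: "x \<in> X"
    have le: "a x \<le> ?A" using x assms by (intro member_le_sum) auto
    have "a x powr t = a x * a x powr (t - 1)"
      using assms(2)[OF x] by (cases "a x = 0") (auto simp: powr_diff)
    also have "\<dots> \<le> a x * ?A powr (t - 1)"
      using assms x le by (intro mult_left_mono powr_mono2) auto
    finally show "a x powr t \<le> a x * ?A powr (t - 1)" .
  qed
  also have "\<dots> = ?A * ?A powr (t - 1)" by (simp add: sum_distrib_right)
  also have "\<dots> = ?A powr t"
    using assms by (cases "?A = 0") (auto simp: powr_diff sum_nonneg)
  finally show ?thesis .
qed

lemma powr_sum_le_sum_powr:
  fixes a :: "'a \<Rightarrow> real"
  assumes "finite X" and "\<And>x. x \<in> X \<Longrightarrow> 0 \<le> a x" and "0 < t" "t \<le> 1"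
  shows "(\<Sum>x\<in>X. a x) powr t \<le> (\<Sum>x\<in>X. a x powr t)"
proof -
  have "(\<Sum>x\<in>X. (a x powr t) powr (1/t)) \<le> (\<Sum>x\<in>X. a x powr t) powr (1/t)"
    using assms by (intro sum_powr_le_powr_sum) auto
  then have "(\<Sum>x\<in>X. a x) \<le> (\<Sum>x\<in>X. a x powr t) powr (1/t)"
    using assms by (simp add: powr_powr)
  then have "(\<Sum>x\<in>X. a x) powr t \<le> ((\<Sum>x\<in>X. a x powr t) powr (1/t)) powr t"
    using assms by (intro powr_mono2) (auto intro: sum_nonneg)
  then show ?thesis using assms by (simp add: powr_powr sum_nonneg)
qed

text \<open>Hoelder's inequality remains true for sums, as opposed to integrals, when the exponents satisfy
  only \<open>1/p + 1/q \<ge> 1\<close>, because \<open>\<ell>\<close>-norms decrease in the exponent.  This is the one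
  place where the gain of integrability \<open>p \<le> q\<close> enters the passage from testing to the strong bound.\<close>
lemma Holder_sum:
  fixes a b :: "'a \<Rightarrow> real"
  assumes "finite X" and "\<And>x. x \<in> X \<Longrightarrow> 0 \<le> a x" and "\<And>x. x \<in> X \<Longrightarrow> 0 \<le> b x"
    and "1 < p" "1 < q" "1 \<le> 1 / p + 1 / q"
  shows "(\<Sum>x\<in>X. a x * b x) \<le> (\<Sum>x\<in>X. a x powr p) powr (1/p) * (\<Sum>x\<in>X. b x powr q) powr (1/q)"
proof -
  define s where "s = p / (p - 1)"
  have s: "1 - 1/p = 1/s" "s > 1" using assms by (auto simp: s_def field_simps)
  have "s \<ge> q" using assms unfolding s_def by (simp add: field_simps)
  have "(\<Sum>x\<in>X. a x * b x) = (\<Sum>x\<in>X. (a x powr p) powr (1/p) * (b x powr s) powr (1 - 1/p))"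
    using assms s by (intro sum.cong) (auto simp: powr_powr)
  also have "\<dots> \<le> (\<Sum>x\<in>X. a x powr p) powr (1/p) * (\<Sum>x\<in>X. b x powr s) powr (1 - 1/p)"
    using assms by (intro geometric_mean_sum_le) auto
  also have "(\<Sum>x\<in>X. b x powr s) = (\<Sum>x\<in>X. (b x powr q) powr (s/q))"
    using assms by (intro sum.cong) (auto simp: powr_powr)
  also have "(\<dots>) powr (1 - 1/p) \<le> ((\<Sum>x\<in>X. b x powr q) powr (s/q)) powr (1 - 1/p)"
    using assms \<open>s \<ge> q\<close> by (intro powr_mono2 sum_powr_le_powr_sum) (auto intro!: sum_nonneg)
  also have "((\<Sum>x\<in>X. b x powr q) powr (s/q)) powr (1 - 1/p) = (\<Sum>x\<in>X. b x powr q) powr (1/q)"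
    using s by (simp add: powr_powr)
  finally show ?thesis by (simp add: mult_left_mono)
qed

lemma powr_add_mult_le:
  fixes a S s :: real
  assumes "0 \<le> a" "0 \<le> S" "1 \<le> s"
  shows "(a + S) powr s \<le> s * a * (a + S) powr (s - 1) + S powr s"
proof (cases "a + S = 0 \<or> S = 0 \<or> s = 1")
  case True
  have "a powr s \<le> s * a * a powr (s - 1)" 
  proof (cases "a = 0")
    case False
    then have "a powr s = 1 * (a * a powr (s - 1))" using assms by (simp add: powr_diff)
    also have "\<dots> \<le> s * (a * a powr (s-1))" using assms by (intro mult_right_mono) auto
    finally show ?thesis by simp
  qed simp
  moreover have "s = 1 \<or> S = 0" using True assms by linarith
  ultimately show ?thesis using assms by (auto simp: powr_one_gt_zero_iff)
next
  case False
  then have pos: "a + S > 0" "S > 0" and True_s: "1 < s" using assms by auto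
  have "(S powr s) powr (1/s) * ((a + S) powr s) powr (1 - 1/s) \<le> (1/s) * S powr s + (1 - 1/s) * (a + S) powr s"
    using assms pos True_s by (intro weighted_mean_ineq) auto
  moreover have "(S powr s) powr (1/s) = S" using assms by (simp add: powr_powr)
  moreover have "((a + S) powr s) powr (1 - 1/s) = (a + S) powr (s - 1)"
    using assms by (simp add: powr_powr right_diff_distrib)
  ultimately have "s * (S * (a + S) powr (s - 1)) \<le> s * ((1/s) * S powr s + (1 - 1/s) * (a + S) powr s)"
    using assms by (intro mult_left_mono) auto
  also have "\<dots> = S powr s + (s - 1) * (a + S) powr s"
    using assms by (simp add: field_simps)
  finally have 1: "s * (S * (a + S) powr (s - 1)) \<le> S powr s + (s - 1) * (a + S) powr s" .
  have "(a + S) powr s = (a + S) * (a + S) powr (s - 1)" using pos by (simp add: powr_diff)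
  then show ?thesis using 1 by (simp add: algebra_simps)
qed

text \<open>Discrete version of \<open>d(S\<^sup>s) = s S\<^bsup>s-1\<^esup> dS\<close>: add the terms in the order given by \<open>\<rho>\<close> and bound each
  increment of the power of the partial sum by convexity.  For the cubes through a point, ordered by size,
  it reduces the power of a sum to sums over subcubes with a power lowered by one.\<close>
lemma powr_sum_chain_le:
  fixes a :: "'b \<Rightarrow> real" and \<rho> :: "'b \<Rightarrow> nat"
  assumes "finite S" "inj_on \<rho> S" "\<And>b. b \<in> S \<Longrightarrow> 0 \<le> a b" "1 \<le> s"
  shows "(\<Sum>b\<in>S. a b) powr s \<le> s * (\<Sum>b\<in>S. a b * (\<Sum>c\<in>{c\<in>S. \<rho> c \<le> \<rho> b}. a c) powr (s - 1))"
  using assms(1-3)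
proof (induction "card S" arbitrary: S)
  case 0
  then show ?case by simp
next
  case (Suc n)
  then have ne: "S \<noteq> {}" by auto
  have "Max (\<rho> ` S) \<in> \<rho> ` S" using ne Suc.prems by (intro Max_in) auto
  then obtain m where m: "m \<in> S" "\<rho> m = Max (\<rho> ` S)" by auto
  have le: "\<rho> c \<le> \<rho> m" if "c \<in> S" for c using that Suc.prems m by auto
  let ?S = "S - {m}"
  have IH: "sum a ?S powr s \<le> s * (\<Sum>b\<in>?S. a b * sum a {c\<in>?S. \<rho> c \<le> \<rho> b} powr (s - 1))"
    using Suc m by (intro Suc.hyps(1)) (auto intro: inj_on_subset)
  have eq: "{c\<in>?S. \<rho> c \<le> \<rho> b} = {c\<in>S. \<rho> c \<le> \<rho> b}" if "b \<in> ?S" for b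
  proof -
    have "\<rho> b \<noteq> \<rho> m" using that m(1) inj_onD[OF Suc.prems(2), of b m] by auto
    moreover have "\<rho> b \<le> \<rho> m" using that le by auto
    ultimately show ?thesis by auto
  qed
  have full: "{c\<in>S. \<rho> c \<le> \<rho> m} = S" using le by auto
  have split: "sum h S = h m + sum h ?S" for h :: "'b \<Rightarrow> real"
    using Suc.prems m by (simp add: sum.remove)
  have "(a m + sum a ?S) powr s \<le> s * a m * (a m + sum a ?S) powr (s - 1) + sum a ?S powr s"
    using Suc.prems m assms(4) by (intro powr_add_mult_le) (auto intro: sum_nonneg)
  also have "\<dots> \<le> s * a m * (a m + sum a ?S) powr (s - 1) + s * (\<Sum>b\<in>?S. a b * sum a {c\<in>?S. \<rho> c \<le> \<rho> b} powr (s - 1))"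
    using IH by simp
  also have "(\<Sum>b\<in>?S. a b * sum a {c\<in>?S. \<rho> c \<le> \<rho> b} powr (s - 1))
     = (\<Sum>b\<in>?S. a b * sum a {c\<in>S. \<rho> c \<le> \<rho> b} powr (s - 1))"
    by (intro sum.cong refl) (metis (no_types, lifting) eq)
  also have "s * a m * (a m + sum a ?S) powr (s - 1) + s * (\<Sum>b\<in>?S. a b * sum a {c\<in>S. \<rho> c \<le> \<rho> b} powr (s - 1))
     = s * (\<Sum>b\<in>S. a b * sum a {c\<in>S. \<rho> c \<le> \<rho> b} powr (s - 1))"
    unfolding split[of "\<lambda>b. a b * sum a {c\<in>S. \<rho> c \<le> \<rho> b} powr (s - 1)"] full
    by (simp add: split[of a] algebra_simps)
  finally show ?case by (simp add: split[of a])
qed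

lemma geometric_sum_int_le:
  fixes K :: "int set" and c Y :: real
  assumes "finite K" "0 < c" and "\<And>k. k \<in> K \<Longrightarrow> 2 powr real_of_int k \<le> Y" and "0 < Y"
  shows "(\<Sum>k\<in>K. 2 powr (real_of_int k * c)) \<le> Y powr c / (1 - 2 powr (-c))"
proof -
  have lt: "2 powr (-c) < (1::real)" using assms powr_less_mono[of "-c" 0 "2::real"] by simp
  show ?thesis
  proof (cases "K = {}")
    case True
    then show ?thesis using lt assms by simp
  next
    case False
    define M where "M = Max K"
    have M: "M \<in> K" "\<And>k. k \<in> K \<Longrightarrow> k \<le> M" using False assms by (auto simp: M_def)
    have "(\<Sum>k\<in>K. 2 powr (real_of_int k * c)) = (\<Sum>k\<in>K. 2 powr (real_of_int M * c) * (2 powr (-c)) ^ nat (M - k))"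
    proof (intro sum.cong refl)
      fix k assume "k \<in> K"
      have "real_of_int k * c = real_of_int M * c + real (nat (M - k)) * (-c)"
        using M(2)[OF \<open>k \<in> K\<close>] by (simp add: algebra_simps)
      then have "2 powr (real_of_int k * c) = (2::real) powr (real_of_int M * c + real (nat (M - k)) * (-c))"
        by simp
      also have "\<dots> = 2 powr (real_of_int M * c) * (2 powr (-c)) ^ nat (M - k)"
        by (simp only: powr_add) (simp add: powr_power mult.commute)
      finally show "2 powr (real_of_int k * c) = (2::real) powr (real_of_int M * c) * (2 powr (-c)) ^ nat (M - k)" .
    qed
    also have "\<dots> = 2 powr (real_of_int M * c) * (\<Sum>k\<in>K. (2 powr (-c)) ^ nat (M - k))"
      by (simp add: sum_distrib_left)
    also have "(\<Sum>k\<in>K. (2 powr (-c)) ^ nat (M - k)) = (\<Sum>i\<in>(\<lambda>k. nat (M - k)) ` K. (2 powr (-c)::real) ^ i)"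
    proof -
      have "inj_on (\<lambda>k. nat (M - k)) K"
        using M(2) by (intro inj_onI) (smt (verit) eq_nat_nat_iff)
      then show ?thesis by (simp add: sum.reindex)
    qed
    also have "\<dots> \<le> (\<Sum>i. (2 powr (-c)) ^ i)"
      using assms lt by (intro sum_le_suminf summable_geometric) auto
    also have "\<dots> = 1 / (1 - 2 powr (-c))" using lt by (simp add: suminf_geometric)
    finally have "(\<Sum>k\<in>K. 2 powr (real_of_int k * c)) \<le> 2 powr (real_of_int M * c) * (1 / (1 - 2 powr (-c)))"
      by (simp add: mult_left_mono)
    also have "2 powr (real_of_int M * c) = (2 powr real_of_int M) powr c" by (simp add: powr_powr)
    also have "\<dots> * (1 / (1 - 2 powr (-c))) \<le> Y powr c * (1 / (1 - 2 powr (-c)))"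
      using assms M lt by (intro mult_right_mono powr_mono2) auto
    finally show ?thesis by simp
  qed
qed

section \<open>Stopping cubes and the Carleson embedding\<close>

definition wsum :: "('a \<Rightarrow> real) \<Rightarrow> 'a set \<Rightarrow> real" where
  "wsum m Q = (\<Sum>x\<in>Q. m x)"

definition wavg :: "('a \<Rightarrow> real) \<Rightarrow> ('a \<Rightarrow> real) \<Rightarrow> 'a set \<Rightarrow> real" where
  "wavg m f Q = (\<Sum>x\<in>Q. f x * m x) / wsum m Q"

definition laminar :: "'a set set \<Rightarrow> bool" where
  "laminar \<Q> \<longleftrightarrow> finite \<Q> \<and> (\<forall>Q\<in>\<Q>. finite Q \<and> Q \<noteq> {}) \<and>
     (\<forall>Q\<in>\<Q>. \<forall>Q'\<in>\<Q>. Q \<inter> Q' \<noteq> {} \<longrightarrow> Q \<subseteq> Q' \<or> Q' \<subseteq> Q)"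

text \<open>The average of \<open>f\<close> over a cube is replaced by its maximum over all larger cubes, on a logarithmic scale.
  This makes the level monotone under inclusion, so that the cubes of one level between a cube and its
  largest ancestor of that level all have that level.\<close>
definition level :: "('a \<Rightarrow> real) \<Rightarrow> ('a \<Rightarrow> real) \<Rightarrow> 'a set set \<Rightarrow> 'a set \<Rightarrow> int" where
  "level m f \<Q> Q = \<lfloor>log 2 (Max (wavg m f ` {R\<in>\<Q>. Q \<subseteq> R}))\<rfloor>"

text \<open>The largest ancestor with the same level (lemma \<open>stop_props\<close>).  The ancestors of a cube form a chain,
  so their union is one of them.\<close>
definition stop :: "('a \<Rightarrow> real) \<Rightarrow> ('a \<Rightarrow> real) \<Rightarrow> 'a set set \<Rightarrow> 'a set \<Rightarrow> 'a set" where
  "stop m f \<Q> Q = \<Union> {R\<in>\<Q>. Q \<subseteq> R \<and> level m f \<Q> R = level m f \<Q> Q}"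

lemma chain_Union_in:
  assumes "finite C" "C \<noteq> {}" "\<And>A B. A \<in> C \<Longrightarrow> B \<in> C \<Longrightarrow> A \<subseteq> B \<or> B \<subseteq> A"
  shows "\<Union>C \<in> C"
  using assms
proof (induction C rule: finite_ne_induct)
  case (insert A C)
  then have "\<Union>C \<in> C" by auto
  moreover then have "A \<subseteq> \<Union>C \<or> \<Union>C \<subseteq> A" using insert.prems by auto
  ultimately show ?case by (auto simp: sup.absorb1 sup.absorb2)
qed auto

text \<open>Positivity of all averages keeps the logarithms meaningful; cubes with a vanishing average contribute
  nothing to the sums below and are removed beforehand.\<close>
locale stopping =
  fixes \<Q> :: "'a set set" and m f :: "'a \<Rightarrow> real"
  assumes lam: "laminar \<Q>"
    and m_pos: "\<And>Q x. Q \<in> \<Q> \<Longrightarrow> x \<in> Q \<Longrightarrow> 0 < m x"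
    and f_nonneg: "\<And>Q x. Q \<in> \<Q> \<Longrightarrow> x \<in> Q \<Longrightarrow> 0 \<le> f x"
    and avg_pos: "\<And>Q. Q \<in> \<Q> \<Longrightarrow> 0 < wavg m f Q"
begin

abbreviation "lev \<equiv> level m f \<Q>"
abbreviation "stp \<equiv> stop m f \<Q>"

lemma fin [simp]: "finite \<Q>" "Q \<in> \<Q> \<Longrightarrow> finite Q" "Q \<in> \<Q> \<Longrightarrow> Q \<noteq> {}"
  using lam by (auto simp: laminar_def)

lemma nested: "Q \<in> \<Q> \<Longrightarrow> R \<in> \<Q> \<Longrightarrow> x \<in> Q \<Longrightarrow> x \<in> R \<Longrightarrow> Q \<subseteq> R \<or> R \<subseteq> Q"
  using lam by (auto simp: laminar_def)

lemma ancestors_chain: 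
  assumes "Q \<in> \<Q>" "R \<in> \<Q>" "S \<in> \<Q>" "Q \<subseteq> R" "Q \<subseteq> S" shows "R \<subseteq> S \<or> S \<subseteq> R"
proof -
  obtain x where "x \<in> Q" using fin(3)[OF assms(1)] by auto
  then show ?thesis using nested assms by (meson subsetD)
qed

lemma wsum_pos: "Q \<in> \<Q> \<Longrightarrow> 0 < wsum m Q"
  unfolding wsum_def using m_pos fin by (intro sum_pos) auto

lemma level_bounds:
  assumes "Q \<in> \<Q>"
  shows "wavg m f Q < 2 * 2 powr lev Q" and "\<exists>R\<in>\<Q>. Q \<subseteq> R \<and> 2 powr lev Q \<le> wavg m f R"
proof -
  let ?A = "wavg m f ` {R\<in>\<Q>. Q \<subseteq> R}"
  have A: "finite ?A" "?A \<noteq> {}" using assms by auto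
  have in_A: "Max ?A \<in> ?A" using A by (rule Max_in)
  have pos: "0 < Max ?A" using in_A avg_pos by auto
  have le: "wavg m f Q \<le> Max ?A" using A assms by (intro Max_ge) auto
  have "log 2 (Max ?A) < real_of_int (lev Q) + 1" unfolding level_def by linarith
  then have "Max ?A < 2 powr (real_of_int (lev Q) + 1)" using pos by (simp add: log_less_iff)
  also have "\<dots> = 2 * 2 powr lev Q" by (simp add: powr_add)
  finally show "wavg m f Q < 2 * 2 powr lev Q" using le by simp
  have "real_of_int (lev Q) \<le> log 2 (Max ?A)" unfolding level_def by linarith
  then have "2 powr lev Q \<le> Max ?A" using pos by (simp add: le_log_iff)
  then show "\<exists>R\<in>\<Q>. Q \<subseteq> R \<and> 2 powr lev Q \<le> wavg m f R" using in_A by auto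
qed

lemma level_mono:
  assumes "Q \<in> \<Q>" "R \<in> \<Q>" "Q \<subseteq> R" shows "lev R \<le> lev Q"
proof -
  have ne: "{S\<in>\<Q>. R \<subseteq> S} \<noteq> {}" using assms by auto
  have "Max (wavg m f ` {S\<in>\<Q>. R \<subseteq> S}) \<le> Max (wavg m f ` {S\<in>\<Q>. Q \<subseteq> S})"
    using assms ne by (intro Max_mono) auto
  moreover have "0 < Max (wavg m f ` {S\<in>\<Q>. R \<subseteq> S})"
  proof -
    have "Max (wavg m f ` {S\<in>\<Q>. R \<subseteq> S}) \<in> wavg m f ` {S\<in>\<Q>. R \<subseteq> S}"
      using ne by (intro Max_in) auto
    then show ?thesis using avg_pos by auto
  qed
  ultimately show ?thesis unfolding level_def by (intro floor_mono) (auto simp: log_le_cancel_iff)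
qed

lemma stop_props:
  assumes "Q \<in> \<Q>"
  shows stop_in: "stp Q \<in> \<Q>" and le_stop: "Q \<subseteq> stp Q" and lev_stop: "lev (stp Q) = lev Q"
proof -
  have "stp Q \<in> {R\<in>\<Q>. Q \<subseteq> R \<and> lev R = lev Q}"
    unfolding stop_def using assms
    by (intro chain_Union_in) (auto simp del: fin(3) dest: ancestors_chain[OF assms])
  then show "stp Q \<in> \<Q>" "Q \<subseteq> stp Q" "lev (stp Q) = lev Q" by auto
qed

lemma stop_maximal: "Q \<in> \<Q> \<Longrightarrow> R \<in> \<Q> \<Longrightarrow> Q \<subseteq> R \<Longrightarrow> lev R = lev Q \<Longrightarrow> R \<subseteq> stp Q"
  unfolding stop_def by auto

text \<open>A cube between \<open>Q\<close> and its stopping cube has the same stopping cube.  This is what makes the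
  decomposition into pairs of stopping cubes free of multiplicity.\<close>
lemma stop_between:
  assumes "Q \<in> \<Q>" "R \<in> \<Q>" "Q \<subseteq> R" "R \<subseteq> stp Q" shows "stp R = stp Q"
proof -
  have "lev R \<le> lev Q" "lev (stp Q) \<le> lev R" using assms by (auto intro!: level_mono stop_in)
  then have lev: "lev R = lev Q" using lev_stop assms by auto
  have "Q \<subseteq> stp R" using assms le_stop[of R] by blast
  then have "stp R \<subseteq> stp Q"
    using assms lev by (intro stop_maximal[of Q "stp R"]) (auto simp: stop_in lev_stop)
  moreover have "stp Q \<subseteq> stp R"
    using assms lev by (intro stop_maximal[of R "stp Q"]) (auto simp: stop_in lev_stop)
  ultimately show ?thesis by auto
qed

lemma stops_disjoint:
  assumes "F \<in> stp ` \<Q>" "G \<in> stp ` \<Q>" "lev F = lev G" "x \<in> F" "x \<in> G"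
  shows "F = G"
proof -
  obtain Q R where Q: "Q \<in> \<Q>" "F = stp Q" and R: "R \<in> \<Q>" "G = stp R" using assms by auto
  have *: "F' = G'" if "F' \<subseteq> G'" "Q' \<in> \<Q>" "F' = stp Q'" "R' \<in> \<Q>" "G' = stp R'" "lev F' = lev G'" for F' G' Q' R'
  proof -
    have "G' \<subseteq> stp Q'" using that le_stop[of Q'] lev_stop[of Q'] by (intro stop_maximal stop_in) (auto simp: stop_in)
    then show ?thesis using that by auto
  qed
  have "F \<subseteq> G \<or> G \<subseteq> F" using nested stop_in Q R assms by metis
  then show ?thesis using *[of F G Q R] *[of G F R Q] Q R assms by auto
qed

text \<open>The maximum in the level of the stopping cube is attained over some larger cube, which then has the same level;
  by maximality this is the stopping cube itself.\<close>
lemma stop_avg_ge: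
  assumes "Q \<in> \<Q>" shows "2 powr lev Q \<le> wavg m f (stp Q)"
proof -
  obtain R where R: "R \<in> \<Q>" "stp Q \<subseteq> R" "2 powr lev (stp Q) \<le> wavg m f R"
    using level_bounds(2)[OF stop_in[OF assms]] by auto
  have "2 powr lev (stp Q) < 2 * 2 powr lev R" using level_bounds(1)[OF R(1)] R(3) by simp
  also have "2 * 2 powr real_of_int (lev R) = (2::real) powr (real_of_int (lev R) + 1)" by (simp add: powr_add)
  finally have "real_of_int (lev (stp Q)) < real_of_int (lev R) + 1" by (subst (asm) powr_less_cancel_iff) auto
  then have "lev (stp Q) \<le> lev R" by linarith
  moreover have "lev R \<le> lev (stp Q)" using R assms by (intro level_mono stop_in) auto
  ultimately have "lev R = lev Q" using lev_stop assms by auto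
  then have "R \<subseteq> stp Q" using assms R le_stop[OF assms] by (intro stop_maximal) auto
  then show ?thesis using R lev_stop[OF assms] by auto
qed

lemma avg_le_stop: "Q \<in> \<Q> \<Longrightarrow> wavg m f Q \<le> 2 * wavg m f (stp Q)"
  using level_bounds(1)[of Q] stop_avg_ge[of Q] by linarith

text \<open>If \<open>F\<close> is a stopping cube of level \<open>k\<close>, then at least half of the integral of \<open>f\<close> over \<open>F\<close> comes from the
  set where \<open>f > 2\<^bsup>k-1\<^esup>\<close>.  Stopping cubes of one level are disjoint, so at a fixed point at most one of them counts
  for each level \<open>k\<close> with \<open>2\<^bsup>k-1\<^esup> < f\<close>, and the sum over these levels is geometric.\<close>
lemma carleson_embedding:
  assumes "finite X" "\<Union>\<Q> \<subseteq> X" "\<And>x. x \<in> X \<Longrightarrow> 0 \<le> m x" "\<And>x. x \<in> X \<Longrightarrow> 0 \<le> f x" and p: "1 < p"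
  shows "(\<Sum>F\<in>stp ` \<Q>. wavg m f F powr p * wsum m F)
     \<le> (2 powr (2 * p) / (1 - 2 powr (1 - p))) * (\<Sum>x\<in>X. f x powr p * m x)"
proof -
  define T where "T F x = (if x \<in> F \<and> 2 powr (real_of_int (lev F) - 1) < f x then 2 powr (real_of_int (lev F) * (p - 1)) else 0)" for F x
  have finT: "finite (stp ` \<Q>)" by simp
  have 1: "wavg m f F powr p * wsum m F \<le> 2 powr (p + 1) * (\<Sum>x\<in>X. T F x * (f x * m x))" if F: "F \<in> stp ` \<Q>" for F
  proof -
    obtain Q where Q: "Q \<in> \<Q>" "F = stp Q" using F by auto
    have FQ: "F \<in> \<Q>" using Q stop_in by auto
    have FX: "F \<subseteq> X" using FQ assms by auto
    let ?k = "real_of_int (lev F)"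
    have "2 powr ?k \<le> wavg m f F" using stop_avg_ge[OF Q(1)] Q lev_stop by auto
    then have "2 powr ?k * wsum m F \<le> (\<Sum>x\<in>F. f x * m x)"
      using wsum_pos[OF FQ] unfolding wavg_def by (simp add: pos_le_divide_eq)
    also have "\<dots> \<le> (\<Sum>x\<in>F. (if 2 powr (?k - 1) < f x then f x * m x else 0) + 2 powr (?k - 1) * m x)"
      using m_pos[OF FQ] f_nonneg[OF FQ] by (intro sum_mono) (auto intro: mult_right_mono less_imp_le)
    also have "\<dots> = (\<Sum>x\<in>F. (if 2 powr (?k - 1) < f x then f x * m x else 0)) + 2 powr (?k - 1) * wsum m F"
      by (simp add: sum.distrib wsum_def sum_distrib_left)
    finally have a: "2 powr (?k - 1) * wsum m F \<le> (\<Sum>x\<in>F. (if 2 powr (?k - 1) < f x then f x * m x else 0))"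
      by (simp add: powr_diff field_simps)
    have "wavg m f F \<le> 2 * 2 powr ?k" using level_bounds(1)[OF FQ] by simp
    also have "\<dots> = 2 powr (?k + 1)" by (simp add: powr_add)
    finally have "wavg m f F powr p * wsum m F \<le> (2 powr (?k + 1)) powr p * wsum m F"
      using p avg_pos[OF FQ] wsum_pos[OF FQ] by (intro mult_right_mono powr_mono2) auto
    also have "\<dots> = 2 powr (p + 1) * (2 powr (?k * (p - 1)) * (2 powr (?k - 1) * wsum m F))"
      by (simp add: powr_powr algebra_simps flip: powr_add)
    also have "\<dots> \<le> 2 powr (p + 1) * (2 powr (?k * (p - 1)) * (\<Sum>x\<in>F. (if 2 powr (?k - 1) < f x then f x * m x else 0)))"
      by (intro mult_left_mono a) auto
    also have "2 powr (?k * (p - 1)) * (\<Sum>x\<in>F. (if 2 powr (?k - 1) < f x then f x * m x else 0)) = (\<Sum>x\<in>F. T F x * (f x * m x))"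
      unfolding sum_distrib_left T_def by (intro sum.cong) auto
    also have "\<dots> = (\<Sum>x\<in>X. T F x * (f x * m x))"
      using FX assms(1) by (intro sum.mono_neutral_left) (auto simp: T_def)
    finally show ?thesis .
  qed
  have 2: "(\<Sum>F\<in>stp ` \<Q>. T F x) \<le> (2 * f x) powr (p - 1) / (1 - 2 powr (1 - p))" if x: "x \<in> X" for x
  proof (cases "f x > 0")
    case False
    then have "T F x = 0" for F
      by (simp add: T_def) (smt (verit) powr_ge_zero)
    moreover have "2 powr (1 - p) < (1::real)" using p powr_less_mono[of "1-p" 0 "2::real"] by simp
    ultimately show ?thesis by (simp add: divide_nonneg_pos)
  next
    case True
    define S where "S = {F\<in>stp ` \<Q>. x \<in> F \<and> 2 powr (real_of_int (lev F) - 1) < f x}"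
    have inj: "inj_on lev S" unfolding S_def by (intro inj_onI stops_disjoint[of _ _ x]) auto
    have "(\<Sum>F\<in>stp ` \<Q>. T F x) = (\<Sum>F\<in>S. 2 powr (real_of_int (lev F) * (p - 1)))"
      unfolding S_def T_def by (simp add: sum.inter_filter)
    also have "\<dots> = (\<Sum>k\<in>lev ` S. 2 powr (real_of_int k * (p - 1)))"
      using inj by (simp add: sum.reindex)
    also have "\<dots> \<le> (2 * f x) powr (p - 1) / (1 - 2 powr (- (p - 1)))"
      using p True by (intro geometric_sum_int_le) (auto simp: S_def powr_diff)
    finally show ?thesis by simp
  qed
  have "(\<Sum>F\<in>stp ` \<Q>. wavg m f F powr p * wsum m F) \<le> (\<Sum>F\<in>stp ` \<Q>. 2 powr (p + 1) * (\<Sum>x\<in>X. T F x * (f x * m x)))"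
    by (intro sum_mono 1)
  also have "\<dots> = 2 powr (p + 1) * (\<Sum>x\<in>X. (\<Sum>F\<in>stp ` \<Q>. T F x) * (f x * m x))"
    by (simp add: sum_distrib_right sum.swap[of _ X] flip: sum_distrib_left)
  also have "\<dots> \<le> 2 powr (p + 1) * (\<Sum>x\<in>X. ((2 * f x) powr (p - 1) / (1 - 2 powr (1 - p))) * (f x * m x))"
    using assms by (intro mult_left_mono sum_mono mult_right_mono 2) auto
  also have "\<dots> = 2 powr (p + 1) * (\<Sum>x\<in>X. (2 powr (p - 1) / (1 - 2 powr (1 - p))) * (f x powr p * m x))"
  proof (intro arg_cong[of _ _ "(*) (2 powr (p + 1))"] sum.cong refl)
    fix x assume "x \<in> X"
    then have "0 \<le> f x" using assms by auto
    then have "f x powr p = f x powr (p - 1) * f x" by (cases "f x = 0") (auto simp: powr_diff)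
    then show "(2 * f x) powr (p - 1) / (1 - 2 powr (1 - p)) * (f x * m x) = (2 powr (p - 1) / (1 - 2 powr (1 - p))) * (f x powr p * m x)"
      using \<open>0 \<le> f x\<close> by (simp add: powr_mult)
  qed
  also have "\<dots> = ((2 powr (p + 1) * 2 powr (p - 1)) / (1 - 2 powr (1 - p))) * (\<Sum>x\<in>X. f x powr p * m x)"
    by (simp add: sum_distrib_left mult.assoc)
  also have "2 powr (p + 1) * 2 powr (p - 1) = (2::real) powr (2 * p)" by (simp flip: powr_add)
  finally show ?thesis .
qed

end

section \<open>Parallel stopping cubes\<close>

text \<open>The part of the bilinear form in which the stopping cube of \<open>g\<close> lies inside that of \<open>f\<close>.
  On the cubes with a given stopping cube \<open>F\<close> for \<open>f\<close>, the average of \<open>f\<close> is at most twice that over \<open>F\<close>, and the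
  average of \<open>g\<close> is dominated by a function \<open>gs F\<close> built from stopping cubes \<open>G\<close> of \<open>g\<close> that are assigned to \<open>F\<close> alone.
  So Hoelder's inequality and the testing condition on \<open>F\<close> apply, and the sum over \<open>F\<close> is
  controlled by two Carleson embeddings.\<close>
lemma corona_half:
  fixes \<sigma> u f g :: "'a \<Rightarrow> real" and c :: "'a set \<Rightarrow> real"
  assumes "stopping \<Q> \<sigma> f" "stopping \<Q> u g"
    and X: "finite X" "\<Union>\<Q> \<subseteq> X" "\<And>x. x \<in> X \<Longrightarrow> 0 < \<sigma> x" "\<And>x. x \<in> X \<Longrightarrow> 0 < u x"
    and fg: "\<And>x. x \<in> X \<Longrightarrow> 0 \<le> f x" "\<And>x. x \<in> X \<Longrightarrow> 0 \<le> g x"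
    and lam: "\<And>Q. Q \<in> \<Q> \<Longrightarrow> 0 \<le> c Q"
    and pq: "1 < p" "1 < q" "1 \<le> 1/p + (1 - 1/q)" and "0 \<le> T"
    and testing: "\<And>R. R \<in> \<Q> \<Longrightarrow> (\<Sum>x\<in>R. u x * (\<Sum>Q\<in>{Q\<in>\<Q>. x \<in> Q \<and> Q \<subseteq> R}. c Q * wsum \<sigma> Q) powr q) powr (1/q)
           \<le> T * wsum \<sigma> R powr (1/p)"
  defines "q' \<equiv> q / (q - 1)"
  shows "(\<Sum>Q\<in>{Q\<in>\<Q>. stop u g \<Q> Q \<subseteq> stop \<sigma> f \<Q> Q}. c Q * (\<Sum>x\<in>Q. f x * \<sigma> x) * (\<Sum>x\<in>Q. g x * u x))
     \<le> 4 * T * (2 powr (2 * p) / (1 - 2 powr (1 - p)) * (\<Sum>x\<in>X. f x powr p * \<sigma> x)) powr (1/p)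
       * (2 powr (2 * q') / (1 - 2 powr (1 - q')) * (\<Sum>x\<in>X. g x powr q' * u x)) powr (1/q')"
proof -
  interpret f: stopping \<Q> \<sigma> f by fact
  interpret g: stopping \<Q> u g by fact
  have q': "1 < q'" "1/q' = 1 - 1/q" using pq by (auto simp: q'_def field_simps)
  let ?F = "f.stp" and ?G = "g.stp"
  let ?Q = "{Q\<in>\<Q>. ?G Q \<subseteq> ?F Q}"
  define gs where "gs F x = (\<Sum>G\<in>{G\<in>?G ` \<Q>. ?F G = F \<and> x \<in> G}. wavg u g G powr q')" for F x
  have gs0: "0 \<le> gs F x" for F x unfolding gs_def by (intro sum_nonneg) auto
  have avg_f: "0 < wavg \<sigma> f Q" and avg_g: "0 < wavg u g Q" if "Q \<in> \<Q>" for Q using that f.avg_pos g.avg_pos by auto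
  have ws: "0 < wsum \<sigma> Q" and wu: "0 < wsum u Q" if "Q \<in> \<Q>" for Q using that f.wsum_pos g.wsum_pos by auto
  define Tf where "Tf F x = (\<Sum>Q\<in>{Q\<in>\<Q>. x \<in> Q \<and> Q \<subseteq> F}. c Q * wsum \<sigma> Q)" for F x
  have Tf0: "0 \<le> Tf F x" for F x unfolding Tf_def using lam ws by (intro sum_nonneg mult_nonneg_nonneg) (auto intro: less_imp_le)
  have single: "c Q * (\<Sum>x\<in>Q. f x * \<sigma> x) * (\<Sum>x\<in>Q. g x * u x)
     \<le> 4 * wavg \<sigma> f (?F Q) * (c Q * wsum \<sigma> Q * (\<Sum>x\<in>Q. gs (?F Q) x powr (1/q') * u x))" if Q: "Q \<in> ?Q" for Q
  proof -
    have Q': "Q \<in> \<Q>" "?G Q \<subseteq> ?F Q" using Q by auto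
    have "(\<Sum>x\<in>Q. f x * \<sigma> x) = wavg \<sigma> f Q * wsum \<sigma> Q" using ws[OF Q'(1)] by (simp add: wavg_def)
    also have "\<dots> \<le> 2 * wavg \<sigma> f (?F Q) * wsum \<sigma> Q"
      using f.avg_le_stop[OF Q'(1)] ws[OF Q'(1)] by (intro mult_right_mono) auto
    finally have 1: "(\<Sum>x\<in>Q. f x * \<sigma> x) \<le> 2 * wavg \<sigma> f (?F Q) * wsum \<sigma> Q" .
    \<comment> \<open>Each stopping cube of \<open>g\<close> that occurs is thus assigned to a single stopping cube of \<open>f\<close>.\<close>
    have FG: "?F (?G Q) = ?F Q"
      using Q' g.le_stop g.stop_in by (intro f.stop_between) auto
    have "wavg u g (?G Q) \<le> gs (?F Q) x powr (1/q')" if "x \<in> Q" for x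
    proof -
      have "wavg u g (?G Q) powr q' \<le> gs (?F Q) x"
        unfolding gs_def using Q' FG g.le_stop[OF Q'(1)] that by (intro member_le_sum) auto
      then have "(wavg u g (?G Q) powr q') powr (1/q') \<le> gs (?F Q) x powr (1/q')"
        using q'(1) by (intro powr_mono2) auto
      then show ?thesis using q'(1) avg_g[OF g.stop_in[OF Q'(1)]] by (simp add: powr_powr)
    qed
    then have "wavg u g (?G Q) * wsum u Q \<le> (\<Sum>x\<in>Q. gs (?F Q) x powr (1/q') * u x)"
      unfolding wsum_def sum_distrib_left using g.m_pos[OF Q'(1)] by (intro sum_mono mult_right_mono) (auto intro: less_imp_le)
    moreover have "(\<Sum>x\<in>Q. g x * u x) \<le> 2 * wavg u g (?G Q) * wsum u Q"
      using g.avg_le_stop[OF Q'(1)] wu[OF Q'(1)] by (subst pos_divide_le_eq[symmetric]) (auto simp: wavg_def)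
    ultimately have 2: "(\<Sum>x\<in>Q. g x * u x) \<le> 2 * (\<Sum>x\<in>Q. gs (?F Q) x powr (1/q') * u x)" by simp
    have "c Q * ((\<Sum>x\<in>Q. f x * \<sigma> x) * (\<Sum>x\<in>Q. g x * u x)) \<le> c Q * ((2 * wavg \<sigma> f (?F Q) * wsum \<sigma> Q) * (2 * (\<Sum>x\<in>Q. gs (?F Q) x powr (1/q') * u x)))"
      using 1 2 lam[OF Q'(1)] Q' f.f_nonneg f.m_pos g.f_nonneg g.m_pos
      by (intro mult_left_mono mult_mono) (auto intro!: sum_nonneg mult_nonneg_nonneg less_imp_le[OF avg_f[OF f.stop_in]] less_imp_le[OF ws] intro: less_imp_le)
    then show ?thesis by (simp add: mult_ac)
  qed
  have group: "(\<Sum>Q\<in>{Q\<in>?Q. ?F Q = F}. c Q * wsum \<sigma> Q * (\<Sum>x\<in>Q. gs F x powr (1/q') * u x))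
      \<le> T * wsum \<sigma> F powr (1/p) * (\<Sum>x\<in>F. gs F x * u x) powr (1/q')" if F: "F \<in> ?F ` \<Q>" for F
  proof -
    have FQ: "F \<in> \<Q>" using F f.stop_in by auto
    have FX: "finite F" "F \<subseteq> X" using FQ X by auto
    have pos: "0 < u x" if "x \<in> F" for x using that FX X by auto
    have "(\<Sum>Q\<in>{Q\<in>?Q. ?F Q = F}. c Q * wsum \<sigma> Q * (\<Sum>x\<in>Q. gs F x powr (1/q') * u x))
      \<le> (\<Sum>Q\<in>{Q\<in>\<Q>. Q \<subseteq> F}. c Q * wsum \<sigma> Q * (\<Sum>x\<in>Q. gs F x powr (1/q') * u x))"
      using f.le_stop lam ws X gs0
      by (intro sum_mono2) (auto intro!: sum_nonneg mult_nonneg_nonneg intro: less_imp_le less_imp_le[OF g.m_pos])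
    also have "\<dots> = (\<Sum>Q\<in>{Q\<in>\<Q>. Q \<subseteq> F}. \<Sum>x\<in>F. if x \<in> Q then c Q * wsum \<sigma> Q * (gs F x powr (1/q') * u x) else 0)"
    proof (intro sum.cong refl)
      fix Q assume "Q \<in> {Q\<in>\<Q>. Q \<subseteq> F}"
      then have "F \<inter> Q = Q" by auto
      then show "c Q * wsum \<sigma> Q * (\<Sum>x\<in>Q. gs F x powr (1/q') * u x) = (\<Sum>x\<in>F. if x \<in> Q then c Q * wsum \<sigma> Q * (gs F x powr (1/q') * u x) else 0)"
        using FX by (simp add: sum_distrib_left flip: sum.inter_restrict)
    qed
    also have "\<dots> = (\<Sum>x\<in>F. Tf F x * (gs F x powr (1/q') * u x))"
    proof -
      have "(\<Sum>Q\<in>{Q\<in>\<Q>. Q \<subseteq> F}. if x \<in> Q then c Q * wsum \<sigma> Q * (gs F x powr (1/q') * u x) else 0)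
          = Tf F x * (gs F x powr (1/q') * u x)" for x
        unfolding Tf_def sum_distrib_right
        by (subst sum.inter_filter[symmetric]) (auto intro!: sum.cong)
      then show ?thesis by (subst sum.swap) simp
    qed
    also have "\<dots> = (\<Sum>x\<in>F. (u x * Tf F x powr q) powr (1/q) * (gs F x * u x) powr (1 - 1/q))"
    proof (intro sum.cong refl)
      fix x assume x: "x \<in> F"
      have "(u x * Tf F x powr q) powr (1/q) * (gs F x * u x) powr (1/q')
        = Tf F x * gs F x powr (1/q') * (u x powr (1/q) * u x powr (1/q'))"
        using pos[OF x] gs0 Tf0 pq by (simp add: powr_mult powr_powr)
      also have "u x powr (1/q) * u x powr (1/q') = u x"
        using pos[OF x] q' by (simp flip: powr_add)
      finally show "Tf F x * (gs F x powr (1/q') * u x) = (u x * Tf F x powr q) powr (1/q) * (gs F x * u x) powr (1 - 1/q)"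
        using q' by simp
    qed
    also have "\<dots> \<le> (\<Sum>x\<in>F. u x * Tf F x powr q) powr (1/q) * (\<Sum>x\<in>F. gs F x * u x) powr (1 - 1/q)"
      using FX pos pq gs0 by (intro geometric_mean_sum_le) (auto intro!: mult_nonneg_nonneg intro: less_imp_le)
    also have "\<dots> \<le> (T * wsum \<sigma> F powr (1/p)) * (\<Sum>x\<in>F. gs F x * u x) powr (1 - 1/q)"
      using testing[OF FQ] unfolding Tf_def by (intro mult_right_mono) auto
    finally show ?thesis using q' by simp
  qed
  have gsum: "(\<Sum>F\<in>?F ` \<Q>. \<Sum>x\<in>F. gs F x * u x) \<le> (\<Sum>G\<in>?G ` \<Q>. wavg u g G powr q' * wsum u G)"
  proof -
    have "(\<Sum>x\<in>F. gs F x * u x) \<le> (\<Sum>G\<in>{G\<in>?G ` \<Q>. ?F G = F}. wavg u g G powr q' * wsum u G)" if F: "F \<in> ?F ` \<Q>" for F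
    proof -
      have FQ: "F \<in> \<Q>" using F f.stop_in by auto
      have FX: "finite F" "F \<subseteq> X" using FQ X by auto
      have "(\<Sum>x\<in>F. gs F x * u x) = (\<Sum>x\<in>F. \<Sum>G\<in>{G\<in>?G ` \<Q>. ?F G = F}. if x \<in> G then wavg u g G powr q' * u x else 0)"
      proof (intro sum.cong refl)
        fix x
        show "gs F x * u x = (\<Sum>G\<in>{G\<in>?G ` \<Q>. ?F G = F}. if x \<in> G then wavg u g G powr q' * u x else 0)"
          unfolding gs_def sum_distrib_right
          by (subst sum.inter_filter[symmetric]) (auto intro!: sum.cong)
      qed
      also have "\<dots> = (\<Sum>G\<in>{G\<in>?G ` \<Q>. ?F G = F}. \<Sum>x\<in>F. if x \<in> G then wavg u g G powr q' * u x else 0)"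
        by (rule sum.swap)
      also have "\<dots> \<le> (\<Sum>G\<in>{G\<in>?G ` \<Q>. ?F G = F}. wavg u g G powr q' * wsum u G)"
      proof (rule sum_mono)
        fix G assume "G \<in> {G\<in>?G ` \<Q>. ?F G = F}"
        then have G: "G \<in> \<Q>" "finite G" using g.stop_in by auto
        have "(\<Sum>x\<in>F. if x \<in> G then wavg u g G powr q' * u x else 0) = (\<Sum>x\<in>F \<inter> G. wavg u g G powr q' * u x)"
          using FX by (simp add: sum.inter_restrict)
        also have "\<dots> \<le> (\<Sum>x\<in>G. wavg u g G powr q' * u x)"
          using G g.m_pos[OF G(1)] by (intro sum_mono2) (auto intro!: mult_nonneg_nonneg intro: less_imp_le)
        finally show "(\<Sum>x\<in>F. if x \<in> G then wavg u g G powr q' * u x else 0) \<le> wavg u g G powr q' * wsum u G"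
          by (simp add: wsum_def sum_distrib_left)
      qed
      finally show ?thesis .
    qed
    then have "(\<Sum>F\<in>?F ` \<Q>. \<Sum>x\<in>F. gs F x * u x) \<le> (\<Sum>F\<in>?F ` \<Q>. \<Sum>G\<in>{G\<in>?G ` \<Q>. ?F G = F}. wavg u g G powr q' * wsum u G)"
      by (rule sum_mono)
    also have "\<dots> = (\<Sum>G\<in>?G ` \<Q>. wavg u g G powr q' * wsum u G)"
      using g.stop_in by (intro sum.group) auto
    finally show ?thesis .
  qed
  have "(\<Sum>Q\<in>?Q. c Q * (\<Sum>x\<in>Q. f x * \<sigma> x) * (\<Sum>x\<in>Q. g x * u x))
    \<le> (\<Sum>Q\<in>?Q. 4 * wavg \<sigma> f (?F Q) * (c Q * wsum \<sigma> Q * (\<Sum>x\<in>Q. gs (?F Q) x powr (1/q') * u x)))"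
    by (intro sum_mono single)
  also have "\<dots> = (\<Sum>F\<in>?F ` \<Q>. \<Sum>Q\<in>{Q\<in>?Q. ?F Q = F}. 4 * wavg \<sigma> f (?F Q) * (c Q * wsum \<sigma> Q * (\<Sum>x\<in>Q. gs (?F Q) x powr (1/q') * u x)))"
    by (intro sum.group[symmetric]) auto
  also have "\<dots> = (\<Sum>F\<in>?F ` \<Q>. 4 * wavg \<sigma> f F * (\<Sum>Q\<in>{Q\<in>?Q. ?F Q = F}. c Q * wsum \<sigma> Q * (\<Sum>x\<in>Q. gs F x powr (1/q') * u x)))"
    by (intro sum.cong refl) (auto simp: sum_distrib_left intro!: sum.cong)
  also have "\<dots> \<le> (\<Sum>F\<in>?F ` \<Q>. 4 * wavg \<sigma> f F * (T * wsum \<sigma> F powr (1/p) * (\<Sum>x\<in>F. gs F x * u x) powr (1/q')))"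
    using f.stop_in by (intro sum_mono mult_left_mono group) (auto intro!: less_imp_le[OF avg_f])
  also have "\<dots> = 4 * T * (\<Sum>F\<in>?F ` \<Q>. (wavg \<sigma> f F * wsum \<sigma> F powr (1/p)) * (\<Sum>x\<in>F. gs F x * u x) powr (1/q'))"
    by (simp add: sum_distrib_left mult_ac)
  also have "\<dots> \<le> 4 * T * ((\<Sum>F\<in>?F ` \<Q>. (wavg \<sigma> f F * wsum \<sigma> F powr (1/p)) powr p) powr (1/p)
      * (\<Sum>F\<in>?F ` \<Q>. ((\<Sum>x\<in>F. gs F x * u x) powr (1/q')) powr q') powr (1/q'))"
    using \<open>0 \<le> T\<close> f.stop_in pq q' by (intro mult_left_mono Holder_sum) (auto intro!: mult_nonneg_nonneg less_imp_le[OF avg_f])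
  also have "(\<Sum>F\<in>?F ` \<Q>. (wavg \<sigma> f F * wsum \<sigma> F powr (1/p)) powr p) = (\<Sum>F\<in>?F ` \<Q>. wavg \<sigma> f F powr p * wsum \<sigma> F)"
  proof (intro sum.cong refl)
    fix F assume "F \<in> ?F ` \<Q>"
    then have F: "F \<in> \<Q>" using f.stop_in by auto
    show "(wavg \<sigma> f F * wsum \<sigma> F powr (1/p)) powr p = wavg \<sigma> f F powr p * wsum \<sigma> F"
      using avg_f[OF F] ws[OF F] pq by (simp add: powr_mult powr_powr)
  qed
  also have "(\<Sum>F\<in>?F ` \<Q>. ((\<Sum>x\<in>F. gs F x * u x) powr (1/q')) powr q') = (\<Sum>F\<in>?F ` \<Q>. \<Sum>x\<in>F. gs F x * u x)"
  proof (intro sum.cong refl)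
    fix F assume "F \<in> ?F ` \<Q>"
    then have F: "F \<in> \<Q>" using f.stop_in by auto
    have "0 \<le> (\<Sum>x\<in>F. gs F x * u x)" using gs0 g.m_pos[OF F] by (intro sum_nonneg mult_nonneg_nonneg) (auto intro: less_imp_le)
    then show "((\<Sum>x\<in>F. gs F x * u x) powr (1/q')) powr q' = (\<Sum>x\<in>F. gs F x * u x)"
      using q'(1) by (simp add: powr_powr)
  qed
  also have "4 * T * ((\<Sum>F\<in>?F ` \<Q>. wavg \<sigma> f F powr p * wsum \<sigma> F) powr (1/p) * (\<Sum>F\<in>?F ` \<Q>. \<Sum>x\<in>F. gs F x * u x) powr (1/q'))
     \<le> 4 * T * ((2 powr (2 * p) / (1 - 2 powr (1 - p)) * (\<Sum>x\<in>X. f x powr p * \<sigma> x)) powr (1/p)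
       * (2 powr (2 * q') / (1 - 2 powr (1 - q')) * (\<Sum>x\<in>X. g x powr q' * u x)) powr (1/q'))"
  proof (intro mult_left_mono mult_mono powr_mono2)
    show "(\<Sum>F\<in>?F ` \<Q>. wavg \<sigma> f F powr p * wsum \<sigma> F) \<le> 2 powr (2 * p) / (1 - 2 powr (1 - p)) * (\<Sum>x\<in>X. f x powr p * \<sigma> x)"
      using X fg pq by (intro f.carleson_embedding) (auto intro: less_imp_le)
    have "(\<Sum>G\<in>?G ` \<Q>. wavg u g G powr q' * wsum u G) \<le> 2 powr (2 * q') / (1 - 2 powr (1 - q')) * (\<Sum>x\<in>X. g x powr q' * u x)"
      using X fg q' by (intro g.carleson_embedding) (auto intro: less_imp_le)
    then show "(\<Sum>F\<in>?F ` \<Q>. \<Sum>x\<in>F. gs F x * u x) \<le> 2 powr (2 * q') / (1 - 2 powr (1 - q')) * (\<Sum>x\<in>X. g x powr q' * u x)"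
      using gsum by linarith
    show "0 \<le> (\<Sum>F\<in>?F ` \<Q>. wavg \<sigma> f F powr p * wsum \<sigma> F)"
      using f.stop_in by (intro sum_nonneg mult_nonneg_nonneg) (auto intro!: less_imp_le[OF ws])
    show "0 \<le> (\<Sum>F\<in>?F ` \<Q>. \<Sum>x\<in>F. gs F x * u x)"
      using gs0 X f.stop_in by (intro sum_nonneg mult_nonneg_nonneg) (auto intro!: less_imp_le[OF g.m_pos[OF f.stop_in]])
  qed (use pq q' \<open>0 \<le> T\<close> in auto)
  finally show ?thesis by (simp add: mult.assoc)
qed

section \<open>The testing condition on a dyadic tree\<close>

text \<open>The exchange of powers that drives the iteration: a power of the coefficient \<open>M\<^bsup>-r\<^esup> S\<close> times a power of
  \<open>K\<close> divided by the local characteristic is a monomial in volume and masses.\<close>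
lemma power_rearrange:
  fixes M S U K r s t A B :: real
  assumes r: "r = 1/A + 1/B" and w: "0 < M" "0 < S" "0 < U" "0 < K" and AB': "0 < A" "0 < B"
  shows "(M powr (-r) * S) powr s * U * (K / (M powr (-r) * U powr (1/A) * S powr (1/B))) powr t
    = K powr t * (M powr (r * (t - s)) * S powr (s - t/B) * U powr (1 - t/A))"
proof -
  have "ln ((M powr (-r) * S) powr s * U * (K / (M powr (-r) * U powr (1/A) * S powr (1/B))) powr t) = ln (K powr t * (M powr (r * (t - s)) * S powr (s - t/B) * U powr (1 - t/A)))"
    using w by (simp add: ln_mult ln_div ln_powr) (simp add: r algebra_simps add_divide_distrib diff_divide_distrib)
  then show ?thesis using w by (subst (asm) ln_inj_iff) auto
qed

text \<open>The relation \<open>r = 1/A + 1/B\<close> with \<open>r < 1\<close> becomes a pair of conjugate exponents after division by \<open>r\<close>.\<close>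
lemma conjugate_split:
  fixes A B r :: real
  assumes "0 < A" "0 < B" "r = 1/A + 1/B"
  shows "0 < 1/(A*r)" "1/(A*r) < 1" "1 - 1/(A*r) = 1/(B*r)"
proof -
  have r: "0 < r" using assms by (simp add: add_pos_pos)
  have "1/(A*r) + 1/(B*r) = (1/A + 1/B) / r" by (simp only: add_divide_distrib divide_divide_eq_left)
  also have "\<dots> = 1" using r unfolding assms(3)[symmetric] by simp
  finally have e: "1/(A*r) + 1/(B*r) = 1" .
  have "0 < 1/(A*r)" "0 < 1/(B*r)" using assms r by (auto intro!: divide_pos_pos mult_pos_pos)
  with e show "0 < 1/(A*r)" "1/(A*r) < 1" "1 - 1/(A*r) = 1/(B*r)" by linarith+
qed

lemma geometric_tail_le:
  fixes c :: real
  assumes "0 \<le> c" "c < 1"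
  shows "(\<Sum>j\<in>{i..N}. c ^ (j - i)) \<le> 1 / (1 - c)"
proof -
  have "(\<Sum>j\<in>{i..N}. c ^ (j - i)) = (\<Sum>k\<in>(\<lambda>j. j - i) ` {i..N}. c ^ k)"
    by (subst sum.reindex) (auto intro!: inj_onI)
  also have "\<dots> \<le> (\<Sum>k. c ^ k)"
    using assms by (intro sum_le_suminf summable_geometric) auto
  finally show ?thesis using assms by (simp add: suminf_geometric)
qed

text \<open>The discrete model.  The points of \<open>X\<close> stand for the smallest cubes, with volume \<open>m\<close> and masses \<open>\<sigma>\<close> and \<open>u\<close>; the set
  \<open>D j\<close> is the partition into cubes of generation \<open>j\<close>, and \<open>\<theta> = 2\<^bsup>-n\<^esup>\<close>.  The exponents are
  \<open>A = q\<close> and \<open>B = p'\<close>, so that the hypotheses are symmetric in \<open>(A, u)\<close> and \<open>(B, \<sigma>)\<close>.  The assumption \<open>atom\<close> is the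
  trace left by \<open>u\<^bsup>1/q\<^esup> \<sigma>\<^bsup>1/p'\<^esup> = 1\<close>, and \<open>bound\<close> is the condition on the weight.\<close>
locale dyadic_weights =
  fixes X :: "'a set" and D :: "nat \<Rightarrow> 'a set set" and N :: nat and \<theta> V :: real
    and m \<sigma> u :: "'a \<Rightarrow> real" and A B K :: real
  assumes X: "finite X"
    and D_sub: "\<And>j Q. j \<le> N \<Longrightarrow> Q \<in> D j \<Longrightarrow> Q \<subseteq> X \<and> Q \<noteq> {}"
    and D_disj: "\<And>j Q R x. j \<le> N \<Longrightarrow> Q \<in> D j \<Longrightarrow> R \<in> D j \<Longrightarrow> x \<in> Q \<Longrightarrow> x \<in> R \<Longrightarrow> Q = R"
    and D_parent: "\<And>j Q. j < N \<Longrightarrow> Q \<in> D (Suc j) \<Longrightarrow> \<exists>P\<in>D j. Q \<subseteq> P"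
    and \<theta>: "0 < \<theta>" "\<theta> \<le> 1/2" and V: "0 < V"
    and pos: "\<And>x. x \<in> X \<Longrightarrow> 0 < m x" "\<And>x. x \<in> X \<Longrightarrow> 0 < \<sigma> x" "\<And>x. x \<in> X \<Longrightarrow> 0 < u x"
    and vol: "\<And>j Q. j \<le> N \<Longrightarrow> Q \<in> D j \<Longrightarrow> wsum m Q = V * \<theta> ^ j"
    and AB: "1 < A" "1 < B" "1/A + 1/B < 1"
    and atom: "\<And>x. x \<in> X \<Longrightarrow> m x powr (1/A + 1/B) \<le> u x powr (1/A) * \<sigma> x powr (1/B)"
    and bound: "\<And>j Q. j \<le> N \<Longrightarrow> Q \<in> D j \<Longrightarrow>
       wsum u Q powr (1/A) * wsum \<sigma> Q powr (1/B) \<le> K * wsum m Q powr (1/A + 1/B)"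
begin

definition "\<Q> = (\<Union>j\<le>N. D j)"
definition "r = 1/A + 1/B"

lemma AB_pos: "0 < A" "0 < B" using AB by auto

lemma r_bounds: "0 < r" "r < 1"
  using AB by (auto simp: r_def intro: add_pos_pos)

lemmas atom' = atom[folded r_def] and bound' = bound[folded r_def]

lemma nonneg: "x \<in> X \<Longrightarrow> 0 \<le> m x" "x \<in> X \<Longrightarrow> 0 \<le> \<sigma> x" "x \<in> X \<Longrightarrow> 0 \<le> u x"
  using pos by (auto intro: less_imp_le)

lemma in_\<Q>: "Q \<in> \<Q> \<longleftrightarrow> (\<exists>j\<le>N. Q \<in> D j)" unfolding \<Q>_def by auto

lemma fin [simp]: "finite \<Q>" "Q \<in> \<Q> \<Longrightarrow> finite Q"
proof -
  have "\<Q> \<subseteq> Pow X" using D_sub unfolding \<Q>_def by fastforce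
  then show "finite \<Q>" "Q \<in> \<Q> \<Longrightarrow> finite Q" using X by (auto intro: finite_subset)
qed

lemma finD [simp]: "j \<le> N \<Longrightarrow> finite (D j)" 
  by (rule finite_subset[of "D j" \<Q>]) (auto simp: in_\<Q>)

lemma \<Q>_sub: "Q \<in> \<Q> \<Longrightarrow> Q \<subseteq> X" "Q \<in> \<Q> \<Longrightarrow> Q \<noteq> {}" using D_sub by (auto simp: \<Q>_def)

lemma ancestor:
  assumes "i \<le> j" "j \<le> N" "Q \<in> D j" shows "\<exists>P\<in>D i. Q \<subseteq> P"
  using assms
proof (induction "j - i" arbitrary: j Q)
  case 0
  then show ?case by auto
next
  case (Suc k)
  then obtain j' where j': "j = Suc j'" by (cases j) auto
  then obtain P where P: "P \<in> D j'" "Q \<subseteq> P" using D_parent[of j' Q] Suc.prems by auto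
  have "\<exists>S\<in>D i. P \<subseteq> S" using Suc j' P by (intro Suc.hyps(1)[of j']) auto
  then show ?case using P by blast
qed

lemma nested_gen:
  assumes "i \<le> j" "j \<le> N" "Q \<in> D j" "P \<in> D i" "x \<in> Q" "x \<in> P" shows "Q \<subseteq> P"
proof -
  obtain S where "S \<in> D i" "Q \<subseteq> S" using ancestor assms by meson
  then show ?thesis using D_disj[of i S P x] assms by auto
qed

lemma nested: "Q \<in> \<Q> \<Longrightarrow> R \<in> \<Q> \<Longrightarrow> x \<in> Q \<Longrightarrow> x \<in> R \<Longrightarrow> Q \<subseteq> R \<or> R \<subseteq> Q"
  unfolding in_\<Q> using nested_gen by (meson nle_le)

lemma wpos: assumes "Q \<in> \<Q>" shows "0 < wsum m Q" "0 < wsum \<sigma> Q" "0 < wsum u Q"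
  unfolding wsum_def using assms \<Q>_sub[of Q] pos by (auto intro!: sum_pos)

lemma wsum_mono: "Q \<in> \<Q> \<Longrightarrow> R \<in> \<Q> \<Longrightarrow> Q \<subseteq> R \<Longrightarrow> wsum m Q \<le> wsum m R \<and> wsum \<sigma> Q \<le> wsum \<sigma> R \<and> wsum u Q \<le> wsum u R"
  unfolding wsum_def using \<Q>_sub[of R] by (intro conjI sum_mono2) (auto intro: nonneg)

lemma gen_le:
  assumes "i \<le> N" "j \<le> N" "Q \<in> D j" "R \<in> D i" "Q \<subseteq> R" shows "i \<le> j"
proof (rule ccontr)
  assume "\<not> i \<le> j"
  have "wsum m Q \<le> wsum m R" using assms by (intro wsum_mono[THEN conjunct1]) (auto simp: in_\<Q>)
  then have "\<theta> ^ j \<le> \<theta> ^ i" using assms V by (simp add: vol)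
  moreover have "\<theta> ^ i < \<theta> ^ j" using \<theta> \<open>\<not> i \<le> j\<close> by (intro power_strict_decreasing) auto
  ultimately show False by simp
qed

lemma sum_generation_le:
  fixes h :: "'a \<Rightarrow> real"
  assumes R: "R \<in> \<Q>" and j: "j \<le> N" and h: "\<And>x. x \<in> X \<Longrightarrow> 0 \<le> h x"
  shows "(\<Sum>Q\<in>{Q\<in>D j. Q \<subseteq> R}. wsum h Q) \<le> wsum h R"
proof -
  have "(\<Sum>Q\<in>{Q\<in>D j. Q \<subseteq> R}. wsum h Q) = sum h (\<Union>{Q\<in>D j. Q \<subseteq> R})"
  proof -
    have "finite Q" if "Q \<in> D j" for Q using that j by (intro fin(2)) (auto simp: in_\<Q>)
    moreover have "Q \<inter> S = {}" if "Q \<in> D j" "S \<in> D j" "Q \<noteq> S" for Q S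
      using D_disj[OF j, of Q S] that by blast
    ultimately show ?thesis
      unfolding wsum_def by (subst sum.Union_disjoint) auto
  qed
  also have "\<dots> \<le> sum h R" using R \<Q>_sub[of R] h by (intro sum_mono2) auto
  finally show ?thesis by (simp add: wsum_def)
qed

lemma sum_generations:
  fixes h :: "'a set \<Rightarrow> real"
  assumes i: "i \<le> N" "R \<in> D i"
  shows "(\<Sum>Q\<in>{Q\<in>\<Q>. Q \<subseteq> R}. h Q) = (\<Sum>j\<in>{i..N}. \<Sum>Q\<in>{Q\<in>D j. Q \<subseteq> R}. h Q)"
proof -
  have eq: "{Q\<in>\<Q>. Q \<subseteq> R} = (\<Union>j\<in>{i..N}. {Q\<in>D j. Q \<subseteq> R})"
  proof -
    have "i \<le> j" if "j \<le> N" "Q \<in> D j" "Q \<subseteq> R" for j Q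
      using gen_le[OF i(1) that(1,2) i(2) that(3)] .
    then show ?thesis unfolding in_\<Q> by fastforce
  qed
  have dis: "{Q\<in>D j. Q \<subseteq> R} \<inter> {Q\<in>D k. Q \<subseteq> R} = {}" if "j \<in> {i..N}" "k \<in> {i..N}" "j \<noteq> k" for j k
  proof -
    have jk: "j \<le> N" "k \<le> N" using that by auto
    have False if "Q \<in> D j" "Q \<in> D k" for Q
      using gen_le[OF jk that(2) that(1) order_refl] gen_le[OF jk(2,1) that(1) that(2) order_refl] \<open>j \<noteq> k\<close> by linarith
    then show ?thesis by blast
  qed
  show ?thesis unfolding eq
    by (subst sum.UNION_disjoint) (use dis in auto)
qed

definition geom_const :: "real \<Rightarrow> real" where "geom_const d = 3 / (1 - \<theta> powr d)"

text \<open>Relative to \<open>R\<close>, volume and masses of a subcube are numbers \<open>x\<close>, \<open>y\<close>, \<open>z\<close> in \<open>[0, 1]\<close>.  If the exponents are nonnegative with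
  sum at least \<open>1 + d\<close>, then the monomial is at most \<open>x\<^sup>d (x + y + z)\<close>.  Here \<open>x\<^sup>d\<close> decays geometrically in the generation,
  and \<open>x\<close>, \<open>y\<close>, \<open>z\<close> each add up to at most one over the subcubes of a generation.\<close>
lemma tree_sum_le:
  assumes R: "R \<in> \<Q>" and e: "0 \<le> e1" "0 \<le> e2" "0 \<le> e3" and d: "0 < d" "d \<le> e1" "1 + d \<le> e1 + e2 + e3"
  shows "(\<Sum>Q\<in>{Q\<in>\<Q>. Q \<subseteq> R}. wsum m Q powr e1 * wsum \<sigma> Q powr e2 * wsum u Q powr e3)
     \<le> geom_const d * (wsum m R powr e1 * wsum \<sigma> R powr e2 * wsum u R powr e3)"
proof -
  obtain i where i: "i \<le> N" "R \<in> D i" using R in_\<Q> by auto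
  let ?P = "\<lambda>Q. wsum m Q powr e1 * wsum \<sigma> Q powr e2 * wsum u Q powr e3"
  have PR: "0 \<le> ?P R" by auto
  have lt: "\<theta> powr d < 1" using powr_less_mono2[of d \<theta> 1] \<theta> d by simp
  have gen: "(\<Sum>Q\<in>{Q\<in>D j. Q \<subseteq> R}. ?P Q) \<le> 3 * (\<theta> powr d) ^ (j - i) * ?P R" if j: "i \<le> j" "j \<le> N" for j
  proof -
    have each: "?P Q \<le> (\<theta> powr d) ^ (j - i) * ?P R * (wsum m Q / wsum m R + wsum \<sigma> Q / wsum \<sigma> R + wsum u Q / wsum u R)"
      if Q: "Q \<in> {Q\<in>D j. Q \<subseteq> R}" for Q
    proof -
      have QQ: "Q \<in> \<Q>" using Q j by (auto simp: in_\<Q>)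
      note wR = wpos[OF R] and wQ = wpos[OF QQ]
      define x y z where "x = wsum m Q / wsum m R" "y = wsum \<sigma> Q / wsum \<sigma> R" "z = wsum u Q / wsum u R"
      have xyz: "0 < x" "x \<le> 1" "0 < y" "y \<le> 1" "0 < z" "z \<le> 1"
        using wR wQ wsum_mono[OF QQ R] Q by (auto simp: x_y_z_def)
      have "\<theta> ^ j = \<theta> ^ i * \<theta> ^ (j - i)" using j by (simp flip: power_add)
      then have x: "x = \<theta> ^ (j - i)" using vol[OF i] vol[OF j(2), of Q] Q \<theta> V by (simp add: x_y_z_def)
      define M where "M = max x (max y z)"
      have M: "0 < M" "M \<le> 1" "x \<le> M" "y \<le> M" "z \<le> M" "M \<le> x + y + z" using xyz by (auto simp: M_def)
      have "?P Q = (x powr e1 * y powr e2 * z powr e3) * ?P R"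
        using wR wQ by (simp add: x_y_z_def powr_divide)
      also have "x powr e1 = x powr d * x powr (e1 - d)" by (simp flip: powr_add)
      also have "x powr d * x powr (e1 - d) * y powr e2 * z powr e3 * ?P R \<le> x powr d * M powr (e1 - d) * M powr e2 * M powr e3 * ?P R"
        using xyz M d e by (intro mult_right_mono mult_mono powr_mono2 mult_left_mono) auto
      also have "x powr d * M powr (e1 - d) * M powr e2 * M powr e3 = x powr d * M powr (e1 - d + e2 + e3)"
        by (simp add: powr_add mult.assoc)
      also have "x powr d * M powr (e1 - d + e2 + e3) * ?P R \<le> x powr d * M powr 1 * ?P R"
        using M d by (intro mult_right_mono mult_left_mono powr_mono') auto
      also have "\<dots> \<le> x powr d * (x + y + z) * ?P R"
        using M by (intro mult_right_mono mult_left_mono) auto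
      also have "x powr d = (\<theta> powr d) ^ (j - i)" using \<theta> by (simp add: x powr_realpow[symmetric] powr_powr mult.commute)
      finally show ?thesis by (simp add: x_y_z_def mult_ac)
    qed
    have le1: "(\<Sum>Q\<in>{Q\<in>D j. Q \<subseteq> R}. wsum h Q / wsum h R) \<le> 1" if "0 < wsum h R" "\<And>x. x \<in> X \<Longrightarrow> 0 \<le> h x" for h
      using sum_generation_le[OF R j(2), of h] that by (simp add: divide_le_eq flip: sum_divide_distrib)
    have "(\<Sum>Q\<in>{Q\<in>D j. Q \<subseteq> R}. ?P Q) \<le> (\<Sum>Q\<in>{Q\<in>D j. Q \<subseteq> R}. (\<theta> powr d) ^ (j - i) * ?P R * (wsum m Q / wsum m R + wsum \<sigma> Q / wsum \<sigma> R + wsum u Q / wsum u R))"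
      by (intro sum_mono each)
    also have "\<dots> = (\<theta> powr d) ^ (j - i) * ?P R * ((\<Sum>Q\<in>{Q\<in>D j. Q \<subseteq> R}. wsum m Q / wsum m R) + (\<Sum>Q\<in>{Q\<in>D j. Q \<subseteq> R}. wsum \<sigma> Q / wsum \<sigma> R) + (\<Sum>Q\<in>{Q\<in>D j. Q \<subseteq> R}. wsum u Q / wsum u R))"
      by (simp add: sum.distrib flip: sum_distrib_left)
    also have "\<dots> \<le> (\<theta> powr d) ^ (j - i) * ?P R * (1 + 1 + 1)"
      using wpos[OF R] by (intro mult_left_mono add_mono le1) (auto intro: nonneg)
    finally show ?thesis by (simp add: mult_ac)
  qed
  have "(\<Sum>Q\<in>{Q\<in>\<Q>. Q \<subseteq> R}. ?P Q) = (\<Sum>j\<in>{i..N}. \<Sum>Q\<in>{Q\<in>D j. Q \<subseteq> R}. ?P Q)"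
    using i by (rule sum_generations)
  also have "\<dots> \<le> (\<Sum>j\<in>{i..N}. 3 * (\<theta> powr d) ^ (j - i) * ?P R)"
    by (intro sum_mono gen) auto
  also have "\<dots> = 3 * ?P R * (\<Sum>j\<in>{i..N}. (\<theta> powr d) ^ (j - i))"
    by (simp add: sum_distrib_left mult_ac)
  also have "\<dots> \<le> 3 * ?P R * (1 / (1 - \<theta> powr d))"
    using lt by (intro mult_left_mono geometric_tail_le) auto
  finally show ?thesis by (simp add: geom_const_def mult_ac)
qed

text \<open>Applied to a cube, this gives the lower bound \<open>1\<close> for the local characteristic; applied to
  the complement of a child, it yields the loss of mass in \<open>child_decay\<close>.\<close>
lemma atoms_Holder:
  assumes "E \<subseteq> X" shows "wsum m E powr r \<le> wsum u E powr (1/A) * wsum \<sigma> E powr (1/B)"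
proof -
  note r = r_bounds(1) and t01 = conjugate_split[OF _ _ r_def] 
  note t = t01(3)[OF AB_pos]
  have E: "finite E" using assms X by (rule finite_subset)
  have "wsum m E \<le> (\<Sum>x\<in>E. u x powr (1/(A*r)) * \<sigma> x powr (1 - 1/(A*r)))"
    unfolding wsum_def
  proof (rule sum_mono)
    fix x assume "x \<in> E"
    then have x: "x \<in> X" using assms by auto
    have "(m x powr r) powr (1/r) \<le> (u x powr (1/A) * \<sigma> x powr (1/B)) powr (1/r)"
      using r atom'[OF x] by (intro powr_mono2) auto
    then show "m x \<le> u x powr (1/(A*r)) * \<sigma> x powr (1 - 1/(A*r))"
      using pos[OF x] r unfolding t by (simp add: powr_powr powr_mult)
  qed
  also have "\<dots> \<le> wsum u E powr (1/(A*r)) * wsum \<sigma> E powr (1 - 1/(A*r))"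
    unfolding wsum_def using E t01(1,2)[OF AB_pos] assms by (intro geometric_mean_sum_le) (auto intro: nonneg)
  finally have "wsum m E powr r \<le> (wsum u E powr (1/(A*r)) * wsum \<sigma> E powr (1/(B*r))) powr r"
    unfolding t using r assms by (intro powr_mono2) (auto simp: wsum_def intro!: sum_nonneg nonneg)
  then show ?thesis using r by (simp add: powr_mult powr_powr)
qed

text \<open>The quantity whose supremum over cubes is bounded by \<open>K\<close>.\<close>
definition char_ratio :: "'a set \<Rightarrow> real" where
  "char_ratio Q = wsum m Q powr (-r) * wsum u Q powr (1/A) * wsum \<sigma> Q powr (1/B)"

lemma char_ratio_bounds: assumes "Q \<in> \<Q>" shows "1 \<le> char_ratio Q" "char_ratio Q \<le> K"
proof -
  have "wsum m Q powr r > 0" using wpos[OF assms] by simp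
  have char_ratio: "char_ratio Q = (wsum u Q powr (1/A) * wsum \<sigma> Q powr (1/B)) / wsum m Q powr r"
    unfolding char_ratio_def powr_minus_divide by simp
  then show "1 \<le> char_ratio Q" using atoms_Holder[OF \<Q>_sub(1)[OF assms]] wpos[OF assms] by (simp add: char_ratio le_divide_eq divide_le_eq)
  obtain j where "j \<le> N" "Q \<in> D j" using assms in_\<Q> by auto
  from bound'[OF this] show "char_ratio Q \<le> K" using wpos[OF assms] by (simp add: char_ratio le_divide_eq divide_le_eq)
qed

definition coeff :: "'a set \<Rightarrow> real" where "coeff Q = wsum m Q powr (-r) * wsum \<sigma> Q"

lemma coeff_pos: "Q \<in> \<Q> \<Longrightarrow> 0 < coeff Q" using wpos[of Q] by (simp add: coeff_def)

text \<open>The rate \<open>d\<close> at which \<open>tree_sum_le\<close> can be applied in \<open>coeff_sum_le\<close>: the first entry is the exponent of the volume,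
  the second is the excess of the sum of the exponents over \<open>1\<close>.\<close>
definition decay_gap :: "real \<Rightarrow> real" where "decay_gap s = min (r * (min (s * B) A - s)) (s * (1 - r))"

lemma decay_gap_pos: "0 < s \<Longrightarrow> s < A \<Longrightarrow> 0 < decay_gap s"
  using AB r_bounds by (auto simp: decay_gap_def min_def intro!: mult_pos_pos)

text \<open>The total exponent exceeds \<open>1\<close> by \<open>s (1 - r)\<close>, and the three exponents are nonnegative precisely when
  \<open>s \<le> t \<le> min (s B) A\<close>; hence the sum over all subcubes is dominated by the term of the largest cube.  The
  factor \<open>K / char_ratio Q \<ge> 1\<close> is carried along instead of being estimated, because it may be
  spent at the next step.\<close>
lemma coeff_sum_le:
  assumes R: "R \<in> \<Q>" and s: "0 < s" "s < A"
  defines "t \<equiv> min (s * B) A"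
  shows "(\<Sum>Q\<in>{Q\<in>\<Q>. Q \<subseteq> R}. coeff Q powr s * wsum u Q * (K / char_ratio Q) powr t)
     \<le> geom_const (decay_gap s) * (coeff R powr s * wsum u R * (K / char_ratio R) powr t)"
proof -
  have rw: "coeff Q powr s * wsum u Q * (K / char_ratio Q) powr t
    = K powr t * (wsum m Q powr (r * (t - s)) * wsum \<sigma> Q powr (s - t/B) * wsum u Q powr (1 - t/A))" if Q: "Q \<in> \<Q>" for Q
    unfolding coeff_def char_ratio_def using wpos[OF Q] char_ratio_bounds[OF Q] AB by (intro power_rearrange) (auto simp: r_def)
  have st: "s < t" "t \<le> s * B" "t \<le> A" using s AB by (auto simp: t_def)
  note r = r_bounds
  \<comment> \<open>The terms in \<open>t\<close> cancel because \<open>r = 1/A + 1/B\<close>.\<close>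
  have e: "r * (t - s) + (s - t / B) + (1 - t / A) = 1 + s * (1 - r)"
    by (simp add: r_def algebra_simps add_divide_distrib diff_divide_distrib)
  have "(\<Sum>Q\<in>{Q\<in>\<Q>. Q \<subseteq> R}. coeff Q powr s * wsum u Q * (K / char_ratio Q) powr t)
     = K powr t * (\<Sum>Q\<in>{Q\<in>\<Q>. Q \<subseteq> R}. wsum m Q powr (r * (t - s)) * wsum \<sigma> Q powr (s - t/B) * wsum u Q powr (1 - t/A))"
    unfolding sum_distrib_left by (intro sum.cong rw) auto
  also have "\<dots> \<le> K powr t * (geom_const (decay_gap s) * (wsum m R powr (r * (t - s)) * wsum \<sigma> R powr (s - t/B) * wsum u R powr (1 - t/A)))"
  proof (intro mult_left_mono tree_sum_le R)
    show "0 \<le> s - t/B" "0 \<le> 1 - t/A" using st AB by (auto simp: field_simps)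
    show "0 \<le> r * (t - s)" using r st by auto
    show "0 < decay_gap s" using decay_gap_pos s by auto
    show "decay_gap s \<le> r * (t - s)" by (simp add: decay_gap_def t_def)
    show "1 + decay_gap s \<le> r * (t - s) + (s - t / B) + (1 - t / A)" unfolding e by (simp add: decay_gap_def)
  qed auto
  also have "\<dots> = geom_const (decay_gap s) * (coeff R powr s * wsum u R * (K / char_ratio R) powr t)"
    unfolding rw[OF R] by simp
  finally show ?thesis .
qed

text \<open>The function whose \<open>A\<close>-th power is integrated in the testing condition for \<open>R\<close>.\<close>
definition local_sum :: "'a set \<Rightarrow> 'a \<Rightarrow> real" where
  "local_sum R x = (\<Sum>Q\<in>{Q\<in>\<Q>. x \<in> Q \<and> Q \<subseteq> R}. coeff Q)"

lemma swap_sum: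
  fixes h :: "'a set \<Rightarrow> 'a \<Rightarrow> real"
  assumes "R \<in> \<Q>"
  shows "(\<Sum>x\<in>R. u x * (\<Sum>Q\<in>{Q\<in>\<Q>. x \<in> Q \<and> Q \<subseteq> R}. h Q x)) = (\<Sum>Q\<in>{Q\<in>\<Q>. Q \<subseteq> R}. \<Sum>x\<in>Q. u x * h Q x)"
proof -
  have "(\<Sum>Q\<in>{Q\<in>\<Q>. x \<in> Q \<and> Q \<subseteq> R}. u x * h Q x) = (\<Sum>Q\<in>{Q\<in>\<Q>. Q \<subseteq> R}. if x \<in> Q then u x * h Q x else 0)" for x
    by (subst sum.inter_filter[symmetric]) (auto intro!: sum.cong)
  then have "(\<Sum>x\<in>R. u x * (\<Sum>Q\<in>{Q\<in>\<Q>. x \<in> Q \<and> Q \<subseteq> R}. h Q x))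
     = (\<Sum>Q\<in>{Q\<in>\<Q>. Q \<subseteq> R}. \<Sum>x\<in>R. if x \<in> Q then u x * h Q x else 0)"
    unfolding sum_distrib_left by (subst sum.swap) simp
  also have "\<dots> = (\<Sum>Q\<in>{Q\<in>\<Q>. Q \<subseteq> R}. \<Sum>x\<in>Q. u x * h Q x)"
  proof (rule sum.cong[OF refl])
    fix Q assume "Q \<in> {Q\<in>\<Q>. Q \<subseteq> R}"
    then have "R \<inter> Q = Q" by auto
    then show "(\<Sum>x\<in>R. if x \<in> Q then u x * h Q x else 0) = (\<Sum>x\<in>Q. u x * h Q x)"
      using fin(2)[OF assms] by (simp flip: sum.inter_restrict)
  qed
  finally show ?thesis .
qed

text \<open>Apply \<open>powr_sum_chain_le\<close> to the cubes through a point, which form a chain and are ordered by their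
  cardinality.\<close>
lemma local_sum_powr_le:
  assumes R: "R \<in> \<Q>" and s: "1 \<le> s"
  shows "(\<Sum>x\<in>R. u x * local_sum R x powr s) \<le> s * (\<Sum>Q\<in>{Q\<in>\<Q>. Q \<subseteq> R}. coeff Q * (\<Sum>x\<in>Q. u x * local_sum Q x powr (s - 1)))"
proof -
  have "u x * local_sum R x powr s \<le> u x * (s * (\<Sum>Q\<in>{Q\<in>\<Q>. x \<in> Q \<and> Q \<subseteq> R}. coeff Q * local_sum Q x powr (s - 1)))" if x: "x \<in> R" for x
  proof (rule mult_left_mono)
    let ?S = "{Q\<in>\<Q>. x \<in> Q \<and> Q \<subseteq> R}"
    have chain: "Q \<subseteq> P \<longleftrightarrow> card Q \<le> card P" if "Q \<in> ?S" "P \<in> ?S" for Q P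
    proof
      assume "card Q \<le> card P"
      moreover have "Q \<subseteq> P \<or> P \<subseteq> Q" using that nested[of Q P x] by auto
      ultimately show "Q \<subseteq> P" using card_seteq[of Q P] that by auto
    qed (use that in \<open>auto intro: card_mono\<close>)
    have inj: "inj_on card ?S" using chain by (intro inj_onI) (metis (no_types, lifting) order_refl subset_antisym)
    have "local_sum R x powr s \<le> s * (\<Sum>Q\<in>?S. coeff Q * (\<Sum>P\<in>{P\<in>?S. card P \<le> card Q}. coeff P) powr (s - 1))"
      unfolding local_sum_def using inj s by (intro powr_sum_chain_le) (auto intro: less_imp_le[OF coeff_pos])
    also have "\<dots> = s * (\<Sum>Q\<in>?S. coeff Q * local_sum Q x powr (s - 1))"
    proof -
      have "{P\<in>?S. card P \<le> card Q} = {P\<in>\<Q>. x \<in> P \<and> P \<subseteq> Q}" if "Q \<in> ?S" for Q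
        using chain[OF _ that] that by blast
      then have "sum coeff {P\<in>?S. card P \<le> card Q} = local_sum Q x" if "Q \<in> ?S" for Q
        using that unfolding local_sum_def by simp
      then show ?thesis by (intro arg_cong[of _ _ "(*) s"] sum.cong refl) simp
    qed
    finally show "local_sum R x powr s \<le> s * (\<Sum>Q\<in>?S. coeff Q * local_sum Q x powr (s - 1))" .
    show "0 \<le> u x" using x \<Q>_sub[OF R] nonneg by auto
  qed
  then have "(\<Sum>x\<in>R. u x * local_sum R x powr s) \<le> (\<Sum>x\<in>R. u x * (\<Sum>Q\<in>{Q\<in>\<Q>. x \<in> Q \<and> Q \<subseteq> R}. s * (coeff Q * local_sum Q x powr (s - 1))))"
    unfolding sum_distrib_left[of s] by (rule sum_mono)
  also have "\<dots> = (\<Sum>Q\<in>{Q\<in>\<Q>. Q \<subseteq> R}. \<Sum>x\<in>Q. u x * (s * (coeff Q * local_sum Q x powr (s - 1))))"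
    by (rule swap_sum[OF R])
  also have "\<dots> = s * (\<Sum>Q\<in>{Q\<in>\<Q>. Q \<subseteq> R}. coeff Q * (\<Sum>x\<in>Q. u x * local_sum Q x powr (s - 1)))"
    unfolding sum_distrib_left by (intro sum.cong refl) simp
  finally show ?thesis .
qed

primrec iter_const :: "nat \<Rightarrow> real \<Rightarrow> real" where
  "iter_const 0 s = geom_const (decay_gap s)"
| "iter_const (Suc n) s = s * iter_const n (s - 1) * geom_const (decay_gap s)"

lemma geom_const_nonneg: "0 < d \<Longrightarrow> 0 \<le> geom_const d"
  using powr_less_mono2[of d \<theta> 1] \<theta> by (simp add: geom_const_def)

lemma iter_const_nonneg: "real n < s \<Longrightarrow> s < A \<Longrightarrow> 0 \<le> iter_const n s"
  by (induction n arbitrary: s) (auto intro!: mult_nonneg_nonneg geom_const_nonneg decay_gap_pos)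

lemma char_ratio_quot_powr_mono:
  assumes "Q \<in> \<Q>" "a \<le> b" shows "(K / char_ratio Q) powr a \<le> (K / char_ratio Q) powr b"
  using char_ratio_bounds[OF assms(1)] assms(2) by (intro powr_mono) auto

text \<open>Induction on the integer part of the exponent: \<open>local_sum_powr_le\<close> lowers the exponent by one, the induction hypothesis
  replaces the inner integral by the term of its largest cube, and \<open>coeff_sum_le\<close> sums what is left.  The restriction
  \<open>s < A\<close> is essential, since at \<open>s = A\<close> the volume disappears from the monomial.\<close>
lemma local_sum_iterate:
  assumes "real n < s" "s \<le> real n + 1" "s < A" "R \<in> \<Q>"
  shows "(\<Sum>x\<in>R. u x * local_sum R x powr s) \<le> iter_const n s * (coeff R powr s * wsum u R * (K / char_ratio R) powr (min (s * B) A))"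
  using assms
proof (induction n arbitrary: s R)
  case 0
  then have s: "0 < s" "s \<le> 1" by auto
  have "(\<Sum>x\<in>R. u x * local_sum R x powr s) \<le> (\<Sum>x\<in>R. u x * (\<Sum>Q\<in>{Q\<in>\<Q>. x \<in> Q \<and> Q \<subseteq> R}. coeff Q powr s))"
    unfolding local_sum_def using s \<Q>_sub[OF 0(4)]
    by (intro sum_mono mult_left_mono powr_sum_le_sum_powr) (auto intro: less_imp_le[OF coeff_pos] nonneg)
  also have "\<dots> = (\<Sum>Q\<in>{Q\<in>\<Q>. Q \<subseteq> R}. coeff Q powr s * wsum u Q * 1)"
    unfolding swap_sum[OF 0(4)] by (simp add: wsum_def mult.commute sum_distrib_right)
  also have "\<dots> \<le> (\<Sum>Q\<in>{Q\<in>\<Q>. Q \<subseteq> R}. coeff Q powr s * wsum u Q * (K / char_ratio Q) powr (min (s * B) A))"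
  proof (intro sum_mono mult_left_mono)
    fix Q assume Q: "Q \<in> {Q\<in>\<Q>. Q \<subseteq> R}"
    then show "1 \<le> (K / char_ratio Q) powr (min (s * B) A)"
      using char_ratio_bounds[of Q] s AB by (intro ge_one_powr_ge_zero) (auto simp: min_def)
    show "0 \<le> coeff Q powr s * wsum u Q" using Q wpos[of Q] by auto
  qed
  also have "\<dots> \<le> geom_const (decay_gap s) * (coeff R powr s * wsum u R * (K / char_ratio R) powr (min (s * B) A))"
    using 0 s by (intro coeff_sum_le) auto
  finally show ?case by simp
next
  case (Suc n)
  then have s: "1 < s" "s < A" "0 < s" by auto
  have c: "0 \<le> iter_const n (s - 1)" using Suc.prems by (intro iter_const_nonneg) auto
  have "(\<Sum>x\<in>R. u x * local_sum R x powr s) \<le> s * (\<Sum>Q\<in>{Q\<in>\<Q>. Q \<subseteq> R}. coeff Q * (\<Sum>x\<in>Q. u x * local_sum Q x powr (s - 1)))"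
    using Suc.prems s by (intro local_sum_powr_le) auto
  also have "\<dots> \<le> s * (\<Sum>Q\<in>{Q\<in>\<Q>. Q \<subseteq> R}. iter_const n (s - 1) * (coeff Q powr s * wsum u Q * (K / char_ratio Q) powr (min (s * B) A)))"
  proof (intro mult_left_mono sum_mono)
    fix Q assume "Q \<in> {Q\<in>\<Q>. Q \<subseteq> R}"
    then have Q: "Q \<in> \<Q>" by auto
    have "coeff Q * (\<Sum>x\<in>Q. u x * local_sum Q x powr (s - 1))
       \<le> coeff Q * (iter_const n (s - 1) * (coeff Q powr (s - 1) * wsum u Q * (K / char_ratio Q) powr (min ((s - 1) * B) A)))"
      using Suc.prems Q by (intro mult_left_mono Suc.IH) (auto intro: less_imp_le[OF coeff_pos])
    also have "\<dots> \<le> coeff Q * (iter_const n (s - 1) * (coeff Q powr (s - 1) * wsum u Q * (K / char_ratio Q) powr (min (s * B) A)))"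
      using c wpos[OF Q] Q AB by (intro mult_left_mono char_ratio_quot_powr_mono) (auto simp: min_def left_diff_distrib intro: less_imp_le[OF coeff_pos])
    also have "\<dots> = iter_const n (s - 1) * ((coeff Q * coeff Q powr (s - 1)) * wsum u Q * (K / char_ratio Q) powr (min (s * B) A))"
      by (simp add: mult_ac)
    also have "coeff Q * coeff Q powr (s - 1) = coeff Q powr s"
      using coeff_pos[OF Q] by (simp add: powr_diff)
    finally show "coeff Q * (\<Sum>x\<in>Q. u x * local_sum Q x powr (s - 1))
       \<le> iter_const n (s - 1) * (coeff Q powr s * wsum u Q * (K / char_ratio Q) powr (min (s * B) A))" .
  qed (use s in auto)
  also have "\<dots> = s * iter_const n (s - 1) * (\<Sum>Q\<in>{Q\<in>\<Q>. Q \<subseteq> R}. coeff Q powr s * wsum u Q * (K / char_ratio Q) powr (min (s * B) A))"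
    by (simp add: sum_distrib_left mult_ac)
  also have "\<dots> \<le> s * iter_const n (s - 1) * (geom_const (decay_gap s) * (coeff R powr s * wsum u R * (K / char_ratio R) powr (min (s * B) A)))"
    using Suc.prems s c by (intro mult_left_mono coeff_sum_le) auto
  finally show ?case by (simp add: mult_ac)
qed

text \<open>A lower bound for the proportion of the mass of a cube that any of its children misses.\<close>
definition "mass_loss = 2 powr (- (r * B)) * K powr (- B)"

text \<open>The complement of the child has at least half of the volume of \<open>P\<close>.  Hoelder's inequality on that complement
  bounds this volume by \<open>u(P)\<^bsup>1/A\<^esup>\<close> times a power of the mass of the complement, and the condition on the weight
  removes \<open>u(P)\<close>.\<close>
lemma child_decay:
  assumes j: "Suc j \<le> N" and P: "P \<in> D j" and Q: "Q \<in> D (Suc j)" "Q \<subseteq> P"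
  shows "wsum \<sigma> Q \<le> (1 - mass_loss) * wsum \<sigma> P"
proof -
  have PQ: "P \<in> \<Q>" "Q \<in> \<Q>" unfolding in_\<Q> using j P Q by (meson Suc_leD)+
  have KP: "0 < K" using char_ratio_bounds[OF PQ(1)] by linarith
  let ?E = "P - Q"
  have E: "?E \<subseteq> X" using \<Q>_sub[OF PQ(1)] by auto
  have diff: "wsum h ?E = wsum h P - wsum h Q" for h :: "'a \<Rightarrow> real"
    unfolding wsum_def using fin(2)[OF PQ(1)] Q by (intro sum_diff) auto
  have "wsum m Q = \<theta> * wsum m P" using vol[of j P] vol[of "Suc j" Q] assms by simp
  then have "wsum m P / 2 \<le> wsum m ?E" using \<theta> wpos[OF PQ(1)] by (simp add: diff)
  then have "(wsum m P / 2) powr r \<le> wsum m ?E powr r"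
    using r_bounds wpos[OF PQ(1)] by (intro powr_mono2) auto
  also have "\<dots> \<le> wsum u ?E powr (1/A) * wsum \<sigma> ?E powr (1/B)" by (rule atoms_Holder[OF E])
  also have "\<dots> \<le> wsum u P powr (1/A) * wsum \<sigma> ?E powr (1/B)"
  proof (intro mult_right_mono powr_mono2)
    show "wsum u ?E \<le> wsum u P" using diff[of u] wpos[OF PQ(2)] by simp
    have "\<And>x. x \<in> ?E \<Longrightarrow> 0 \<le> u x" using E nonneg by blast
    then show "0 \<le> wsum u ?E" unfolding wsum_def by (rule sum_nonneg)
  qed (use AB in auto)
  finally have 1: "(wsum m P / 2) powr r \<le> wsum u P powr (1/A) * wsum \<sigma> ?E powr (1/B)" .
  have "wsum m P powr r * (2 powr (-r) * wsum \<sigma> P powr (1/B)) = (wsum m P / 2) powr r * wsum \<sigma> P powr (1/B)"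
    using wpos[OF PQ(1)] by (simp add: powr_divide powr_minus field_simps)
  also have "\<dots> \<le> (wsum u P powr (1/A) * wsum \<sigma> ?E powr (1/B)) * wsum \<sigma> P powr (1/B)"
    using 1 by (intro mult_right_mono) auto
  also have "\<dots> = (wsum u P powr (1/A) * wsum \<sigma> P powr (1/B)) * wsum \<sigma> ?E powr (1/B)" by simp
  also have "\<dots> \<le> (K * wsum m P powr r) * wsum \<sigma> ?E powr (1/B)"
    using j P by (intro mult_right_mono bound') auto
  finally have "wsum m P powr r * (2 powr (-r) * wsum \<sigma> P powr (1/B)) \<le> wsum m P powr r * (K * wsum \<sigma> ?E powr (1/B))"
    by (simp add: mult_ac)
  then have "2 powr (-r) * wsum \<sigma> P powr (1/B) \<le> K * wsum \<sigma> ?E powr (1/B)"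
    using wpos[OF PQ(1)] by simp
  then have "(2 powr (-r) * wsum \<sigma> P powr (1/B)) powr B \<le> (K * wsum \<sigma> ?E powr (1/B)) powr B"
    using AB by (intro powr_mono2) auto
  moreover have "0 \<le> wsum \<sigma> ?E" using E unfolding wsum_def by (auto intro!: sum_nonneg nonneg)
  ultimately have "2 powr (-(r * B)) * wsum \<sigma> P \<le> K powr B * wsum \<sigma> ?E"
    using AB wpos[OF PQ(1)] KP by (simp add: powr_mult powr_powr)
  then have "mass_loss * wsum \<sigma> P \<le> wsum \<sigma> ?E"
    using KP by (simp add: mass_loss_def powr_minus_divide[of K] divide_le_eq mult_ac)
  then show ?thesis unfolding diff by (simp add: algebra_simps)
qed

lemma mass_loss_bounds: assumes "R \<in> \<Q>" shows "0 < mass_loss" "mass_loss < 1"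
proof -
  have K: "1 \<le> K" using char_ratio_bounds[OF assms] by linarith
  then show "0 < mass_loss" by (simp add: mass_loss_def)
  have "K powr (-B) \<le> 1" using K AB powr_mono[of "-B" 0 K] by simp
  moreover have "2 powr (-(r*B)) < (1::real)" using r_bounds AB powr_less_mono[of "-(r*B)" 0 "2::real"] by simp
  ultimately have "mass_loss \<le> 2 powr (-(r*B)) * 1" unfolding mass_loss_def by (intro mult_left_mono) auto
  then show "mass_loss < 1" using \<open>2 powr (-(r*B)) < (1::real)\<close> by linarith
qed

lemma mass_decay:
  assumes "i \<le> j" "j \<le> N" "R \<in> D i" "Q \<in> D j" "Q \<subseteq> R"
  shows "wsum \<sigma> Q \<le> (1 - mass_loss) ^ (j - i) * wsum \<sigma> R"
  using assms
proof (induction "j - i" arbitrary: j Q)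
  case 0
  then have "i = j" by auto
  obtain x where "x \<in> Q" using D_sub 0 by fastforce
  then have "Q = R" using D_disj[of j Q R x] 0 \<open>i = j\<close> by auto
  then show ?case using \<open>i = j\<close> by simp
next
  case (Suc k)
  then obtain j' where j': "j = Suc j'" by (cases j) auto
  have RQ: "R \<in> \<Q>" using Suc.prems by (auto simp: in_\<Q> intro: exI[of _ i])
  obtain P where P: "P \<in> D j'" "Q \<subseteq> P" using D_parent[of j' Q] Suc.prems j' by auto
  obtain x where "x \<in> Q" using D_sub[of j Q] Suc.prems by auto
  then have "x \<in> P" "x \<in> R" using P Suc.prems by auto
  then have PR: "P \<subseteq> R" using Suc P j' by (intro nested_gen[of i j' P R x]) auto
  have "wsum \<sigma> Q \<le> (1 - mass_loss) * wsum \<sigma> P" using child_decay[of j' P Q] P Suc.prems j' by auto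
  also have "\<dots> \<le> (1 - mass_loss) * ((1 - mass_loss) ^ (j' - i) * wsum \<sigma> R)"
    using Suc P PR j' mass_loss_bounds[OF RQ] by (intro mult_left_mono Suc.hyps(1)) auto
  also have "\<dots> = (1 - mass_loss) ^ (j - i) * wsum \<sigma> R"
    using j' Suc by (simp add: Suc_diff_le)
  finally show ?case .
qed

text \<open>One factor \<open>\<sigma>(Q)\<close> is summed over a generation, the remaining power \<open>\<sigma>(Q)\<^bsup>t-1\<^esup>\<close> decays geometrically by
  \<open>mass_decay\<close>.  The ratio is close to \<open>1\<close>, which costs the factor \<open>1 / mass_loss\<close>, that is, the power \<open>K\<^sup>B\<close>.\<close>
lemma sigma_power_sum_le:
  assumes R: "R \<in> \<Q>" and t: "1 < t"
  shows "(\<Sum>Q\<in>{Q\<in>\<Q>. Q \<subseteq> R}. wsum \<sigma> Q powr t) \<le> 2 powr (r * B) / min 1 (t - 1) * K powr B * wsum \<sigma> R powr t"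
proof -
  obtain i where i: "i \<le> N" "R \<in> D i" using R in_\<Q> by auto
  have K: "1 \<le> K" using char_ratio_bounds[OF R] by linarith
  note e = mass_loss_bounds[OF R]
  define c where "c = (1 - mass_loss) powr (t - 1)"
  have c: "0 \<le> c" "c \<le> 1 - min 1 (t - 1) * mass_loss"
  proof -
    show "c \<le> 1 - min 1 (t - 1) * mass_loss"
    proof (cases "t - 1 < 1")
      case True
      have "(1 - mass_loss) powr (t - 1) * 1 powr (1 - (t - 1)) \<le> (t - 1) * (1 - mass_loss) + (1 - (t - 1)) * 1"
        using True t e by (intro weighted_mean_ineq) auto
      then show ?thesis using True by (simp add: c_def algebra_simps)
    next
      case False
      have "(1 - mass_loss) powr (t - 1) \<le> (1 - mass_loss) powr 1"
        using False e by (intro powr_mono') auto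
      then show ?thesis using False e by (simp add: c_def)
    qed
  qed (simp add: c_def)
  have me: "0 < min 1 (t - 1) * mass_loss" using e t by auto
  have "(\<Sum>Q\<in>{Q\<in>\<Q>. Q \<subseteq> R}. wsum \<sigma> Q powr t) = (\<Sum>j\<in>{i..N}. \<Sum>Q\<in>{Q\<in>D j. Q \<subseteq> R}. wsum \<sigma> Q powr t)"
    using i by (rule sum_generations)
  also have "\<dots> \<le> (\<Sum>j\<in>{i..N}. c ^ (j - i) * wsum \<sigma> R powr t)"
  proof (rule sum_mono)
    fix j assume "j \<in> {i..N}"
    then have j: "i \<le> j" "j \<le> N" by auto
    have "(\<Sum>Q\<in>{Q\<in>D j. Q \<subseteq> R}. wsum \<sigma> Q powr t) \<le> (\<Sum>Q\<in>{Q\<in>D j. Q \<subseteq> R}. (c ^ (j - i) * wsum \<sigma> R powr (t - 1)) * wsum \<sigma> Q)"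
    proof (rule sum_mono)
      fix Q assume Q: "Q \<in> {Q\<in>D j. Q \<subseteq> R}"
      then have QQ: "Q \<in> \<Q>" using j by (auto simp: in_\<Q>)
      have "wsum \<sigma> Q powr t = wsum \<sigma> Q powr (t - 1) * wsum \<sigma> Q"
        using wpos[OF QQ] by (simp add: powr_diff)
      also have "\<dots> \<le> ((1 - mass_loss) ^ (j - i) * wsum \<sigma> R) powr (t - 1) * wsum \<sigma> Q"
        using wpos[OF QQ] t mass_decay[OF j i(2)] Q by (intro mult_right_mono powr_mono2) auto
      also have "((1 - mass_loss) ^ (j - i) * wsum \<sigma> R) powr (t - 1) = c ^ (j - i) * wsum \<sigma> R powr (t - 1)"
        using e wpos[OF R] by (simp add: c_def powr_mult powr_realpow[symmetric] powr_powr mult.commute)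
      finally show "wsum \<sigma> Q powr t \<le> (c ^ (j - i) * wsum \<sigma> R powr (t - 1)) * wsum \<sigma> Q" .
    qed
    also have "\<dots> = (c ^ (j - i) * wsum \<sigma> R powr (t - 1)) * (\<Sum>Q\<in>{Q\<in>D j. Q \<subseteq> R}. wsum \<sigma> Q)"
      by (simp add: sum_distrib_left)
    also have "\<dots> \<le> (c ^ (j - i) * wsum \<sigma> R powr (t - 1)) * wsum \<sigma> R"
      using c j R by (intro mult_left_mono sum_generation_le) (auto intro: nonneg)
    also have "\<dots> = c ^ (j - i) * wsum \<sigma> R powr t" using wpos[OF R] by (simp add: powr_diff)
    finally show "(\<Sum>Q\<in>{Q\<in>D j. Q \<subseteq> R}. wsum \<sigma> Q powr t) \<le> c ^ (j - i) * wsum \<sigma> R powr t" .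
  qed
  also have "\<dots> = (\<Sum>j\<in>{i..N}. c ^ (j - i)) * wsum \<sigma> R powr t" by (simp add: sum_distrib_right)
  also have "\<dots> \<le> 1 / (1 - c) * wsum \<sigma> R powr t"
    using c me by (intro mult_right_mono geometric_tail_le) auto
  also have "\<dots> \<le> 1 / (min 1 (t - 1) * mass_loss) * wsum \<sigma> R powr t"
    using c me by (intro mult_right_mono frac_le) auto
  also have "1 / (min 1 (t - 1) * mass_loss) = 2 powr (r * B) / min 1 (t - 1) * K powr B"
    using K t by (simp add: mass_loss_def powr_minus field_simps)
  finally show ?thesis .
qed

definition "testing_const = A * iter_const (nat \<lceil>A - 1\<rceil> - 1) (A - 1) * (2 powr (r * B) / min 1 (A - A/B - 1))"

text \<open>At \<open>s = A\<close> one application of \<open>local_sum_powr_le\<close> remains.  In the resulting sum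
  volume and \<open>u\<close>-mass cancel exactly and leave \<open>K\<^sup>A \<Sum> \<sigma>(Q)\<^bsup>A - A/B\<^esup>\<close>, where \<open>A - A/B = q/p > 1\<close>.\<close>
lemma testing:
  assumes R: "R \<in> \<Q>"
  shows "(\<Sum>x\<in>R. u x * local_sum R x powr A) \<le> testing_const * K powr (A + B) * wsum \<sigma> R powr (A - A / B)"
proof -
  \<comment> \<open>The integer part of \<open>A - 1\<close>, except that an integer is rounded down by one, as \<open>local_sum_iterate\<close> requires.\<close>
  define n where "n = nat \<lceil>A - 1\<rceil> - 1"
  have n: "real n < A - 1" "A - 1 \<le> real n + 1" using AB unfolding n_def by linarith+
  have K: "1 \<le> K" using char_ratio_bounds[OF R] by linarith
  have c: "0 \<le> iter_const n (A - 1)" using n by (intro iter_const_nonneg) auto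
  have t: "1 < A - A/B" using AB by (simp add: field_simps)
  have "(\<Sum>x\<in>R. u x * local_sum R x powr A) \<le> A * (\<Sum>Q\<in>{Q\<in>\<Q>. Q \<subseteq> R}. coeff Q * (\<Sum>x\<in>Q. u x * local_sum Q x powr (A - 1)))"
    using R AB by (intro local_sum_powr_le) auto
  also have "\<dots> \<le> A * (\<Sum>Q\<in>{Q\<in>\<Q>. Q \<subseteq> R}. iter_const n (A - 1) * (K powr A * wsum \<sigma> Q powr (A - A/B)))"
  proof (intro mult_left_mono sum_mono)
    fix Q assume "Q \<in> {Q\<in>\<Q>. Q \<subseteq> R}"
    then have Q: "Q \<in> \<Q>" by auto
    have "coeff Q * (\<Sum>x\<in>Q. u x * local_sum Q x powr (A - 1))
       \<le> coeff Q * (iter_const n (A - 1) * (coeff Q powr (A - 1) * wsum u Q * (K / char_ratio Q) powr (min ((A - 1) * B) A)))"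
      using n Q by (intro mult_left_mono local_sum_iterate) (auto intro: less_imp_le[OF coeff_pos])
    also have "\<dots> \<le> coeff Q * (iter_const n (A - 1) * (coeff Q powr (A - 1) * wsum u Q * (K / char_ratio Q) powr A))"
      using c wpos[OF Q] Q AB by (intro mult_left_mono char_ratio_quot_powr_mono) (auto intro: less_imp_le[OF coeff_pos])
    also have "\<dots> = iter_const n (A - 1) * ((coeff Q * coeff Q powr (A - 1)) * wsum u Q * (K / char_ratio Q) powr A)"
      by (simp add: mult_ac)
    also have "coeff Q * coeff Q powr (A - 1) = coeff Q powr A"
      using coeff_pos[OF Q] by (simp add: powr_diff)
    also have "coeff Q powr A * wsum u Q * (K / char_ratio Q) powr A = K powr A * (wsum m Q powr (r * (A - A)) * wsum \<sigma> Q powr (A - A/B) * wsum u Q powr (1 - A/A))"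
      unfolding coeff_def char_ratio_def using wpos[OF Q] char_ratio_bounds[OF Q] AB by (intro power_rearrange) (auto simp: r_def)
    also have "\<dots> = K powr A * wsum \<sigma> Q powr (A - A/B)" using wpos[OF Q] AB by simp
    finally show "coeff Q * (\<Sum>x\<in>Q. u x * local_sum Q x powr (A - 1)) \<le> iter_const n (A - 1) * (K powr A * wsum \<sigma> Q powr (A - A/B))" .
  qed (use AB in auto)
  also have "\<dots> = A * iter_const n (A - 1) * K powr A * (\<Sum>Q\<in>{Q\<in>\<Q>. Q \<subseteq> R}. wsum \<sigma> Q powr (A - A/B))"
    by (simp add: sum_distrib_left mult_ac)
  also have "\<dots> \<le> A * iter_const n (A - 1) * K powr A * (2 powr (r * B) / min 1 (A - A/B - 1) * K powr B * wsum \<sigma> R powr (A - A/B))"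
    using R t c AB by (intro mult_left_mono sigma_power_sum_le) auto
  also have "\<dots> = testing_const * K powr (A + B) * wsum \<sigma> R powr (A - A / B)"
    by (simp add: testing_const_def n_def powr_add mult_ac)
  finally show ?thesis .
qed

lemma testing_const_nonneg: "0 \<le> testing_const"
proof -
  have n: "real (nat \<lceil>A - 1\<rceil> - 1) < A - 1" using AB by linarith
  have "1 < A - A/B" using AB by (simp add: field_simps)
  then show ?thesis unfolding testing_const_def
    using AB n by (intro mult_nonneg_nonneg iter_const_nonneg divide_nonneg_nonneg) auto
qed

end

section \<open>From testing to the strong bound\<close>

context dyadic_weights
begin

lemma swapped: "dyadic_weights X D N \<theta> V m u \<sigma> B A K"
  using X D_sub D_disj D_parent \<theta> V pos vol AB atom bound
  by unfold_locales (simp_all add: add.commute mult.commute)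

lemma testing_norm:
  assumes "R \<in> \<Q>" "\<Q>' \<subseteq> \<Q>"
  shows "(\<Sum>x\<in>R. u x * (\<Sum>Q\<in>{Q\<in>\<Q>'. x \<in> Q \<and> Q \<subseteq> R}. wsum m Q powr (-r) * wsum \<sigma> Q) powr A) powr (1/A)
     \<le> testing_const powr (1/A) * K powr (r * max A B) * wsum \<sigma> R powr (1 - 1/B)"
proof -
  have K: "1 \<le> K" using char_ratio_bounds[OF assms(1)] by linarith
  have u: "0 \<le> u x" if "x \<in> R" for x using that \<Q>_sub[OF assms(1)] nonneg by auto
  have "(\<Sum>x\<in>R. u x * (\<Sum>Q\<in>{Q\<in>\<Q>'. x \<in> Q \<and> Q \<subseteq> R}. wsum m Q powr (-r) * wsum \<sigma> Q) powr A)
     \<le> (\<Sum>x\<in>R. u x * local_sum R x powr A)"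
    unfolding local_sum_def coeff_def using AB assms wpos
    by (intro sum_mono mult_left_mono powr_mono2 sum_mono2 u) (auto intro!: sum_nonneg mult_nonneg_nonneg intro: less_imp_le)
  also have "\<dots> \<le> testing_const * K powr (A + B) * wsum \<sigma> R powr (A - A / B)"
    by (rule testing[OF assms(1)])
  finally have "(\<Sum>x\<in>R. u x * (\<Sum>Q\<in>{Q\<in>\<Q>'. x \<in> Q \<and> Q \<subseteq> R}. wsum m Q powr (-r) * wsum \<sigma> Q) powr A) powr (1/A)
     \<le> (testing_const * K powr (A + B) * wsum \<sigma> R powr (A - A / B)) powr (1/A)"
    using AB by (intro powr_mono2) (auto intro!: sum_nonneg mult_nonneg_nonneg u)
  also have "\<dots> = testing_const powr (1/A) * K powr ((A + B) / A) * wsum \<sigma> R powr ((A - A / B) / A)"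
    using testing_const_nonneg by (simp add: powr_mult powr_powr)
  also have "(A - A / B) / A = 1 - 1/B" using AB by (simp add: field_simps)
  also have "testing_const powr (1/A) * K powr ((A + B) / A) * wsum \<sigma> R powr (1 - 1/B)
     \<le> testing_const powr (1/A) * K powr (r * max A B) * wsum \<sigma> R powr (1 - 1/B)"
  proof (intro mult_right_mono mult_left_mono powr_mono)
    have "(A + B) / A = r * B" using AB by (simp add: r_def field_simps)
    also have "\<dots> \<le> r * max A B" using r_bounds by (intro mult_left_mono) auto
    finally show "(A + B) / A \<le> r * max A B" .
  qed (use K in auto)
  finally show ?thesis .
qed

interpretation sw: dyadic_weights X D N \<theta> V m u \<sigma> B A K
  by (rule swapped)

lemma sw_r: "sw.r = r"
  by (simp add: r_def sw.r_def)

lemma laminar_\<Q>: "laminar \<Q>"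
  unfolding laminar_def
proof (intro conjI ballI impI)
  fix Q R assume "Q \<in> \<Q>" "R \<in> \<Q>" "Q \<inter> R \<noteq> {}"
  then show "Q \<subseteq> R \<or> R \<subseteq> Q" using nested by blast
qed (use fin \<Q>_sub in auto)

definition "carleson_const t = 2 powr (2 * t) / (1 - 2 powr (1 - t) :: real)"

lemma carleson_const_pos: "1 < t \<Longrightarrow> 0 < carleson_const t"
  using powr_less_mono[of "1 - t" 0 "2::real"] by (simp add: carleson_const_def)

definition "strong_const = 4 * (testing_const powr (1/A) + dyadic_weights.testing_const \<theta> B A powr (1/B))
   * carleson_const (B / (B - 1)) powr (1 - 1/B) * carleson_const (A / (A - 1)) powr (1 - 1/A)"

lemma strong_const_nonneg: "0 \<le> strong_const"
  unfolding strong_const_def by (intro mult_nonneg_nonneg add_nonneg_nonneg) auto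

text \<open>Any two stopping cubes of a cube \<open>Q\<close>, one for each function, both contain \<open>Q\<close> and are therefore nested.
  Each of the two cases is an instance of \<open>corona_half\<close>; the second one uses the interpretation \<open>sw\<close> with the roles of
  \<open>(A, u)\<close> and \<open>(B, \<sigma>)\<close> exchanged, and hence the adjoint testing condition.\<close>
lemma bilinear:
  assumes f: "\<And>x. x \<in> X \<Longrightarrow> 0 \<le> f x" and g: "\<And>x. x \<in> X \<Longrightarrow> 0 \<le> g x"
  defines "p \<equiv> B / (B - 1)" and "A' \<equiv> A / (A - 1)"
  shows "(\<Sum>Q\<in>\<Q>. wsum m Q powr (-r) * (\<Sum>x\<in>Q. f x * \<sigma> x) * (\<Sum>x\<in>Q. g x * u x))
    \<le> strong_const * K powr (r * max A B) * (\<Sum>x\<in>X. f x powr p * \<sigma> x) powr (1/p) * (\<Sum>x\<in>X. g x powr A' * u x) powr (1/A')"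
proof -
  have p: "1 < p" "1/p = 1 - 1/B" and A': "1 < A'" "1/A' = 1 - 1/A"
    using AB by (auto simp: p_def A'_def field_simps)
  have sum1: "1 \<le> 1/p + (1 - 1/A)" "1 \<le> 1/A' + (1 - 1/B)" using p A' AB by auto
  \<comment> \<open>Cubes on which one of the functions vanishes contribute nothing, and passing to a subfamily keeps the testing condition.\<close>
  define \<Q>' where "\<Q>' = {Q\<in>\<Q>. 0 < wavg \<sigma> f Q \<and> 0 < wavg u g Q}"
  have sub: "\<Q>' \<subseteq> \<Q>" by (auto simp: \<Q>'_def)
  have in_X: "x \<in> X" if "Q \<in> \<Q>" "x \<in> Q" for x Q using that \<Q>_sub by auto
  have lam': "laminar \<Q>'" using laminar_\<Q> sub unfolding laminar_def by (meson finite_subset subset_iff)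
  have s1: "stopping \<Q>' \<sigma> f"
    by unfold_locales (use lam' pos f in_X sub in \<open>auto simp: \<Q>'_def\<close>)
  have s2: "stopping \<Q>' u g"
    by unfold_locales (use lam' pos g in_X sub in \<open>auto simp: \<Q>'_def\<close>)
  interpret f: stopping \<Q>' \<sigma> f by (rule s1)
  interpret g: stopping \<Q>' u g by (rule s2)
  let ?T = "\<lambda>Q. wsum m Q powr (-r) * (\<Sum>x\<in>Q. f x * \<sigma> x) * (\<Sum>x\<in>Q. g x * u x)"
  let ?L1 = "{Q\<in>\<Q>'. stop u g \<Q>' Q \<subseteq> stop \<sigma> f \<Q>' Q}" and ?L2 = "{Q\<in>\<Q>'. stop \<sigma> f \<Q>' Q \<subseteq> stop u g \<Q>' Q}"
  have fs0: "0 \<le> (\<Sum>x\<in>Q. f x * \<sigma> x)" "0 \<le> (\<Sum>x\<in>Q. g x * u x)" if "Q \<in> \<Q>" for Q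
    using that in_X f g nonneg by (auto intro!: sum_nonneg mult_nonneg_nonneg)
  have T0: "0 \<le> ?T Q" if "Q \<in> \<Q>" for Q using fs0[OF that] by (intro mult_nonneg_nonneg) auto
  let ?P = "(carleson_const p * (\<Sum>x\<in>X. f x powr p * \<sigma> x)) powr (1/p) * (carleson_const A' * (\<Sum>x\<in>X. g x powr A' * u x)) powr (1/A')"
  let ?Km = "K powr (r * max A B)"
  have K0: "0 \<le> ?Km" by simp
  have "(\<Sum>Q\<in>\<Q>. ?T Q) = (\<Sum>Q\<in>\<Q>'. ?T Q)"
  proof (rule sum.mono_neutral_right)
    show "\<forall>Q\<in>\<Q> - \<Q>'. ?T Q = 0"
    proof
      fix Q assume Q: "Q \<in> \<Q> - \<Q>'"
      then have "\<not> 0 < wavg \<sigma> f Q \<or> \<not> 0 < wavg u g Q" by (auto simp: \<Q>'_def)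
      moreover have "0 < wsum \<sigma> Q" "0 < wsum u Q" using wpos Q by auto
      ultimately have "\<not> 0 < (\<Sum>x\<in>Q. f x * \<sigma> x) \<or> \<not> 0 < (\<Sum>x\<in>Q. g x * u x)"
        by (auto simp: wavg_def zero_less_divide_iff)
      then show "?T Q = 0" using fs0[of Q] Q by auto
    qed
  qed (use sub in auto)
  also have "\<dots> \<le> (\<Sum>Q\<in>?L1 \<union> ?L2. ?T Q)"
  proof -
    have "\<Q>' = ?L1 \<union> ?L2"
    proof -
      have "stop u g \<Q>' Q \<subseteq> stop \<sigma> f \<Q>' Q \<or> stop \<sigma> f \<Q>' Q \<subseteq> stop u g \<Q>' Q" if "Q \<in> \<Q>'" for Q
        using f.ancestors_chain[OF that g.stop_in f.stop_in g.le_stop f.le_stop] that by blast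
      then show ?thesis by blast
    qed
    then show ?thesis by simp
  qed
  also have "\<dots> \<le> (\<Sum>Q\<in>?L1. ?T Q) + (\<Sum>Q\<in>?L2. ?T Q)"
    using T0 sub f.fin(1) by (subst sum.union_inter[symmetric]) (auto intro!: sum_nonneg)
  also have "(\<Sum>Q\<in>?L1. ?T Q) \<le> 4 * (testing_const powr (1/A) * ?Km) *
     (2 powr (2 * p) / (1 - 2 powr (1 - p)) * (\<Sum>x\<in>X. f x powr p * \<sigma> x)) powr (1/p)
       * (2 powr (2 * (A / (A - 1))) / (1 - 2 powr (1 - A / (A - 1))) * (\<Sum>x\<in>X. g x powr (A / (A - 1)) * u x)) powr (1/(A / (A - 1)))"
    by (rule corona_half[OF s1 s2 X])
      (use \<Q>_sub sub pos f g p AB sum1 testing_norm[OF subsetD[OF sub] sub] in auto)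
  also have "\<dots> = 4 * (testing_const powr (1/A) * ?Km) * ?P"
    by (simp add: carleson_const_def A'_def)
  also have "(\<Sum>Q\<in>?L2. ?T Q) = (\<Sum>Q\<in>?L2. wsum m Q powr (-r) * (\<Sum>x\<in>Q. g x * u x) * (\<Sum>x\<in>Q. f x * \<sigma> x))"
    by (simp add: mult_ac)
  also have "\<dots> \<le> 4 * (sw.testing_const powr (1/B) * ?Km) *
     (2 powr (2 * A') / (1 - 2 powr (1 - A')) * (\<Sum>x\<in>X. g x powr A' * u x)) powr (1/A')
       * (2 powr (2 * (B / (B - 1))) / (1 - 2 powr (1 - B / (B - 1))) * (\<Sum>x\<in>X. f x powr (B / (B - 1)) * \<sigma> x)) powr (1/(B / (B - 1)))"
    by (rule corona_half[OF s2 s1 X])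
      (use \<Q>_sub sub pos f g A' AB sum1 sw.testing_norm[OF subsetD[OF sub] sub, unfolded sw_r max.commute[of B A]] in auto)
  also have "\<dots> = 4 * (sw.testing_const powr (1/B) * ?Km) * ?P"
    by (simp add: carleson_const_def p_def mult_ac)
  also have "4 * (testing_const powr (1/A) * ?Km) * ?P + 4 * (sw.testing_const powr (1/B) * ?Km) * ?P
     = 4 * (testing_const powr (1/A) + sw.testing_const powr (1/B)) * ?Km * ?P"
    by (simp add: algebra_simps)
  also have "\<dots> = strong_const * ?Km * (\<Sum>x\<in>X. f x powr p * \<sigma> x) powr (1/p) * (\<Sum>x\<in>X. g x powr A' * u x) powr (1/A')"
    using carleson_const_pos[OF p(1)] carleson_const_pos[OF A'(1)] nonneg
    unfolding strong_const_def p_def[symmetric] A'_def[symmetric] p(2)[symmetric] A'(2)[symmetric]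
    by (simp add: powr_mult sum_nonneg)
  finally show ?thesis by simp
qed

text \<open>Duality: apply the bilinear bound to \<open>f = \<mu>/\<sigma>\<close> and to the \<open>(A-1)\<close>-st power of the function to be estimated, and divide by a
  power of the left-hand side, which is finite here.\<close>
theorem strong:
  assumes \<mu>: "\<And>x. x \<in> X \<Longrightarrow> 0 \<le> \<mu> x"
  defines "p \<equiv> B / (B - 1)"
  shows "(\<Sum>x\<in>X. u x * (\<Sum>Q\<in>{Q\<in>\<Q>. x \<in> Q}. wsum m Q powr (-r) * wsum \<mu> Q) powr A) powr (1/A)
    \<le> strong_const * K powr (r * max A B) * (\<Sum>x\<in>X. \<mu> x powr p * \<sigma> x powr (1 - p)) powr (1/p)"
proof -
  have p: "1 < p" using AB by (simp add: p_def field_simps)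
  define A' where "A' = A / (A - 1)"
  have A': "1 < A'" "1/A' = 1 - 1/A" using AB by (auto simp: A'_def field_simps)
  define h where "h x = (\<Sum>Q\<in>{Q\<in>\<Q>. x \<in> Q}. wsum m Q powr (-r) * wsum \<mu> Q)" for x
  have w\<mu>: "0 \<le> wsum \<mu> Q" if "Q \<in> \<Q>" for Q
    unfolding wsum_def using that \<Q>_sub \<mu> by (intro sum_nonneg) auto
  have h0: "0 \<le> h x" for x unfolding h_def using w\<mu> by (intro sum_nonneg) auto
  define S where "S = (\<Sum>x\<in>X. u x * h x powr A)"
  let ?Y = "(\<Sum>x\<in>X. \<mu> x powr p * \<sigma> x powr (1 - p)) powr (1/p)"
  have S0: "0 \<le> S" unfolding S_def using nonneg by (intro sum_nonneg) auto
  have "S = (\<Sum>x\<in>X. \<Sum>Q\<in>\<Q>. if x \<in> Q then wsum m Q powr (-r) * wsum \<mu> Q * (h x powr (A - 1) * u x) else 0)"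
    unfolding S_def
  proof (rule sum.cong[OF refl])
    fix x
    have "u x * h x powr A = h x * (h x powr (A - 1) * u x)"
      using h0[of x] by (cases "h x = 0") (auto simp: powr_diff)
    also have "\<dots> = (\<Sum>Q\<in>\<Q>. if x \<in> Q then wsum m Q powr (-r) * wsum \<mu> Q * (h x powr (A - 1) * u x) else 0)"
      unfolding h_def[of x] sum_distrib_right by (rule sum.inter_filter) simp
    finally show "u x * h x powr A = (\<Sum>Q\<in>\<Q>. if x \<in> Q then wsum m Q powr (-r) * wsum \<mu> Q * (h x powr (A - 1) * u x) else 0)" .
  qed
  also have "\<dots> = (\<Sum>Q\<in>\<Q>. \<Sum>x\<in>X. if x \<in> Q then wsum m Q powr (-r) * wsum \<mu> Q * (h x powr (A - 1) * u x) else 0)"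
    by (rule sum.swap)
  also have "\<dots> = (\<Sum>Q\<in>\<Q>. wsum m Q powr (-r) * (\<Sum>x\<in>Q. (\<mu> x / \<sigma> x) * \<sigma> x) * (\<Sum>x\<in>Q. h x powr (A - 1) * u x))"
  proof (rule sum.cong[OF refl])
    fix Q assume Q: "Q \<in> \<Q>"
    have "(\<Sum>x\<in>Q. (\<mu> x / \<sigma> x) * \<sigma> x) = wsum \<mu> Q"
      unfolding wsum_def using \<Q>_sub[OF Q] pos by (intro sum.cong refl) (metis nonzero_eq_divide_eq order_less_irrefl subsetD)
    moreover have "X \<inter> Q = Q" using \<Q>_sub[OF Q] by auto
    ultimately show "(\<Sum>x\<in>X. if x \<in> Q then wsum m Q powr (-r) * wsum \<mu> Q * (h x powr (A - 1) * u x) else 0)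
      = wsum m Q powr (-r) * (\<Sum>x\<in>Q. (\<mu> x / \<sigma> x) * \<sigma> x) * (\<Sum>x\<in>Q. h x powr (A - 1) * u x)"
      using X by (simp add: sum_distrib_left flip: sum.inter_restrict)
  qed
  also have "\<dots> \<le> strong_const * K powr (r * max A B) * (\<Sum>x\<in>X. (\<mu> x / \<sigma> x) powr p * \<sigma> x) powr (1/p) * (\<Sum>x\<in>X. (h x powr (A - 1)) powr A' * u x) powr (1/A')"
    unfolding p_def A'_def using \<mu> nonneg by (intro bilinear) auto
  also have "(\<Sum>x\<in>X. (\<mu> x / \<sigma> x) powr p * \<sigma> x) = (\<Sum>x\<in>X. \<mu> x powr p * \<sigma> x powr (1 - p))"
  proof (rule sum.cong[OF refl])
    fix x assume "x \<in> X"
    then show "(\<mu> x / \<sigma> x) powr p * \<sigma> x = \<mu> x powr p * \<sigma> x powr (1 - p)"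
      using \<mu>[of x] pos(2)[of x] by (simp add: powr_divide powr_diff)
  qed
  also have "(\<Sum>x\<in>X. (h x powr (A - 1)) powr A' * u x) = S"
    unfolding S_def using AB by (intro sum.cong refl) (simp add: powr_powr A'_def)
  finally have le: "S \<le> strong_const * K powr (r * max A B) * ?Y * S powr (1/A')" .
  have "S powr (1/A) \<le> strong_const * K powr (r * max A B) * ?Y"
  proof (cases "S = 0")
    case True
    then show ?thesis using strong_const_nonneg by simp
  next
    case False
    then have S: "0 < S" using S0 by auto
    have "S powr (1/A) * S powr (1/A') = S" using S A' by (simp flip: powr_add)
    with le have "S powr (1/A) * S powr (1/A') \<le> (strong_const * K powr (r * max A B) * ?Y) * S powr (1/A')" by simp
    then show ?thesis using S by (simp add: mult_le_cancel_right)
  qed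
  then show ?thesis by (simp add: S_def h_def)
qed

end

section \<open>Shifted dyadic grids\<close>

lemma nn_integral_geometric_mean:
  fixes a b :: "'a \<Rightarrow> real"
  assumes [measurable]: "a \<in> borel_measurable M" "b \<in> borel_measurable M"
    and nn: "\<And>x. 0 \<le> a x" "\<And>x. 0 \<le> b x" and t: "0 < t" "t < 1"
    and I: "(\<integral>\<^sup>+x. ennreal (a x) \<partial>M) = ennreal \<alpha>" "(\<integral>\<^sup>+x. ennreal (b x) \<partial>M) = ennreal \<beta>" "0 \<le> \<alpha>" "0 \<le> \<beta>"
  shows "(\<integral>\<^sup>+x. ennreal (a x powr t * b x powr (1 - t)) \<partial>M) \<le> ennreal (\<alpha> powr t * \<beta> powr (1 - t))"
proof (cases "\<alpha> = 0 \<or> \<beta> = 0")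
  case True
  then have "(AE x in M. a x = 0) \<or> (AE x in M. b x = 0)"
    using I nn by (auto simp: nn_integral_0_iff_AE ennreal_eq_0_iff order_class.antisym_conv)
  then have "AE x in M. a x powr t * b x powr (1 - t) = 0"
    by (auto elim: eventually_mono)
  then have "(\<integral>\<^sup>+x. ennreal (a x powr t * b x powr (1 - t)) \<partial>M) = 0"
    by (subst nn_integral_0_iff_AE) (auto elim: eventually_mono)
  then show ?thesis by simp
next
  case False
  then have pos: "0 < \<alpha>" "0 < \<beta>" using I by auto
  define c where "c = \<alpha> powr t * \<beta> powr (1 - t)"
  have c: "0 < c" using pos by (simp add: c_def)
  have pw: "a x powr t * b x powr (1 - t) \<le> c * (t / \<alpha>) * a x + c * ((1 - t) / \<beta>) * b x" for x
  proof -
    have "(a x / \<alpha>) powr t * (b x / \<beta>) powr (1 - t) \<le> t * (a x / \<alpha>) + (1 - t) * (b x / \<beta>)"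
      using nn pos t by (intro weighted_mean_ineq) auto
    then have "c * ((a x / \<alpha>) powr t * (b x / \<beta>) powr (1 - t)) \<le> c * (t * (a x / \<alpha>) + (1 - t) * (b x / \<beta>))"
      using c by (intro mult_left_mono) auto
    moreover have "c * ((a x / \<alpha>) powr t * (b x / \<beta>) powr (1 - t)) = a x powr t * b x powr (1 - t)"
      using nn pos by (simp add: powr_divide c_def)
    ultimately show ?thesis by (simp add: algebra_simps)
  qed
  have "(\<integral>\<^sup>+x. ennreal (a x powr t * b x powr (1 - t)) \<partial>M)
     \<le> (\<integral>\<^sup>+x. ennreal (c * (t / \<alpha>)) * ennreal (a x) + ennreal (c * ((1 - t) / \<beta>)) * ennreal (b x) \<partial>M)"
    using pw nn c pos t by (intro nn_integral_mono) (simp add: ennreal_mult[symmetric] ennreal_plus[symmetric] del: ennreal_plus)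
  also have "\<dots> = ennreal (c * (t / \<alpha>)) * ennreal \<alpha> + ennreal (c * ((1 - t) / \<beta>)) * ennreal \<beta>"
    by (subst nn_integral_add) (auto simp: nn_integral_cmult I)
  also have "\<dots> = ennreal (c * t + c * (1 - t))"
    using c pos t by (simp add: ennreal_mult[symmetric] ennreal_plus[symmetric] del: ennreal_plus)
  also have "c * t + c * (1 - t) = c" by (simp add: algebra_simps)
  finally show ?thesis by (simp add: c_def)
qed

text \<open>Half-open cubes, which tile the space without overlap.\<close>
definition hcube :: "real ^ 'n \<Rightarrow> real \<Rightarrow> (real ^ 'n) set" where
  "hcube a h = {x. \<forall>i. a $ i \<le> x $ i \<and> x $ i < a $ i + h}"

lemma One_nth [simp]: "(\<Sum>b\<in>Basis. (b :: real ^ 'n) $ i) = 1"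
  unfolding sum_component[symmetric] by (simp add: cart_eq_inner_axis inner_sum_left_Basis del: sum_component)

lemma hcube_sub: "hcube a h \<subseteq> cbox a (a + h *\<^sub>R One)" "box a (a + h *\<^sub>R One) \<subseteq> hcube a h"
  unfolding hcube_def by (auto simp: mem_box_cart less_imp_le)

lemma hcube_sets [measurable]: "hcube a h \<in> sets borel"
  unfolding hcube_def by measurable

lemma hcube_measure:
  assumes "0 \<le> h" shows "emeasure lborel (hcube (a :: real ^ 'n) h) = ennreal (h ^ CARD('n))"
proof (rule antisym)
  have "emeasure lborel (hcube a h) \<le> emeasure lborel (cbox a (a + h *\<^sub>R One))"
    by (intro emeasure_mono hcube_sub) auto
  also have "\<dots> = ennreal (h ^ CARD('n))" using assms
    by (subst emeasure_lborel_cbox) (auto simp: inner_simps)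
  finally show "emeasure lborel (hcube a h) \<le> ennreal (h ^ CARD('n))" .
  have "ennreal (h ^ CARD('n)) = emeasure lborel (box a (a + h *\<^sub>R One))" using assms
    by (subst emeasure_lborel_box) (auto simp: inner_simps)
  also have "\<dots> \<le> emeasure lborel (hcube a h)"
    by (intro emeasure_mono hcube_sub) auto
  finally show "ennreal (h ^ CARD('n)) \<le> emeasure lborel (hcube a h)" .
qed

definition side :: "nat \<Rightarrow> nat \<Rightarrow> real" where "side N j = 2 ^ N / 2 ^ j"

text \<open>The cells of generation \<open>j\<close> in the grid with origin \<open>v\<close> have side \<open>2\<^sup>N / 2\<^sup>j\<close>; generation \<open>2 * N\<close>, with side
  \<open>2\<^bsup>-N\<^esup>\<close>, is the finest one.\<close>
definition cell_index :: "real ^ 'n \<Rightarrow> nat \<Rightarrow> nat \<Rightarrow> real ^ 'n \<Rightarrow> int ^ 'n" where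
  "cell_index v N j x = (\<chi> i. \<lfloor>(x $ i - v $ i) / side N j\<rfloor>)"

text \<open>The index of the cell of generation \<open>j\<close> that contains the smallest cell with index \<open>a\<close>.\<close>
definition coarsen :: "nat \<Rightarrow> nat \<Rightarrow> int ^ 'n \<Rightarrow> int ^ 'n" where
  "coarsen N j a = (\<chi> i. a $ i div 2 ^ (2 * N - j))"

text \<open>The bounds are those of a union of cells of every generation (lemma \<open>atoms_coarsen\<close>), and they leave room for translating
  the box \<open>|x\<^sub>i| \<le> 2\<^sup>N\<close> by up to \<open>2\<^sup>N / 3\<close> (lemma \<open>cell_index_atoms\<close>).\<close>
definition atoms :: "nat \<Rightarrow> (int ^ 'n) set" where
  "atoms N = {a. \<forall>i. - (2 * 2 ^ (2 * N)) \<le> a $ i \<and> a $ i < 2 * 2 ^ (2 * N)}"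

definition generation :: "nat \<Rightarrow> nat \<Rightarrow> (int ^ 'n) set set" where
  "generation N j = (\<lambda>a. {b \<in> atoms N. coarsen N j b = coarsen N j a}) ` atoms N"

lemma side_pos [simp]: "0 < side N j" by (simp add: side_def)

lemma finite_atoms: "finite (atoms N :: (int ^ 'n) set)"
proof -
  let ?I = "{- (2 * 2 ^ (2 * N)) ..< 2 * 2 ^ (2 * N)} :: int set"
  have "(\<lambda>a::int^'n. ($) a) ` atoms N \<subseteq> {f. range f \<subseteq> ?I}"
    by (auto simp: atoms_def)
  moreover have "finite {f :: 'n \<Rightarrow> int. range f \<subseteq> ?I}"
    using finite_set_of_finite_funs[of "UNIV :: 'n set" ?I undefined] by (auto simp: image_subset_iff)
  ultimately have "finite ((\<lambda>a::int^'n. ($) a) ` atoms N)" by (rule finite_subset)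
  then show ?thesis by (rule finite_imageD) (auto intro!: inj_onI simp: vec_eq_iff)
qed

lemma finite_generation: "Q \<in> generation N j \<Longrightarrow> finite Q"
  by (auto simp: generation_def intro: finite_subset[OF _ finite_atoms])

lemma cell_index_eq: "{x. cell_index v N j x = c} = hcube (v + side N j *\<^sub>R (\<chi> i. real_of_int (c $ i))) (side N j)"
proof -
  have "\<lfloor>(x $ i - v $ i) / side N j\<rfloor> = c $ i \<longleftrightarrow> v $ i + side N j * c $ i \<le> x $ i \<and> x $ i < v $ i + side N j * c $ i + side N j" for x i
  proof -
    have "\<lfloor>(x $ i - v $ i) / side N j\<rfloor> = c $ i \<longleftrightarrow> real_of_int (c $ i) \<le> (x $ i - v $ i) / side N j \<and> (x $ i - v $ i) / side N j < real_of_int (c $ i) + 1"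
      by (simp add: floor_eq_iff)
    also have "\<dots> \<longleftrightarrow> v $ i + side N j * c $ i \<le> x $ i \<and> x $ i < v $ i + side N j * c $ i + side N j"
      using side_pos[of N j] by (simp add: pos_le_divide_eq pos_divide_less_eq algebra_simps)
    finally show ?thesis .
  qed
  then show ?thesis by (auto simp: cell_index_def hcube_def vec_eq_iff)
qed

lemma coarsen_cell_index: "j \<le> 2 * N \<Longrightarrow> coarsen N j (cell_index v N (2 * N) x) = cell_index v N j x"
proof -
  assume j: "j \<le> 2 * N"
  have "\<lfloor>y / side N j\<rfloor> = \<lfloor>y / side N (2 * N)\<rfloor> div 2 ^ (2 * N - j)" for y
  proof -
    have "(2::real) ^ (2 * N) = 2 ^ j * 2 ^ (2 * N - j)" using j by (simp flip: power_add)
    then have "y / side N j = (y / side N (2 * N)) / real_of_int (2 ^ (2 * N - j))"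
      by (simp add: side_def)
    moreover have "\<lfloor>(y / side N (2 * N)) / real_of_int (2 ^ (2 * N - j))\<rfloor> = \<lfloor>y / side N (2 * N)\<rfloor> div 2 ^ (2 * N - j)"
      by (rule floor_divide_real_eq_div) simp
    ultimately show ?thesis by metis
  qed
  then show ?thesis by (simp add: coarsen_def cell_index_def vec_eq_iff)
qed

lemma coarsen_Suc: "coarsen N (Suc j) a = coarsen N (Suc j) b \<Longrightarrow> Suc j \<le> 2 * N \<Longrightarrow> coarsen N j a = coarsen N j b"
proof -
  assume eq: "coarsen N (Suc j) a = coarsen N (Suc j) b" and j: "Suc j \<le> 2 * N"
  have "x div 2 ^ (2 * N - j) = (x div 2 ^ (2 * N - Suc j)) div 2" for x :: int
  proof -
    have "2 * N - j = Suc (2 * N - Suc j)" using j by simp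
    then have e: "(2::int) ^ (2 * N - j) = 2 ^ (2 * N - Suc j) * 2" by simp
    show ?thesis unfolding e by (rule zdiv_zmult2_eq) simp
  qed
  with eq show ?thesis by (simp add: coarsen_def vec_eq_iff)
qed

lemma atoms_coarsen:
  assumes "a \<in> atoms N" "coarsen N j b = coarsen N j a" "j \<le> 2 * N" shows "b \<in> atoms N"
proof -
  define M :: int where "M = 2 ^ (2 * N - j)"
  have M: "0 < M" by (simp add: M_def)
  have big: "(2::int) * 2 ^ (2 * N) = (2 * 2 ^ j) * M"
    using assms(3) by (simp add: M_def flip: power_add)
  have "- ((2 * 2 ^ j) * M) \<le> b $ i \<and> b $ i < (2 * 2 ^ j) * M" for i
  proof -
    have a: "- ((2 * 2 ^ j) * M) \<le> a $ i" "a $ i < (2 * 2 ^ j) * M"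
      using assms(1) unfolding atoms_def big by auto
    have eq: "b $ i div M = a $ i div M" using assms(2) by (simp add: coarsen_def vec_eq_iff M_def)
    have "- (2 * 2 ^ j) * M div M \<le> a $ i div M" using a M by (intro zdiv_mono1) auto
    moreover have "- (2 * 2 ^ j) * M div M = - (2 * 2 ^ j)"
      using M by (intro nonzero_mult_div_cancel_right) auto
    ultimately have 1: "- (2 * 2 ^ j) \<le> a $ i div M" by simp
    have 2: "a $ i div M < 2 * 2 ^ j"
    proof (rule ccontr)
      assume "\<not> a $ i div M < 2 * 2 ^ j"
      then have "(2 * 2 ^ j) * M \<le> (a $ i div M) * M" using M by (intro mult_right_mono) auto
      also have "\<dots> \<le> a $ i" using M div_mult_mod_eq[of "a $ i" M] pos_mod_sign[of M "a $ i"] by linarith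
      finally show False using a by linarith
    qed
    have b: "b $ i = M * (b $ i div M) + b $ i mod M" "0 \<le> b $ i mod M" "b $ i mod M < M" using M by auto
    have "M * (- (2 * 2 ^ j)) \<le> M * (b $ i div M)" using 1 M eq by (intro mult_left_mono) auto
    moreover have "M * (b $ i div M) \<le> M * (2 * 2 ^ j - 1)" using 2 M eq by (intro mult_left_mono) auto
    moreover have "M * (2 * 2 ^ j - 1) = (2 * 2 ^ j) * M - M" "M * (- (2 * 2 ^ j)) = - ((2 * 2 ^ j) * M)"
      by (simp_all add: algebra_simps)
    ultimately show ?thesis using b by linarith
  qed
  then show ?thesis unfolding atoms_def big by auto
qed

lemma generation_cell:
  assumes "j \<le> 2 * N" "Q \<in> generation N j"
  obtains c where "{x. cell_index v N (2 * N) x \<in> Q} = {x. cell_index v N j x = c}"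
proof -
  obtain a where a: "a \<in> atoms N" "Q = {b \<in> atoms N. coarsen N j b = coarsen N j a}"
    using assms by (auto simp: generation_def)
  have "cell_index v N (2 * N) x \<in> Q \<longleftrightarrow> cell_index v N j x = coarsen N j a" for x
    using a atoms_coarsen[OF a(1) _ assms(1)] coarsen_cell_index[OF assms(1), of v x] by auto
  then show ?thesis by (intro that) auto
qed

lemma cell_sets [measurable]: "{x. cell_index v N j x = c} \<in> sets borel"
  unfolding cell_index_eq by measurable

lemma nn_integral_atoms:
  fixes g :: "real ^ 'n \<Rightarrow> ennreal"
  assumes [measurable]: "g \<in> borel_measurable borel" and "finite Q"
  shows "(\<integral>\<^sup>+x. g x * indicator {x. cell_index v N j x \<in> Q} x \<partial>lborel) = (\<Sum>a\<in>Q. \<integral>\<^sup>+x. g x * indicator {x. cell_index v N j x = a} x \<partial>lborel)"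
proof -
  have "indicator {x. cell_index v N j x \<in> Q} x = (\<Sum>a\<in>Q. indicator {x. cell_index v N j x = a} x :: ennreal)" for x
    using assms(2) by (cases "cell_index v N j x \<in> Q") (auto simp: indicator_def sum.delta' sum.delta)
  then show ?thesis
    by (simp add: sum_distrib_left nn_integral_sum)
qed

text \<open>A positive Borel weight that satisfies the condition on half-open cubes, with the conventions
  \<open>A = q\<close>, \<open>B = p'\<close> and \<open>K = [w]\<^bsup>1/q\<^esup>\<close>.\<close>
locale cube_weight =
  fixes w :: "real ^ 'n \<Rightarrow> real" and A B K :: real
  assumes w_meas [measurable]: "w \<in> borel_measurable borel"
    and w_pos: "\<And>x. 0 < w x"
    and AB: "1 < A" "1 < B" "1/A + 1/B < 1"
    and fin_u: "\<And>a h. 0 < h \<Longrightarrow> (\<integral>\<^sup>+x. ennreal (w x powr A) * indicator (hcube a h) x \<partial>lborel) < \<infinity>"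
    and fin_s: "\<And>a h. 0 < h \<Longrightarrow> (\<integral>\<^sup>+x. ennreal (w x powr (-B)) * indicator (hcube a h) x \<partial>lborel) < \<infinity>"
    and bnd: "\<And>a h. 0 < h \<Longrightarrow>
       enn2real (\<integral>\<^sup>+x. ennreal (w x powr A) * indicator (hcube a h) x \<partial>lborel) powr (1/A) *
       enn2real (\<integral>\<^sup>+x. ennreal (w x powr (-B)) * indicator (hcube a h) x \<partial>lborel) powr (1/B)
        \<le> K * (h ^ CARD('n)) powr (1/A + 1/B)"
begin

definition "p = B / (B - 1)"

definition cell_mass :: "(real ^ 'n \<Rightarrow> real) \<Rightarrow> real ^ 'n \<Rightarrow> nat \<Rightarrow> int ^ 'n \<Rightarrow> real" where
  "cell_mass g v N a = enn2real (\<integral>\<^sup>+x. ennreal (g x) * indicator {x. cell_index v N (2 * N) x = a} x \<partial>lborel)"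

abbreviation "wu \<equiv> (\<lambda>x. w x powr A)"
abbreviation "ws \<equiv> (\<lambda>x. w x powr (-B))"

lemma wsum_cell_mass:
  assumes [measurable]: "g \<in> borel_measurable borel" and "finite Q"
    and fin: "\<And>a. (\<integral>\<^sup>+x. ennreal (g x) * indicator {x. cell_index v N (2 * N) x = a} x \<partial>lborel) < \<infinity>"
  shows "wsum (cell_mass g v N) Q = enn2real (\<integral>\<^sup>+x. ennreal (g x) * indicator {x. cell_index v N (2 * N) x \<in> Q} x \<partial>lborel)"
  unfolding wsum_def cell_mass_def using assms(2)
  by (subst nn_integral_atoms) (auto simp: enn2real_sum fin[simplified])

lemma fin_cell_u: "(\<integral>\<^sup>+x. ennreal (wu x) * indicator {x. cell_index v N j x = a} x \<partial>lborel) < \<infinity>"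
  unfolding cell_index_eq by (intro fin_u) simp

lemma fin_cell_s: "(\<integral>\<^sup>+x. ennreal (ws x) * indicator {x. cell_index v N j x = a} x \<partial>lborel) < \<infinity>"
  unfolding cell_index_eq by (intro fin_s) simp

lemma cell_measure: "emeasure lborel {x :: real ^ 'n. cell_index v N j x = a} = ennreal (side N j ^ CARD('n))"
  unfolding cell_index_eq by (intro hcube_measure) (simp add: less_imp_le)

lemma cell_mass_pos:
  assumes [measurable]: "g \<in> borel_measurable borel" and "\<And>x. 0 < g x"
    and fin: "(\<integral>\<^sup>+x. ennreal (g x) * indicator {x. cell_index v N (2 * N) x = a} x \<partial>lborel) < \<infinity>"
  shows "0 < cell_mass g v N a"
proof -
  have "(\<integral>\<^sup>+x. ennreal (g x) * indicator {x. cell_index v N (2 * N) x = a} x \<partial>lborel) \<noteq> 0"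
  proof
    assume "(\<integral>\<^sup>+x. ennreal (g x) * indicator {x. cell_index v N (2 * N) x = a} x \<partial>lborel) = 0"
    then have "AE x in lborel. ennreal (g x) * indicator {x. cell_index v N (2 * N) x = a} x = 0"
      by (subst (asm) nn_integral_0_iff_AE) auto
    moreover have "x \<notin> {x. cell_index v N (2 * N) x = a}" if "ennreal (g x) * indicator {x. cell_index v N (2 * N) x = a} x = 0" for x
      using that assms(2)[of x] by (auto simp: indicator_def ennreal_eq_0_iff split: if_splits)
    ultimately have "AE x in lborel. x \<notin> {x. cell_index v N (2 * N) x = a}"
      by (rule eventually_mono)
    then have "emeasure lborel {x. cell_index v N (2 * N) x = a} = 0"
      by (subst (asm) AE_iff_measurable[OF _ refl]) auto
    then show False unfolding cell_measure
      using zero_less_power[OF side_pos[of N "2 * N"], of "CARD('n)"] by (simp add: ennreal_eq_0_iff)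
  qed
  then show ?thesis using fin by (auto simp: cell_mass_def enn2real_positive_iff zero_less_iff_neq_zero)
qed

lemma w_nz [simp]: "w x \<noteq> 0"
  using w_pos[of x] by auto

text \<open>The cells of a shifted grid with their volumes and masses form a dyadic tree.  On a smallest cell, the inequality
  \<open>atom\<close> is Hoelder's inequality for \<open>1 = u\<^bsup>1/q\<^esup> \<sigma>\<^bsup>1/p'\<^esup>\<close>.\<close>
lemma grid_tree: "dyadic_weights (atoms N) (generation N) (2 * N) ((1/2) ^ CARD('n)) ((2 ^ N) ^ CARD('n))
   (cell_mass (\<lambda>_. 1) v N) (cell_mass ws v N) (cell_mass wu v N) A B K"
proof
  have meas: "wu \<in> borel_measurable borel" "ws \<in> borel_measurable borel" by measurable
  have fin1: "(\<integral>\<^sup>+x. ennreal 1 * indicator {x. cell_index v N j x = a} x \<partial>lborel) < \<infinity>" for a :: "int^'n" and j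
    by (simp add: cell_measure)
  have mass1: "wsum (cell_mass (\<lambda>_. 1) v N) Q = side N j ^ CARD('n)" if "j \<le> 2 * N" "Q \<in> generation N j" for j and Q :: "(int^'n) set"
  proof -
    note jQ = that
    obtain c where c: "{x. cell_index v N (2 * N) x \<in> Q} = {x. cell_index v N j x = c}" by (rule generation_cell[OF jQ])
    have "finite Q" using that finite_generation by auto
    then have "wsum (cell_mass (\<lambda>_. 1) v N) Q = enn2real (\<integral>\<^sup>+x. ennreal 1 * indicator {x. cell_index v N (2 * N) x \<in> Q} x \<partial>lborel)"
      by (intro wsum_cell_mass fin1) auto
    then show ?thesis unfolding c by (simp add: cell_measure less_imp_le)
  qed
  show "finite (atoms N :: (int ^ 'n) set)" by (rule finite_atoms)
  show "Q \<subseteq> atoms N \<and> Q \<noteq> {}" if "j \<le> 2 * N" "Q \<in> generation N j" for j and Q :: "(int ^ 'n) set"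
    using that by (auto simp: generation_def)
  show "Q = R" if "Q \<in> generation N j" "R \<in> generation N j" "x \<in> Q" "x \<in> R" for j Q R and x :: "int ^ 'n"
    using that by (auto simp: generation_def)
  show "\<exists>P\<in>generation N j. Q \<subseteq> P" if "j < 2 * N" "Q \<in> generation N (Suc j)" for j and Q :: "(int ^ 'n) set"
    using that coarsen_Suc[of N j] by (auto simp: generation_def)
  show "0 < (1/2 :: real) ^ CARD('n)" "(1/2 :: real) ^ CARD('n) \<le> 1/2" "0 < ((2::real) ^ N) ^ CARD('n)"
    using power_decreasing[of 1 "CARD('n)" "1/2::real"] by auto
  show "0 < cell_mass (\<lambda>_. 1) v N a" "0 < cell_mass ws v N a" "0 < cell_mass wu v N a" for a
    using w_nz by (auto intro!: cell_mass_pos fin1 fin_cell_u fin_cell_s)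
  show "wsum (cell_mass (\<lambda>_. 1) v N) Q = (2 ^ N) ^ CARD('n) * ((1 / 2) ^ CARD('n)) ^ j"
    if "j \<le> 2 * N" "Q \<in> generation N j" for j Q
    unfolding mass1[OF that] side_def by (simp add: power_divide power_mult[symmetric] mult.commute)
  show "1 < A" "1 < B" "1/A + 1/B < 1" using AB by auto
  show "wsum (cell_mass wu v N) Q powr (1/A) * wsum (cell_mass ws v N) Q powr (1/B) \<le> K * wsum (cell_mass (\<lambda>_. 1) v N) Q powr (1/A + 1/B)"
    if "j \<le> 2 * N" "Q \<in> generation N j" for j Q
  proof -
    note jQ = that
    obtain c where c: "{x. cell_index v N (2 * N) x \<in> Q} = {x. cell_index v N j x = c}" by (rule generation_cell[OF jQ])
    have Q: "finite Q" using that finite_generation by auto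
    show ?thesis unfolding mass1[OF that] wsum_cell_mass[OF meas(1) Q fin_cell_u] wsum_cell_mass[OF meas(2) Q fin_cell_s] c cell_index_eq
      by (intro bnd) simp
  qed
  show "cell_mass (\<lambda>_. 1) v N a powr (1/A + 1/B) \<le> cell_mass wu v N a powr (1/A) * cell_mass ws v N a powr (1/B)" for a
  proof -
    let ?r = "1/A + 1/B"
    have r: "0 < ?r" using AB by (auto intro: add_pos_pos)
    note t = conjugate_split[of A B ?r, OF _ _ refl]
    have ABp: "0 < A" "0 < B" using AB by auto
    let ?E = "{x. cell_index v N (2 * N) x = a}"
    have one: "(wu x * indicator ?E x) powr (1/(A * ?r)) * (ws x * indicator ?E x) powr (1 - 1/(A * ?r)) = indicator ?E x" for x
    proof (cases "x \<in> ?E")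
      case True
      have "wu x powr (1/(A * ?r)) * ws x powr (1/(B * ?r)) = w x powr (A * (1/(A * ?r)) - B * (1 / (B * ?r)))"
        by (simp add: powr_powr flip: powr_add)
      also have "A * (1/(A * ?r)) - B * (1 / (B * ?r)) = 0" using ABp r by simp
      finally show ?thesis using True w_pos[of x] t(3)[OF ABp] by simp
    qed simp
    have I: "(\<integral>\<^sup>+x. ennreal (g x * indicator ?E x) \<partial>lborel) = ennreal (cell_mass g v N a)"
      if "(\<integral>\<^sup>+x. ennreal (g x) * indicator ?E x \<partial>lborel) < \<infinity>" "\<And>x. 0 \<le> g x" for g
    proof -
      have "ennreal (g x * indicator ?E x) = ennreal (g x) * indicator ?E x" for x by (simp add: indicator_def)
      then show ?thesis using that by (simp add: cell_mass_def)
    qed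
    have m0: "0 \<le> cell_mass g v N a" for g by (simp add: cell_mass_def)
    have "ennreal (cell_mass (\<lambda>_. 1) v N a) = (\<integral>\<^sup>+x. ennreal (1 * indicator ?E x) \<partial>lborel)"
      by (rule I[symmetric]) (auto simp: cell_measure)
    also have "\<dots> = (\<integral>\<^sup>+x. ennreal ((wu x * indicator ?E x) powr (1/(A * ?r)) * (ws x * indicator ?E x) powr (1 - 1/(A * ?r))) \<partial>lborel)"
      unfolding one by simp
    also have "\<dots> \<le> ennreal (cell_mass wu v N a powr (1/(A * ?r)) * cell_mass ws v N a powr (1 - 1/(A * ?r)))"
      using t[OF ABp] by (intro nn_integral_geometric_mean I fin_cell_u fin_cell_s m0) auto
    finally have le: "cell_mass (\<lambda>_. 1) v N a \<le> cell_mass wu v N a powr (1/(A * ?r)) * cell_mass ws v N a powr (1/(B * ?r))"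
      unfolding t(3)[OF ABp] by (subst (asm) ennreal_le_iff) auto
    have "cell_mass (\<lambda>_. 1) v N a powr ?r \<le> (cell_mass wu v N a powr (1/(A * ?r)) * cell_mass ws v N a powr (1/(B * ?r))) powr ?r"
      using le r m0 by (intro powr_mono2) auto
    also have "\<dots> = cell_mass wu v N a powr (1/(A * ?r) * ?r) * cell_mass ws v N a powr (1/(B * ?r) * ?r)"
      by (simp only: powr_mult powr_powr powr_ge_zero)
    also have "1/(A * ?r) * ?r = 1/A" using r by (simp only: divide_divide_eq_left[symmetric]) simp
    also have "1/(B * ?r) * ?r = 1/B" using r by (simp only: divide_divide_eq_left[symmetric]) simp
    finally show ?thesis .
  qed
qed

end

section \<open>From dyadic operators to the Riesz potential\<close>

lemma epowr_ennreal: "0 \<le> a \<Longrightarrow> 0 < r \<Longrightarrow> ennreal a epowr r = ennreal (a powr r)"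
  by (auto simp: epowr_def ennreal_eq_0_iff)

lemma epowr_top: "0 < r \<Longrightarrow> top epowr r = top"
  by (simp add: epowr_def)

lemma epowr_mono: "x \<le> y \<Longrightarrow> 0 < r \<Longrightarrow> x epowr r \<le> y epowr r"
  by (cases x; cases y) (auto simp: epowr_ennreal epowr_top top_unique intro!: ennreal_leI powr_mono2)

lemma epowr_inverse: "0 < r \<Longrightarrow> (x epowr r) epowr (1 / r) = x" "0 < r \<Longrightarrow> (x epowr (1 / r)) epowr r = x"
  by (cases x; simp add: epowr_ennreal epowr_top powr_powr)+

text \<open>Taking powers is an increasing bijection with inverse \<open>\<lambda>x. x epowr (1 / r)\<close>, so it commutes with suprema.\<close>
lemma epowr_SUP:
  fixes f :: "nat \<Rightarrow> ennreal"
  assumes "0 < r" shows "(SUP n. f n) epowr r = (SUP n. f n epowr r)"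
proof (rule antisym)
  have "f n \<le> (SUP n. f n epowr r) epowr (1 / r)" for n
  proof -
    have "(f n epowr r) epowr (1/r) \<le> (SUP n. f n epowr r) epowr (1 / r)"
      using assms by (intro epowr_mono SUP_upper) auto
    then show ?thesis using assms by (simp add: epowr_inverse)
  qed
  then have "(SUP n. f n) \<le> (SUP n. f n epowr r) epowr (1 / r)" by (rule SUP_least)
  then have "(SUP n. f n) epowr r \<le> ((SUP n. f n epowr r) epowr (1 / r)) epowr r"
    using assms by (intro epowr_mono)
  then show "(SUP n. f n) epowr r \<le> (SUP n. f n epowr r)" using assms by (simp add: epowr_inverse)
  show "(SUP n. f n epowr r) \<le> (SUP n. f n) epowr r"
    using assms by (intro SUP_least epowr_mono SUP_upper) auto
qed

lemma measurable_epowr [measurable]: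
  assumes [measurable]: "f \<in> borel_measurable M" shows "(\<lambda>x. f x epowr r) \<in> borel_measurable M"
  unfolding epowr_def by measurable

text \<open>If both pairs were separated, an integer and an integer plus \<open>2\<^sup>j / 3\<close> would both lie in an
  interval of length less than \<open>1/3\<close>, and \<open>2\<^sup>j\<close> would be a multiple of \<open>3\<close>.\<close>
lemma floor_shift:
  fixes a b :: real
  assumes "\<bar>a - b\<bar> < 1/3"
  shows "\<lfloor>a\<rfloor> = \<lfloor>b\<rfloor> \<or> \<lfloor>a - 2 ^ j / 3\<rfloor> = \<lfloor>b - 2 ^ j / 3\<rfloor>"
proof -
  have *: False if "\<lfloor>a\<rfloor> < \<lfloor>b\<rfloor>" "\<lfloor>a - 2 ^ j / 3\<rfloor> < \<lfloor>b - 2 ^ j / 3\<rfloor>" "b - a < 1/3" for a b :: real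
  proof -
    define m k where "m = \<lfloor>b\<rfloor>" "k = \<lfloor>b - 2 ^ j / 3\<rfloor>"
    have 1: "a < m" "m \<le> b" using that(1) by (auto simp: m_k_def floor_less_iff)
    have 2: "a - 2 ^ j / 3 < k" "k \<le> b - 2 ^ j / 3" using that(2) by (auto simp: m_k_def floor_less_iff)
    have "\<bar>real_of_int (3 * (m - k) - 2 ^ j)\<bar> < 1" using 1 2 that(3) by simp
    then have "3 * (m - k) = 2 ^ j" by linarith
    then have "3 dvd (2::int) ^ j" by (metis dvd_triv_left)
    then have "3 dvd (2::int)" using prime_dvd_power[of "3::int" 2 j] by (simp add: prime_int_numeral_eq)
    then show False by simp
  qed
  show ?thesis
  proof (cases "a \<le> b")
    case True
    then have "\<lfloor>a\<rfloor> \<le> \<lfloor>b\<rfloor>" "\<lfloor>a - 2 ^ j / 3\<rfloor> \<le> \<lfloor>b - 2 ^ j / 3\<rfloor>" by (auto intro!: floor_mono)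
    then show ?thesis using *[of a b] assms by (smt (verit))
  next
    case False
    then have "\<lfloor>b\<rfloor> \<le> \<lfloor>a\<rfloor>" "\<lfloor>b - 2 ^ j / 3\<rfloor> \<le> \<lfloor>a - 2 ^ j / 3\<rfloor>" by (auto intro!: floor_mono)
    then show ?thesis using *[of b a] assms by (smt (verit))
  qed
qed

text \<open>In units of the side of generation \<open>j\<close> the translation is \<open>2\<^sup>j / 3\<close>, which has
  distance \<open>1/3\<close> from the integers.  So one translation serves all scales up to \<open>2\<^sup>N\<close>.\<close>
definition third_shift :: "nat \<Rightarrow> 'n set \<Rightarrow> real ^ 'n" where
  "third_shift N T = (\<chi> i. if i \<in> T then 2 ^ N / 3 else 0)"

lemma cell_index_atoms:
  assumes "\<And>i. \<bar>x $ i\<bar> \<le> 2 ^ N" shows "cell_index (third_shift N T) N (2 * N) x \<in> atoms N"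
proof -
  have "- (2 * 2 ^ (2 * N)) \<le> \<lfloor>(x $ i - third_shift N T $ i) / side N (2 * N)\<rfloor> \<and> \<lfloor>(x $ i - third_shift N T $ i) / side N (2 * N)\<rfloor> < 2 * 2 ^ (2 * N)" for i
  proof -
    define P :: real where "P = 2 ^ N"
    have P: "1 \<le> P" by (simp add: P_def)
    have s: "side N (2 * N) = 1 / P" by (simp add: side_def P_def mult_2 power_add)
    have PP: "(2::real) ^ (2 * N) = P * P" by (simp add: P_def mult_2 power_add)
    have sh: "0 \<le> third_shift N T $ i" "third_shift N T $ i \<le> P / 3" by (auto simp: third_shift_def P_def)
    have x: "- P \<le> x $ i" "x $ i \<le> P" using assms[of i] by (auto simp: P_def)
    have "- (2 * P) \<le> x $ i - third_shift N T $ i" "x $ i - third_shift N T $ i < 2 * P" using sh x P by auto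
    then have "- (2 * P) * P \<le> (x $ i - third_shift N T $ i) * P" "(x $ i - third_shift N T $ i) * P < 2 * P * P"
      using P mult_right_mono[of "- (2 * P)" "x $ i - third_shift N T $ i" P]
        mult_strict_right_mono[of "x $ i - third_shift N T $ i" "2 * P" P] by auto
    then have "real_of_int (- (2 * 2 ^ (2 * N))) \<le> (x $ i - third_shift N T $ i) / side N (2 * N)"
      "(x $ i - third_shift N T $ i) / side N (2 * N) < real_of_int (2 * 2 ^ (2 * N))"
      by (simp_all add: s PP)
    then show ?thesis by (simp only: le_floor_iff floor_less_iff)
  qed
  then show ?thesis by (simp add: atoms_def cell_index_def)
qed

text \<open>Choose the finest generation whose side still exceeds three times the distance.  In each coordinate separately one of
  the two origins does not separate the points (lemma \<open>floor_shift\<close>); the set \<open>T\<close> collects the coordinates that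
  need the translated origin.\<close>
lemma exists_common_cell:
  fixes x y :: "real ^ 'n"
  assumes \<rho>: "(1 / 2 ^ N) / 6 \<le> infnorm (x - y)" "infnorm (x - y) < 2 ^ N / 3"
  shows "\<exists>T. \<exists>j\<le>2 * N. cell_index (third_shift N T) N j x = cell_index (third_shift N T) N j y \<and> side N j / 6 \<le> infnorm (x - y)"
proof -
  let ?\<rho> = "infnorm (x - y)"
  define j where "j = Max {j. j \<le> 2 * N \<and> ?\<rho> < side N j / 3}"
  have fin: "finite {j. j \<le> 2 * N \<and> ?\<rho> < side N j / 3}" by simp
  have "0 \<in> {j. j \<le> 2 * N \<and> ?\<rho> < side N j / 3}" using \<rho> by (simp add: side_def)
  then have j: "j \<le> 2 * N" "?\<rho> < side N j / 3"
    using Max_in[OF fin] unfolding j_def by blast+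
  have low: "side N j / 6 \<le> ?\<rho>"
  proof (cases "j = 2 * N")
    case True
    then show ?thesis using \<rho> by (simp add: side_def mult_2 power_add)
  next
    case False
    then have "\<not> ?\<rho> < side N (Suc j) / 3"
      using j Max_ge[OF fin, of "Suc j"] unfolding j_def[symmetric] by auto
    then show ?thesis by (simp add: side_def)
  qed
  \<comment> \<open>The coordinates that are separated by the untranslated grid.\<close>
  define T where "T = {i. \<lfloor>x $ i / side N j\<rfloor> \<noteq> \<lfloor>y $ i / side N j\<rfloor>}"
  have "\<lfloor>(x $ i - third_shift N T $ i) / side N j\<rfloor> = \<lfloor>(y $ i - third_shift N T $ i) / side N j\<rfloor>" for i
  proof (cases "i \<in> T")
    case True
    have "\<bar>x $ i - y $ i\<bar> \<le> ?\<rho>" using component_le_infnorm_cart[of "x - y" i] by simp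
    then have "\<bar>x $ i - y $ i\<bar> < side N j / 3" using j by simp
    then have "\<bar>x $ i / side N j - y $ i / side N j\<bar> < 1/3"
      by (simp add: diff_divide_distrib[symmetric] abs_of_pos[OF side_pos] pos_divide_less_eq)
    then have "\<lfloor>x $ i / side N j - 2 ^ j / 3\<rfloor> = \<lfloor>y $ i / side N j - 2 ^ j / 3\<rfloor>"
      using True floor_shift[of "x $ i / side N j" "y $ i / side N j" j] by (auto simp: T_def)
    moreover have "(z - third_shift N T $ i) / side N j = z / side N j - 2 ^ j / 3" for z
      using True by (simp add: third_shift_def side_def field_simps)
    ultimately show ?thesis by (simp only:)
  qed (simp add: third_shift_def T_def)
  then show ?thesis using j low by (intro exI[of _ T] exI[of _ j]) (auto simp: cell_index_def vec_eq_iff)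
qed

text \<open>The pairs of points that are seen at the scales between \<open>2\<^bsup>-N\<^esup>\<close> and \<open>2\<^sup>N\<close>; they exhaust
  all pairs of distinct points as \<open>N\<close> grows.\<close>
definition in_range :: "nat \<Rightarrow> real ^ 'n \<Rightarrow> real ^ 'n \<Rightarrow> bool" where
  "in_range N x y \<longleftrightarrow> (\<forall>i. \<bar>x $ i\<bar> \<le> 2 ^ N) \<and> (\<forall>i. \<bar>y $ i\<bar> \<le> 2 ^ N) \<and>
     (1 / 2 ^ N) / 6 \<le> infnorm (x - y) \<and> infnorm (x - y) < 2 ^ N / 3"

lemma powr_sum_le_card:
  fixes a :: "'i \<Rightarrow> real"
  assumes "finite I" "\<And>i. i \<in> I \<Longrightarrow> 0 \<le> a i" "0 < t"
  shows "(\<Sum>i\<in>I. a i) powr t \<le> real (card I) powr t * (\<Sum>i\<in>I. a i powr t)"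
proof -
  let ?S = "\<Sum>i\<in>I. a i powr t"
  have S0: "0 \<le> ?S" by (intro sum_nonneg) auto
  have "a i \<le> ?S powr (1/t)" if "i \<in> I" for i
  proof -
    have "(a i powr t) powr (1/t) \<le> ?S powr (1/t)"
      using assms that by (intro powr_mono2 member_le_sum) auto
    then show ?thesis using assms that by (simp add: powr_powr)
  qed
  then have "(\<Sum>i\<in>I. a i) \<le> real (card I) * ?S powr (1/t)" by (rule sum_bounded_above)
  then have "(\<Sum>i\<in>I. a i) powr t \<le> (real (card I) * ?S powr (1/t)) powr t"
    using assms by (intro powr_mono2) (auto intro: sum_nonneg)
  also have "\<dots> = real (card I) powr t * ?S" using assms S0 by (simp add: powr_mult powr_powr)
  finally show ?thesis .
qed

context cube_weight
begin

definition "r = 1/A + 1/B"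

definition cell_volume :: "real ^ 'n \<Rightarrow> nat \<Rightarrow> (int ^ 'n) set \<Rightarrow> real" where
  "cell_volume v N Q = wsum (cell_mass (\<lambda>_. 1) v N) Q"

lemma cell_volume_eq: assumes "j \<le> 2 * N" "Q \<in> generation N j" shows "cell_volume v N Q = side N j ^ CARD('n)"
proof -
  interpret g: dyadic_weights "atoms N" "generation N" "2 * N" "(1/2) ^ CARD('n)" "(2 ^ N) ^ CARD('n)"
    "cell_mass (\<lambda>_. 1) v N" "cell_mass ws v N" "cell_mass wu v N" A B K by (rule grid_tree)
  show ?thesis unfolding cell_volume_def g.vol[OF assms] side_def by (simp add: power_divide power_mult[symmetric] mult.commute)
qed

text \<open>The dyadic operator for one grid, as a function of the smallest cell.\<close>
definition grid_potential :: "(real ^ 'n \<Rightarrow> real) \<Rightarrow> real ^ 'n \<Rightarrow> nat \<Rightarrow> int ^ 'n \<Rightarrow> real" where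
  "grid_potential F v N a = (\<Sum>Q\<in>{Q\<in>\<Union>j\<le>2*N. generation N j. a \<in> Q}. cell_volume v N Q powr (-r) * wsum (cell_mass F v N) Q)"

definition "grid_const = dyadic_weights.strong_const ((1/2) ^ CARD('n)) A B"

context
  fixes F :: "real ^ 'n \<Rightarrow> real" and Y :: real
  assumes F_meas [measurable]: "F \<in> borel_measurable borel" and F0: "\<And>x. 0 \<le> F x"
    and Y: "(\<integral>\<^sup>+x. ennreal (F x powr p * w x powr p) \<partial>lborel) = ennreal Y" "0 \<le> Y"
begin

lemma p_props: "1 < p" "1/p = 1 - 1/B" "p / B = p - 1"
  using AB by (auto simp: p_def field_simps)

text \<open>Hoelder's inequality on a smallest cell: replacing \<open>F\<close> by its masses does not increase the norm in
  \<open>L\<^sup>p(w\<^sup>p)\<close>.\<close>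
lemma F_atom:
  fixes v N a
  defines "E \<equiv> {x. cell_index v N (2 * N) x = a}"
  shows "(\<integral>\<^sup>+x. ennreal (F x) * indicator E x \<partial>lborel) < \<infinity>"
    and "ennreal (cell_mass F v N a powr p * cell_mass ws v N a powr (1 - p)) \<le> (\<integral>\<^sup>+x. ennreal (F x powr p * w x powr p) * indicator E x \<partial>lborel)"
proof -
  note p = p_props
  have E [measurable]: "E \<in> sets borel" unfolding E_def by measurable
  have le_Y: "(\<integral>\<^sup>+x. ennreal (F x powr p * w x powr p) * indicator E x \<partial>lborel) \<le> ennreal Y"
    unfolding Y(1)[symmetric] by (intro nn_integral_mono) (auto simp: indicator_def)
  then obtain y where y: "(\<integral>\<^sup>+x. ennreal (F x powr p * w x powr p) * indicator E x \<partial>lborel) = ennreal y" "0 \<le> y"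
    by (cases "\<integral>\<^sup>+x. ennreal (F x powr p * w x powr p) * indicator E x \<partial>lborel") (auto simp: top_unique)
  have s: "(\<integral>\<^sup>+x. ennreal (ws x) * indicator E x \<partial>lborel) = ennreal (cell_mass ws v N a)" "0 \<le> cell_mass ws v N a"
    using fin_cell_s[of v N "2 * N" a] by (auto simp: cell_mass_def E_def)
  have ind: "ennreal (h * indicator E x) = ennreal h * indicator E x" for h x by (simp add: indicator_def)
  have eq: "(F x powr p * w x powr p * indicator E x) powr (1/p) * (ws x * indicator E x) powr (1 - 1/p) = F x * indicator E x" for x
  proof (cases "x \<in> E")
    case True
    have "(F x powr p * w x powr p) powr (1/p) * ws x powr (1 - 1/p) = F x * (w x powr 1 * w x powr (-1))"
    proof -
      have e: "- (B * (1 - 1/p)) = - 1" unfolding p(2) using AB by simp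
      show ?thesis unfolding powr_powr using p(1) F0[of x] w_pos[of x] by (simp add: powr_mult powr_powr e del: p_props)
    qed
    also have "w x powr 1 * w x powr (-1) = 1" using w_pos[of x] by (simp flip: powr_add)
    finally show ?thesis using True by simp
  qed simp
  have "(\<integral>\<^sup>+x. ennreal (F x) * indicator E x \<partial>lborel) = (\<integral>\<^sup>+x. ennreal ((F x powr p * w x powr p * indicator E x) powr (1/p) * (ws x * indicator E x) powr (1 - 1/p)) \<partial>lborel)"
    unfolding eq ind ..
  also have "\<dots> \<le> ennreal (y powr (1/p) * cell_mass ws v N a powr (1 - 1/p))"
    using p(1) by (intro nn_integral_geometric_mean) (auto simp: ind y s)
  finally have le: "(\<integral>\<^sup>+x. ennreal (F x) * indicator E x \<partial>lborel) \<le> ennreal (y powr (1/p) * cell_mass ws v N a powr (1 - 1/p))" .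
  from le_less_trans[OF this ennreal_less_top]
  show fin: "(\<integral>\<^sup>+x. ennreal (F x) * indicator E x \<partial>lborel) < \<infinity>" by simp
  have sp: "0 < cell_mass ws v N a"
    using w_pos by (intro cell_mass_pos fin_cell_s) auto
  have "cell_mass F v N a \<le> y powr (1/p) * cell_mass ws v N a powr (1 - 1/p)"
    unfolding cell_mass_def[of F] using le fin by (subst enn2real_leI) (auto simp: E_def)
  then have "cell_mass F v N a powr p \<le> (y powr (1/p) * cell_mass ws v N a powr (1 - 1/p)) powr p"
    using p by (intro powr_mono2) (auto simp: cell_mass_def)
  also have "\<dots> = y * cell_mass ws v N a powr (p - 1)"
    using p y(2) by (simp add: powr_mult powr_powr left_diff_distrib)
  finally have "cell_mass F v N a powr p * cell_mass ws v N a powr (1 - p) \<le> y * cell_mass ws v N a powr (p - 1) * cell_mass ws v N a powr (1 - p)"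
    by (intro mult_right_mono) auto
  also have "\<dots> = y" using sp by (simp add: mult.assoc flip: powr_add)
  finally show "ennreal (cell_mass F v N a powr p * cell_mass ws v N a powr (1 - p)) \<le> (\<integral>\<^sup>+x. ennreal (F x powr p * w x powr p) * indicator E x \<partial>lborel)"
    unfolding y by (rule ennreal_leI)
qed

lemma cell_mass_nonneg: "0 \<le> cell_mass g v N a" by (simp add: cell_mass_def)

lemma grid_potential_nonneg: "0 \<le> grid_potential F v N a"
  unfolding grid_potential_def wsum_def by (intro sum_nonneg mult_nonneg_nonneg) (auto simp: cell_mass_nonneg)

lemma grid_const_nonneg: "0 \<le> grid_const"
proof -
  interpret g: dyadic_weights "atoms 0" "generation 0" "2 * 0" "(1/2) ^ CARD('n)" "(2 ^ 0) ^ CARD('n)"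
    "cell_mass (\<lambda>_. 1) 0 0" "cell_mass ws 0 0" "cell_mass wu 0 0" A B K by (rule grid_tree)
  show ?thesis unfolding grid_const_def by (rule g.strong_const_nonneg)
qed

text \<open>The function in question is constant on the smallest cells, so its norm is the left-hand side of \<open>strong\<close>.\<close>
lemma single_grid:
  "(\<integral>\<^sup>+x. ennreal (grid_potential F v N (cell_index v N (2 * N) x) powr A * w x powr A) * indicator {x. cell_index v N (2 * N) x \<in> atoms N} x \<partial>lborel)
    \<le> ennreal ((grid_const * K powr (r * max A B) * Y powr (1/p)) powr A)"
proof -
  interpret g: dyadic_weights "atoms N" "generation N" "2 * N" "(1/2) ^ CARD('n)" "(2 ^ N) ^ CARD('n)"
    "cell_mass (\<lambda>_. 1) v N" "cell_mass ws v N" "cell_mass wu v N" A B K by (rule grid_tree)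
  note fa = finite_atoms[of N, where ?'n='n]
  let ?L = "cell_index v N (2 * N)"
  have pw: "ennreal (grid_potential F v N (?L x) powr A * w x powr A) * indicator {x. ?L x \<in> atoms N} x
     = (\<Sum>a\<in>atoms N. ennreal (grid_potential F v N a powr A) * (ennreal (wu x) * indicator {x. ?L x = a} x))" for x
  proof (cases "?L x \<in> atoms N")
    case True
    have "(\<Sum>a\<in>atoms N. ennreal (grid_potential F v N a powr A) * (ennreal (wu x) * indicator {x. ?L x = a} x))
      = (\<Sum>a\<in>atoms N. if a = ?L x then ennreal (grid_potential F v N a powr A) * ennreal (wu x) else 0)"
      by (intro sum.cong refl) (auto simp: indicator_def)
    also have "\<dots> = ennreal (grid_potential F v N (?L x) powr A) * ennreal (wu x)" using True fa by (simp add: sum.delta')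
    finally show ?thesis using True by (simp add: ennreal_mult)
  next
    case False
    then show ?thesis by (subst sum.neutral) (auto simp: indicator_def)
  qed
  have "(\<integral>\<^sup>+x. ennreal (grid_potential F v N (?L x) powr A * w x powr A) * indicator {x. ?L x \<in> atoms N} x \<partial>lborel)
     = (\<Sum>a\<in>atoms N. ennreal (grid_potential F v N a powr A) * (\<integral>\<^sup>+x. ennreal (wu x) * indicator {x. ?L x = a} x \<partial>lborel))"
    unfolding pw by (subst nn_integral_sum) (auto simp: nn_integral_cmult)
  also have "\<dots> = (\<Sum>a\<in>atoms N. ennreal (grid_potential F v N a powr A) * ennreal (cell_mass wu v N a))"
    using fin_cell_u by (intro sum.cong refl) (simp add: cell_mass_def)
  also have "\<dots> = ennreal (\<Sum>a\<in>atoms N. cell_mass wu v N a * grid_potential F v N a powr A)"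
    by (subst sum_ennreal[symmetric]) (auto simp: ennreal_mult cell_mass_nonneg mult.commute)
  also have "\<dots> \<le> ennreal ((grid_const * K powr (r * max A B) * Y powr (1/p)) powr A)"
  proof (rule ennreal_leI)
    let ?S = "\<Sum>a\<in>atoms N. cell_mass wu v N a * grid_potential F v N a powr A"
    let ?M = "\<Sum>a\<in>atoms N. cell_mass F v N a powr p * cell_mass ws v N a powr (1 - p)"
    have "ennreal ?M = (\<Sum>a\<in>atoms N. ennreal (cell_mass F v N a powr p * cell_mass ws v N a powr (1 - p)))"
      by (subst sum_ennreal) auto
    also have "\<dots> \<le> (\<Sum>a\<in>atoms N. \<integral>\<^sup>+x. ennreal (F x powr p * w x powr p) * indicator {x. ?L x = a} x \<partial>lborel)"
      by (intro sum_mono F_atom)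
    also have "\<dots> = (\<integral>\<^sup>+x. ennreal (F x powr p * w x powr p) * indicator {x. ?L x \<in> atoms N} x \<partial>lborel)"
      using fa by (intro nn_integral_atoms[symmetric]) auto
    also have "\<dots> \<le> ennreal Y"
      unfolding Y(1)[symmetric] by (intro nn_integral_mono) (auto simp: indicator_def)
    finally have M: "?M \<le> Y" using Y(2) by (simp add: ennreal_le_iff)
    have M0: "0 \<le> ?M" by (intro sum_nonneg) auto
    have "?S powr (1/A) \<le> grid_const * K powr (r * max A B) * ?M powr (1/p)"
      using g.strong[of "cell_mass F v N"] cell_mass_nonneg
      unfolding grid_potential_def cell_volume_def grid_const_def p_def g.\<Q>_def g.r_def r_def by simp
    also have "\<dots> \<le> grid_const * K powr (r * max A B) * Y powr (1/p)"
      using M M0 grid_const_nonneg p_props(1) by (intro mult_left_mono powr_mono2) auto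
    finally have "(?S powr (1/A)) powr A \<le> (grid_const * K powr (r * max A B) * Y powr (1/p)) powr A"
      using AB by (intro powr_mono2) auto
    moreover have "0 \<le> ?S" by (intro sum_nonneg mult_nonneg_nonneg) (auto simp: cell_mass_nonneg)
    ultimately show "?S \<le> (grid_const * K powr (r * max A B) * Y powr (1/p)) powr A"
      using AB by (simp add: powr_powr)
  qed
  finally show ?thesis .
qed

text \<open>By \<open>exists_common_cell\<close> the kernel is at most a multiple of a single term of the sum over all grids and all cells
  that contain both points.\<close>
lemma range_potential_le:
  fixes x :: "real ^ 'n"
  assumes x: "\<And>i. \<bar>x $ i\<bar> \<le> 2 ^ N"
  defines "s \<equiv> real CARD('n) * r"
  shows "(\<integral>\<^sup>+y. ennreal (F y * (if in_range N x y then norm (x - y) powr (-s) else 0)) \<partial>lborel)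
    \<le> ennreal (6 powr s * (\<Sum>T\<in>UNIV. grid_potential F (third_shift N T) N (cell_index (third_shift N T) N (2 * N) x)))"
proof -
  let ?v = "\<lambda>T. third_shift N T :: real ^ 'n" and ?L = "\<lambda>T. cell_index (third_shift N T) N (2 * N) :: real ^ 'n \<Rightarrow> _"
  let ?Q = "\<lambda>T. {Q\<in>\<Union>j\<le>2*N. generation N j. ?L T x \<in> Q}"
  have "0 \<le> r" unfolding r_def using AB by (intro add_nonneg_nonneg) auto
  then have s0: "0 \<le> s" unfolding s_def by (intro mult_nonneg_nonneg) auto
  have finQ: "finite (?Q T)" for T
  proof (rule finite_subset)
    show "finite (\<Union>j\<le>2*N. generation N j :: (int ^ 'n) set set)"
      by (intro finite_UN_I finite_atMost) (simp add: generation_def finite_atoms)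
  qed blast
  have finQ': "finite Q" if "Q \<in> ?Q T" for Q T using that finite_generation by auto
  have term0: "0 \<le> cell_volume v N Q powr (-r) * (F y * indicator {y. ?L T y \<in> Q} y)" for v Q y T
    using F0 by (intro mult_nonneg_nonneg) auto
  have pw: "F y * (if in_range N x y then norm (x - y) powr (-s) else 0)
     \<le> 6 powr s * (\<Sum>T\<in>UNIV. \<Sum>Q\<in>?Q T. cell_volume (?v T) N Q powr (-r) * (F y * indicator {y. ?L T y \<in> Q} y))" for y
  proof (cases "in_range N x y")
    case False
    have "0 \<le> 6 powr s * (\<Sum>T\<in>UNIV. \<Sum>Q\<in>?Q T. cell_volume (?v T) N Q powr (-r) * (F y * indicator {y. ?L T y \<in> Q} y))"
      by (intro mult_nonneg_nonneg sum_nonneg term0) simp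
    then show ?thesis using False by simp
  next
    case True
    then obtain T j where Tj: "j \<le> 2 * N" "cell_index (?v T) N j x = cell_index (?v T) N j y" "side N j / 6 \<le> infnorm (x - y)"
      using exists_common_cell[of N x y] by (auto simp: in_range_def)
    define Q where "Q = {b \<in> atoms N. coarsen N j b = coarsen N j (?L T x)}"
    have xa: "?L T x \<in> atoms N" using x by (rule cell_index_atoms)
    have ya: "?L T y \<in> atoms N" using True by (intro cell_index_atoms) (auto simp: in_range_def)
    have Qg: "Q \<in> generation N j" unfolding generation_def Q_def using xa by (intro imageI)
    have xQ: "?L T x \<in> Q" using xa by (simp add: Q_def)
    have yQ: "?L T y \<in> Q" using ya Tj coarsen_cell_index[OF Tj(1), of "?v T"] by (simp add: Q_def)
    have QQ: "Q \<in> ?Q T" using Qg xQ Tj by auto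
    have sp: "0 < side N j / 6" by simp
    have "norm (x - y) powr (-s) \<le> (side N j / 6) powr (-s)"
      using Tj(3) infnorm_le_norm[of "x - y"] s0 sp by (intro powr_mono2') auto
    also have "\<dots> = 6 powr s * side N j powr (-s)"
      by (simp add: powr_divide powr_minus_divide less_imp_le)
    also have "side N j powr (-s) = cell_volume (?v T) N Q powr (-r)"
      unfolding cell_volume_eq[OF Tj(1) Qg] s_def powr_realpow[OF side_pos, symmetric] by (simp add: powr_powr)
    finally have "F y * norm (x - y) powr (-s) \<le> F y * (6 powr s * cell_volume (?v T) N Q powr (-r))"
      using F0 by (intro mult_left_mono) auto
    also have "\<dots> = 6 powr s * (cell_volume (?v T) N Q powr (-r) * (F y * indicator {y. ?L T y \<in> Q} y))"
      using yQ by simp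
    also have "\<dots> \<le> 6 powr s * (\<Sum>Q\<in>?Q T. cell_volume (?v T) N Q powr (-r) * (F y * indicator {y. ?L T y \<in> Q} y))"
      using QQ term0 finQ by (intro mult_left_mono member_le_sum) auto
    also have "\<dots> \<le> 6 powr s * (\<Sum>T\<in>UNIV. \<Sum>Q\<in>?Q T. cell_volume (?v T) N Q powr (-r) * (F y * indicator {y. ?L T y \<in> Q} y))"
      using term0 by (intro mult_left_mono member_le_sum) (auto intro!: sum_nonneg)
    finally show ?thesis using True by simp
  qed
  have "(\<integral>\<^sup>+y. ennreal (F y * (if in_range N x y then norm (x - y) powr (-s) else 0)) \<partial>lborel)
     \<le> (\<integral>\<^sup>+y. ennreal (6 powr s) * (\<Sum>T\<in>UNIV. \<Sum>Q\<in>?Q T. ennreal (cell_volume (?v T) N Q powr (-r)) * (ennreal (F y) * indicator {y. ?L T y \<in> Q} y)) \<partial>lborel)"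
  proof (intro nn_integral_mono)
    fix y
    have ind: "ennreal (F y * indicator E y) = ennreal (F y) * indicator E y" for E by (simp add: indicator_def)
    have "ennreal (F y * (if in_range N x y then norm (x - y) powr (-s) else 0))
      \<le> ennreal (6 powr s * (\<Sum>T\<in>UNIV. \<Sum>Q\<in>?Q T. cell_volume (?v T) N Q powr (-r) * (F y * indicator {y. ?L T y \<in> Q} y)))"
      by (intro ennreal_leI pw)
    also have "\<dots> = ennreal (6 powr s) * (\<Sum>T\<in>UNIV. \<Sum>Q\<in>?Q T. ennreal (cell_volume (?v T) N Q powr (-r) * (F y * indicator {y. ?L T y \<in> Q} y)))"
      using term0 by (simp add: ennreal_mult sum_nonneg sum_ennreal)
    also have "\<dots> = ennreal (6 powr s) * (\<Sum>T\<in>UNIV. \<Sum>Q\<in>?Q T. ennreal (cell_volume (?v T) N Q powr (-r)) * (ennreal (F y) * indicator {y. ?L T y \<in> Q} y))"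
      unfolding ind[symmetric] using F0 by (simp add: ennreal_mult)
    finally show "ennreal (F y * (if in_range N x y then norm (x - y) powr (-s) else 0)) \<le> \<dots>" .
  qed
  also have "\<dots> = ennreal (6 powr s) * (\<Sum>T\<in>UNIV. \<Sum>Q\<in>?Q T. ennreal (cell_volume (?v T) N Q powr (-r)) * (\<integral>\<^sup>+y. ennreal (F y) * indicator {y. ?L T y \<in> Q} y \<partial>lborel))"
  proof -
    have meas: "(\<lambda>y. ennreal (F y) * indicator {y. ?L T y \<in> Q} y) \<in> borel_measurable lborel" if Q: "Q \<in> ?Q T" for Q T
    proof -
      have "{y. ?L T y \<in> Q} = (\<Union>a\<in>Q. {y. ?L T y = a})" by auto
      then have [measurable]: "{y. ?L T y \<in> Q} \<in> sets borel"
        using finQ'[OF Q] cell_sets by (simp only:) (rule sets.finite_UN)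
      show ?thesis by measurable
    qed
    have meas1: "(\<lambda>y. ennreal (cell_volume (?v T) N Q powr (-r)) * (ennreal (F y) * indicator {y. ?L T y \<in> Q} y)) \<in> borel_measurable lborel" if Q: "Q \<in> ?Q T" for Q T
      by (intro borel_measurable_times_ennreal meas[OF Q] borel_measurable_const)
    have meas2: "(\<lambda>y. \<Sum>Q\<in>?Q T. ennreal (cell_volume (?v T) N Q powr (-r)) * (ennreal (F y) * indicator {y. ?L T y \<in> Q} y)) \<in> borel_measurable lborel" for T
      by (intro borel_measurable_sum borel_measurable_times_ennreal meas borel_measurable_const)
    have "(\<integral>\<^sup>+y. (\<Sum>Q\<in>?Q T. ennreal (cell_volume (?v T) N Q powr (-r)) * (ennreal (F y) * indicator {y. ?L T y \<in> Q} y)) \<partial>lborel)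
       = (\<Sum>Q\<in>?Q T. ennreal (cell_volume (?v T) N Q powr (-r)) * (\<integral>\<^sup>+y. ennreal (F y) * indicator {y. ?L T y \<in> Q} y \<partial>lborel))" for T
    proof (subst nn_integral_sum)
      fix Q assume "Q \<in> ?Q T"
      then show "(\<lambda>y. ennreal (cell_volume (?v T) N Q powr (-r)) * (ennreal (F y) * indicator {y. ?L T y \<in> Q} y)) \<in> borel_measurable lborel"
        by (rule meas1)
    qed (intro sum.cong refl nn_integral_cmult meas)
    then show ?thesis
      unfolding nn_integral_cmult[OF borel_measurable_sum[OF meas2]] nn_integral_sum[OF meas2] by (simp only:)
  qed
  also have "\<dots> = ennreal (6 powr s) * (\<Sum>T\<in>UNIV. \<Sum>Q\<in>?Q T. ennreal (cell_volume (?v T) N Q powr (-r)) * ennreal (wsum (cell_mass F (?v T) N) Q))"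
  proof (intro arg_cong[of _ _ "(*) (ennreal (6 powr s))"] sum.cong refl arg_cong[of _ _ "(*) _"])
    fix T Q assume Q: "Q \<in> ?Q T"
    have "(\<integral>\<^sup>+y. ennreal (F y) * indicator {y. ?L T y \<in> Q} y \<partial>lborel) < \<infinity>"
      using finQ'[OF Q] F_atom(1) by (subst nn_integral_atoms) auto
    then show "(\<integral>\<^sup>+y. ennreal (F y) * indicator {y. ?L T y \<in> Q} y \<partial>lborel) = ennreal (wsum (cell_mass F (?v T) N) Q)"
      using finQ'[OF Q] F_atom(1) by (subst wsum_cell_mass) auto
  qed
  also have "\<dots> = ennreal (6 powr s * (\<Sum>T\<in>UNIV. grid_potential F (third_shift N T) N (?L T x)))"
  proof -
    have w0: "0 \<le> wsum (cell_mass F v N) Q" for v Q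
      unfolding wsum_def by (intro sum_nonneg cell_mass_nonneg)
    show ?thesis
      unfolding grid_potential_def by (simp add: w0 sum_nonneg sum_ennreal ennreal_mult[symmetric])
  qed
  finally show ?thesis .
qed

definition "riesz_const = 6 powr (real CARD('n) * r) * 2 ^ CARD('n) * (2 ^ CARD('n)) powr (1/A) * grid_const"

lemma riesz_const_nonneg: "0 \<le> riesz_const"
  unfolding riesz_const_def using grid_const_nonneg by (intro mult_nonneg_nonneg) auto

lemma range_bound:
  defines "s \<equiv> real CARD('n) * r"
  shows "(\<integral>\<^sup>+x. (\<integral>\<^sup>+y. ennreal (F y * (if in_range N x y then norm (x - y) powr (-s) else 0)) \<partial>lborel) epowr A * ennreal (w x powr A) \<partial>lborel)
    \<le> ennreal ((riesz_const * K powr (r * max A B) * Y powr (1/p)) powr A)"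
proof -
  let ?L = "\<lambda>T. cell_index (third_shift N T) N (2 * N) :: real ^ 'n \<Rightarrow> _"
  let ?h = "\<lambda>T x. grid_potential F (third_shift N T) N (?L T x)"
  let ?M = "real CARD('n set)"
  let ?Z = "grid_const * K powr (r * max A B) * Y powr (1/p)"
  let ?c = "6 powr (s * A) * ?M powr A"
  have M: "?M = 2 ^ CARD('n)" by (simp add: card_UNIV_set[symmetric] card_Pow flip: Pow_UNIV)
  have A0: "0 < A" using AB by simp
  have pw: "(\<integral>\<^sup>+y. ennreal (F y * (if in_range N x y then norm (x - y) powr (-s) else 0)) \<partial>lborel) epowr A * ennreal (w x powr A)
     \<le> ennreal ?c * (\<Sum>T\<in>UNIV. ennreal (?h T x powr A * w x powr A) * indicator {x. ?L T x \<in> atoms N} x)" for x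
  proof (cases "\<forall>i. \<bar>x $ i\<bar> \<le> 2 ^ N")
    case False
    then have "\<not> in_range N x y" for y by (auto simp: in_range_def)
    then show ?thesis using A0 by (simp add: epowr_def)
  next
    case True
    then have xa: "?L T x \<in> atoms N" for T by (intro cell_index_atoms) auto
    have "(\<integral>\<^sup>+y. ennreal (F y * (if in_range N x y then norm (x - y) powr (-s) else 0)) \<partial>lborel) epowr A
      \<le> ennreal (6 powr s * (\<Sum>T\<in>UNIV. ?h T x)) epowr A"
      using A0 True unfolding s_def by (intro epowr_mono range_potential_le) auto
    also have "\<dots> = ennreal ((6 powr s * (\<Sum>T\<in>UNIV. ?h T x)) powr A)"
      using A0 grid_potential_nonneg by (intro epowr_ennreal mult_nonneg_nonneg sum_nonneg) auto
    also have "\<dots> \<le> ennreal (?c * (\<Sum>T\<in>UNIV. ?h T x powr A))"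
    proof (rule ennreal_leI)
      have "(6 powr s * (\<Sum>T\<in>UNIV. ?h T x)) powr A = 6 powr (s * A) * (\<Sum>T\<in>UNIV. ?h T x) powr A"
        using grid_potential_nonneg by (simp add: powr_mult powr_powr sum_nonneg)
      also have "\<dots> \<le> 6 powr (s * A) * (?M powr A * (\<Sum>T\<in>UNIV. ?h T x powr A))"
        using A0 grid_potential_nonneg by (intro mult_left_mono powr_sum_le_card) auto
      finally show "(6 powr s * (\<Sum>T\<in>UNIV. ?h T x)) powr A \<le> ?c * (\<Sum>T\<in>UNIV. ?h T x powr A)" by (simp add: mult_ac)
    qed
    finally have "(\<integral>\<^sup>+y. ennreal (F y * (if in_range N x y then norm (x - y) powr (-s) else 0)) \<partial>lborel) epowr A * ennreal (w x powr A)
      \<le> ennreal (?c * (\<Sum>T\<in>UNIV. ?h T x powr A)) * ennreal (w x powr A)"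
      by (rule mult_right_mono) simp
    also have "\<dots> = ennreal (?c * (\<Sum>T\<in>UNIV. ?h T x powr A * w x powr A))"
      by (subst ennreal_mult[symmetric]) (auto intro!: mult_nonneg_nonneg sum_nonneg simp: sum_distrib_right mult.assoc)
    also have "\<dots> = ennreal ?c * (\<Sum>T\<in>UNIV. ennreal (?h T x powr A * w x powr A) * indicator {x. ?L T x \<in> atoms N} x)"
    proof -
      have "ennreal (?c * (\<Sum>T\<in>UNIV. ?h T x powr A * w x powr A)) = ennreal ?c * ennreal (\<Sum>T\<in>UNIV. ?h T x powr A * w x powr A)"
        by (rule ennreal_mult) (auto intro: sum_nonneg)
      also have "ennreal (\<Sum>T\<in>UNIV. ?h T x powr A * w x powr A) = (\<Sum>T\<in>UNIV. ennreal (?h T x powr A * w x powr A))"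
        by (rule sum_ennreal[symmetric]) auto
      finally show ?thesis using xa by simp
    qed
    finally show ?thesis .
  qed
  have meas: "(\<lambda>x. ennreal (?h T x powr A * w x powr A) * indicator {x. ?L T x \<in> atoms N} x) \<in> borel_measurable lborel" for T
  proof -
    have "(\<lambda>x. ennreal (?h T x powr A * w x powr A) * indicator {x. ?L T x \<in> atoms N} x)
      = (\<lambda>x. \<Sum>a\<in>atoms N. ennreal (grid_potential F (third_shift N T) N a powr A * w x powr A) * indicator {x. ?L T x = a} x)"
    proof
      fix x
      have "(\<Sum>a\<in>atoms N. ennreal (grid_potential F (third_shift N T) N a powr A * w x powr A) * indicator {x. ?L T x = a} x)
        = (\<Sum>a\<in>atoms N. if a = ?L T x then ennreal (grid_potential F (third_shift N T) N a powr A * w x powr A) else 0)"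
        by (intro sum.cong refl) (auto simp: indicator_def)
      then show "ennreal (?h T x powr A * w x powr A) * indicator {x. ?L T x \<in> atoms N} x
        = (\<Sum>a\<in>atoms N. ennreal (grid_potential F (third_shift N T) N a powr A * w x powr A) * indicator {x. ?L T x = a} x)"
        by (simp add: sum.delta' finite_atoms)
    qed
    also have "\<dots> \<in> borel_measurable lborel" by measurable
    finally show ?thesis .
  qed
  have "(\<integral>\<^sup>+x. (\<integral>\<^sup>+y. ennreal (F y * (if in_range N x y then norm (x - y) powr (-s) else 0)) \<partial>lborel) epowr A * ennreal (w x powr A) \<partial>lborel)
    \<le> (\<integral>\<^sup>+x. ennreal ?c * (\<Sum>T\<in>UNIV. ennreal (?h T x powr A * w x powr A) * indicator {x. ?L T x \<in> atoms N} x) \<partial>lborel)"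
    by (intro nn_integral_mono pw)
  also have "\<dots> = ennreal ?c * (\<integral>\<^sup>+x. (\<Sum>T\<in>UNIV. ennreal (?h T x powr A * w x powr A) * indicator {x. ?L T x \<in> atoms N} x) \<partial>lborel)"
    by (intro nn_integral_cmult borel_measurable_sum meas)
  also have "\<dots> = ennreal ?c * (\<Sum>T\<in>UNIV. \<integral>\<^sup>+x. ennreal (?h T x powr A * w x powr A) * indicator {x. ?L T x \<in> atoms N} x \<partial>lborel)"
    by (subst nn_integral_sum[OF meas]) simp
  also have "\<dots> \<le> ennreal ?c * (\<Sum>T\<in>(UNIV :: 'n set set). ennreal (?Z powr A))"
    by (intro mult_left_mono sum_mono single_grid) auto
  also have "\<dots> = ennreal ?c * ennreal (?M * ?Z powr A)"
    by (simp add: ennreal_mult ennreal_of_nat_eq_real_of_nat del: card_UNIV_set)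
  also have "\<dots> = ennreal (?c * (?M * ?Z powr A))"
    by (subst ennreal_mult) auto
  also have "?c * (?M * ?Z powr A) = (riesz_const * K powr (r * max A B) * Y powr (1/p)) powr A"
  proof -
    have "(riesz_const * K powr (r * max A B) * Y powr (1/p)) = 6 powr s * ?M * ?M powr (1/A) * ?Z"
      unfolding riesz_const_def M s_def by (simp add: mult_ac)
    also have "\<dots> powr A = ?c * (?M * ?Z powr A)"
      using A0 grid_const_nonneg by (simp add: powr_mult powr_powr del: card_UNIV_set)
    finally show ?thesis by simp
  qed
  finally show ?thesis .
qed

text \<open>Monotone convergence in \<open>N\<close>, applied first to the inner and then to the outer integral.\<close>
theorem riesz_bound:
  defines "s \<equiv> real CARD('n) * r"
  shows "(\<integral>\<^sup>+x. (\<integral>\<^sup>+y. ennreal (F y * norm (x - y) powr (-s)) \<partial>lborel) epowr A * ennreal (w x powr A) \<partial>lborel)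
    \<le> ennreal ((riesz_const * K powr (r * max A B) * Y powr (1/p)) powr A)"
proof -
  let ?k = "\<lambda>N (x :: real ^ 'n) y. if in_range N x y then norm (x - y) powr (-s) else 0"
  let ?I = "\<lambda>N x. \<integral>\<^sup>+y. ennreal (F y * ?k N x y) \<partial>lborel"
  have A0: "0 < A" using AB by simp
  have tr_mono: "in_range (Suc N) x y" if "in_range N x y" for N and x y :: "real ^ 'n"
  proof -
    have "\<bar>z\<bar> \<le> 2 ^ Suc N" if "\<bar>z\<bar> \<le> 2 ^ N" for z :: real
      using order_trans[OF that power_increasing[of N "Suc N" "2::real"]] by simp
    moreover have "(1 / 2 ^ Suc N) / 6 \<le> (1 / 2 ^ N) / (6::real)" "2 ^ N / 3 \<le> 2 ^ Suc N / (3::real)" by (auto simp: field_simps)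
    ultimately show ?thesis using that unfolding in_range_def by (smt (verit))
  qed
  have k_mono: "?k N x y \<le> ?k (Suc N) x y" for N x y using tr_mono[of N x y] by auto
  have F_mono: "incseq (\<lambda>N y. ennreal (F y * ?k N x y))" for x
    unfolding incseq_Suc_iff le_fun_def by (intro allI ennreal_leI mult_left_mono k_mono F0)
  have lim: "(SUP N. ennreal (F y * ?k N x y)) = ennreal (F y * norm (x - y) powr (-s))" for x y
  proof (rule antisym)
    show "(SUP N. ennreal (F y * ?k N x y)) \<le> ennreal (F y * norm (x - y) powr (-s))"
      using F0 by (intro SUP_least ennreal_leI mult_left_mono) auto
    show "ennreal (F y * norm (x - y) powr (-s)) \<le> (SUP N. ennreal (F y * ?k N x y))"
    proof (cases "x = y")
      case False
      then have \<rho>: "0 < infnorm (x - y)" by (simp add: infnorm_pos_lt)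
      \<comment> \<open>All four requirements of \<open>in_range\<close> hold as soon as \<open>2\<^sup>N\<close> exceeds \<open>b\<close>.\<close>
      define b where "b = max (max (infnorm x) (infnorm y)) (max (1 / infnorm (x - y)) (3 * infnorm (x - y)))"
      obtain N where N: "b < 2 ^ N" using real_arch_pow[of 2 b] by auto
      have b: "infnorm x \<le> b" "infnorm y \<le> b" "1 / infnorm (x - y) \<le> b" "3 * infnorm (x - y) \<le> b"
        unfolding b_def by linarith+
      have "1 / infnorm (x - y) \<le> 2 ^ N" using b N by linarith
      then have "1 / 2 ^ N \<le> infnorm (x - y)" using \<rho> by (simp add: field_simps)
      moreover have "1 / 2 ^ N / 6 \<le> 1 / (2::real) ^ N" by (simp add: field_simps)
      ultimately have "1 / 2 ^ N / 6 \<le> infnorm (x - y)" by (rule order_trans[rotated])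
      moreover have "infnorm (x - y) < 2 ^ N / 3" using b N by linarith
      moreover have "\<bar>x $ i\<bar> \<le> 2 ^ N" "\<bar>y $ i\<bar> \<le> 2 ^ N" for i
        using b N component_le_infnorm_cart[of x i] component_le_infnorm_cart[of y i] by linarith+
      ultimately have "in_range N x y" by (auto simp: in_range_def)
      then have "ennreal (F y * norm (x - y) powr (-s)) = ennreal (F y * ?k N x y)" by simp
      also have "\<dots> \<le> (SUP N. ennreal (F y * ?k N x y))" by (intro SUP_upper) auto
      finally show ?thesis .
    qed simp
  qed
  have [measurable]: "Measurable.pred (borel \<Otimes>\<^sub>M borel) (\<lambda>z :: (real ^ 'n) \<times> (real ^ 'n). in_range N (fst z) (snd z))" for N
  proof -
    have [measurable]: "(\<lambda>z :: (real ^ 'n) \<times> (real ^ 'n). infnorm (fst z - snd z)) \<in> borel_measurable (borel \<Otimes>\<^sub>M borel)"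
      "(\<lambda>z :: (real ^ 'n) \<times> (real ^ 'n). fst z $ i) \<in> borel_measurable (borel \<Otimes>\<^sub>M borel)"
      "(\<lambda>z :: (real ^ 'n) \<times> (real ^ 'n). snd z $ i) \<in> borel_measurable (borel \<Otimes>\<^sub>M borel)" for i
      unfolding borel_prod by (intro borel_measurable_continuous_onI continuous_intros)+
    show ?thesis unfolding in_range_def by measurable
  qed
  have kmeas: "(\<lambda>z. ennreal (F (snd z) * ?k N (fst z) (snd z))) \<in> borel_measurable (lborel \<Otimes>\<^sub>M lborel)" for N
    unfolding borel_prod by (simp add: measurable_cong_sets[OF sets_pair_measure_cong[OF sets_lborel sets_lborel] refl]) measurable
  have k1: "(\<lambda>y. ennreal (F y * ?k N x y)) \<in> borel_measurable lborel" for N x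
  proof -
    have "x \<in> space lborel" by simp
    from measurable_Pair2[OF kmeas this] show ?thesis by (simp only: fst_conv snd_conv)
  qed
  have Imeas: "?I N \<in> borel_measurable lborel" for N
    using lborel.borel_measurable_nn_integral_fst[OF kmeas] by (simp only: fst_conv snd_conv)
  have I_SUP: "(\<integral>\<^sup>+y. ennreal (F y * norm (x - y) powr (-s)) \<partial>lborel) = (SUP N. ?I N x)" for x
    unfolding lim[symmetric] using F_mono k1 by (intro nn_integral_monotone_convergence_SUP) auto
  have G_inc: "incseq (\<lambda>N x. (?I N x) epowr A * ennreal (w x powr A))"
    unfolding incseq_Suc_iff le_fun_def
  proof (intro allI mult_right_mono epowr_mono nn_integral_mono A0)
    fix N x y
    show "ennreal (F y * ?k N x y) \<le> ennreal (F y * ?k (Suc N) x y)"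
      using k_mono F0 by (intro ennreal_leI mult_left_mono)
  qed simp
  have "(\<integral>\<^sup>+x. (\<integral>\<^sup>+y. ennreal (F y * norm (x - y) powr (-s)) \<partial>lborel) epowr A * ennreal (w x powr A) \<partial>lborel)
    = (\<integral>\<^sup>+x. (SUP N. (?I N x) epowr A * ennreal (w x powr A)) \<partial>lborel)"
    unfolding I_SUP epowr_SUP[OF A0] SUP_mult_right_ennreal ..
  also have "\<dots> = (SUP N. \<integral>\<^sup>+x. (?I N x) epowr A * ennreal (w x powr A) \<partial>lborel)"
    using Imeas by (intro nn_integral_monotone_convergence_SUP G_inc borel_measurable_times_ennreal measurable_epowr) auto
  also have "\<dots> \<le> ennreal ((riesz_const * K powr (r * max A B) * Y powr (1/p)) powr A)"
    unfolding s_def by (intro SUP_least range_bound)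
  finally show ?thesis .
qed

end
end

section \<open>The upper bound for weights in the class\<close>

lemma epowr_less_top_iff: "0 < r \<Longrightarrow> x epowr r < top \<longleftrightarrow> x < top"
  by (cases x) (auto simp: epowr_ennreal epowr_top)

lemma epowr_pos_iff: "0 < r \<Longrightarrow> 0 < x epowr r \<longleftrightarrow> 0 < x"
  by (cases x) (auto simp: epowr_ennreal epowr_top less_le)

lemma weight_measurable:
  fixes w :: "real ^ 'n \<Rightarrow> real"
  assumes "weight w" shows "w \<in> borel_measurable lebesgue"
proof (rule borel_measurable_LIMSEQ_real)
  fix x :: "real ^ 'n"
  obtain N where N: "norm x \<le> real N" using real_arch_simple by blast
  have "eventually (\<lambda>i. indicator (cball 0 (real i)) x *\<^sub>R w x = w x) sequentially"
    using eventually_ge_at_top[of N] by eventually_elim (use N in \<open>auto simp: indicator_def\<close>)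
  then show "(\<lambda>i. indicator (cball 0 (real i)) x *\<^sub>R w x) \<longlonglongrightarrow> w x"
    by (rule tendsto_eventually)
next
  fix i
  have "w absolutely_integrable_on cball 0 (real i)" using assms by (simp add: weight_def)
  then show "(\<lambda>x. indicator (cball 0 (real i)) x *\<^sub>R w x) \<in> borel_measurable lebesgue"
    unfolding set_integrable_def by (rule borel_measurable_integrable)
qed

lemma lborel_version:
  fixes w :: "'a :: euclidean_space \<Rightarrow> real"
  assumes "w \<in> borel_measurable lebesgue"
  obtains g where "g \<in> borel_measurable borel" "AE x in lborel. w x = g x"
proof -
  obtain g where "g \<in> borel_measurable lborel" "AE x in lborel. w x = g x"
    using completion_ex_borel_measurable_real[OF assms] by blast
  then show ?thesis by (intro that) auto
qed

lemma emeasure_cube: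
  assumes "0 < h" shows "emeasure lebesgue (cbox a (a + h *\<^sub>R One) :: (real ^ 'n) set) = ennreal (h ^ CARD('n))"
  using assms by (subst emeasure_completion) (auto simp: emeasure_lborel_cbox inner_simps)

text \<open>Integrals over the closed cubes that enter the constant of the class.\<close>
definition cube_integral :: "(real ^ 'n \<Rightarrow> ennreal) \<Rightarrow> real ^ 'n \<Rightarrow> real \<Rightarrow> ennreal" where
  "cube_integral g a h = (\<integral>\<^sup>+x. g x * indicator (cbox a (a + h *\<^sub>R One)) x \<partial>lborel)"

lemma average_cube:
  fixes g :: "real ^ 'n \<Rightarrow> ennreal"
  assumes "0 < h" shows "average (cbox a (a + h *\<^sub>R One)) g = cube_integral g a h / ennreal (h ^ CARD('n))"
  unfolding average_def cube_integral_def emeasure_cube[OF assms] nn_integral_completion ..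

lemma Apq_const_ge:
  assumes "0 < h"
  shows "(cube_integral (\<lambda>x. ennreal (w x) epowr q) a h / ennreal (h ^ CARD('n))) *
    (cube_integral (\<lambda>x. ennreal (w x) epowr (- conj_exponent p)) a h / ennreal (h ^ CARD('n))) epowr (q / conj_exponent p)
    \<le> Apq_const p q (w :: real ^ 'n \<Rightarrow> real)"
proof -
  have "cbox a (a + h *\<^sub>R One) \<in> cubes" unfolding cubes_def using assms by blast
  then show ?thesis unfolding Apq_const_def
    by (rule SUP_upper2) (simp add: average_cube assms)
qed

lemma cube_integral_pos:
  fixes g :: "real ^ 'n \<Rightarrow> ennreal"
  assumes [measurable]: "g \<in> borel_measurable borel" and "AE x in lborel. 0 < g x" and h: "0 < h"
  shows "0 < cube_integral g a h"
proof (rule ccontr)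
  assume "\<not> 0 < cube_integral g a h"
  then have "cube_integral g a h = 0" by simp
  then have "AE x in lborel. g x * indicator (cbox a (a + h *\<^sub>R One)) x = 0"
    unfolding cube_integral_def by (subst (asm) nn_integral_0_iff_AE) auto
  with assms(2) have "AE x in lborel. x \<notin> cbox a (a + h *\<^sub>R One)"
    by eventually_elim (auto simp: indicator_def)
  then have "emeasure lborel (cbox a (a + h *\<^sub>R One)) = 0"
    by (subst (asm) AE_iff_measurable[OF _ refl]) auto
  then show False using emeasure_cube[OF h, of a] zero_less_power[OF h, of "CARD('n)"]
    by (simp add: ennreal_eq_0_iff del: zero_less_power)
qed

lemma cint_cong_AE: "AE x in lborel. g x = g' x \<Longrightarrow> cube_integral g a h = cube_integral g' a h"
  unfolding cube_integral_def by (intro nn_integral_cong_AE) (auto elim: eventually_mono)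

lemma ennreal_divide_less_top: "(x / ennreal c < top) \<longleftrightarrow> x < top" if "0 < c"
  using that by (cases x) (auto simp: divide_ennreal ennreal_top_divide)

text \<open>On a large cube the average of \<open>g\<^sup>q\<close> is positive, so finiteness of the product forces the average of \<open>g\<^bsup>-p'\<^esup>\<close> to be
  finite, and \<open>g\<close> cannot vanish on a set of positive measure there.\<close>
lemma Apq_positive_AE:
  fixes g :: "real ^ 'n \<Rightarrow> real"
  assumes g [measurable]: "g \<in> borel_measurable borel" and g0: "AE x in lborel. 0 \<le> g x"
    and fin: "Apq_const p q g < \<infinity>" and pq: "1 < p" "0 < q"
    and nz: "\<not> (AE x in lborel. g x = 0)"
  shows "AE x in lborel. 0 < g x"
proof -
  have p': "0 < conj_exponent p" using pq by (simp add: conj_exponent_def)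
  define C where "C m = cbox (- (real m *\<^sub>R One)) (- (real m *\<^sub>R One) + (2 * real m) *\<^sub>R (One :: real ^ 'n))" for m
  have C: "x \<in> C m" if "infnorm x \<le> real m" for x m
    unfolding C_def mem_box_cart
  proof
    fix i
    have "\<bar>x $ i\<bar> \<le> real m" using component_le_infnorm_cart[of x i] that by linarith
    then show "(- (real m *\<^sub>R One)) $ i \<le> x $ i \<and> x $ i \<le> (- (real m *\<^sub>R One) + (2 * real m) *\<^sub>R One) $ i" by (simp add: abs_le_iff)
  qed
  have Cev: "eventually (\<lambda>m. x \<in> C m) sequentially" for x
  proof -
    obtain N where "infnorm x \<le> real N" using real_arch_simple by blast
    then have "x \<in> C m" if "N \<le> m" for m using that by (intro C) linarith
    then show ?thesis unfolding eventually_sequentially by blast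
  qed
  define U where "U m = cube_integral (\<lambda>x. ennreal (g x) epowr q) (- (real m *\<^sub>R One)) (2 * real m)" for m
  define S where "S m = cube_integral (\<lambda>x. ennreal (g x) epowr (- conj_exponent p)) (- (real m *\<^sub>R One)) (2 * real m)" for m
  have "\<exists>N>0. 0 < U N"
  proof (rule ccontr)
    assume *: "\<not> (\<exists>N>0. 0 < U N)"
    have "AE x in lborel. \<forall>m\<in>{0<..}. ennreal (g x) epowr q * indicator (C m) x = 0"
    proof (subst AE_ball_countable)
      show "\<forall>m\<in>{0<..}. AE x in lborel. ennreal (g x) epowr q * indicator (C m) x = 0"
      proof
        fix m :: nat assume "m \<in> {0<..}"
        then have "U m = 0" using * by (metis greaterThan_iff zero_less_iff_neq_zero)
        then show "AE x in lborel. ennreal (g x) epowr q * indicator (C m) x = 0"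
          unfolding U_def cube_integral_def C_def by (subst (asm) nn_integral_0_iff_AE) auto
      qed
    qed auto
    with g0 have "AE x in lborel. g x = 0"
    proof eventually_elim
      case (elim x)
      have "eventually (\<lambda>m. x \<in> C m \<and> 0 < m) sequentially"
        using Cev eventually_gt_at_top by (rule eventually_conj)
      then obtain m where "x \<in> C m" "0 < m" by (auto simp: eventually_sequentially)
      then have "ennreal (g x) epowr q = 0" using elim by (auto simp: indicator_def)
      then show ?case using elim pq by (auto simp: epowr_ennreal ennreal_eq_0_iff)
    qed
    with nz show False by simp
  qed
  then obtain N where N: "0 < N" "0 < U N" by blast
  have Upos: "0 < U m" if "N \<le> m" for m
  proof -
    have "C N \<subseteq> C m"
    proof
      fix x assume x: "x \<in> C N"
      have "- real m \<le> x $ i \<and> x $ i \<le> real m" for i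
      proof -
        have "- real N \<le> x $ i" "x $ i \<le> real N" using x by (auto simp: C_def mem_box_cart)
        then show ?thesis using that by linarith
      qed
      then show "x \<in> C m" by (simp add: C_def mem_box_cart)
    qed
    then have "U N \<le> U m" unfolding U_def cube_integral_def C_def
      by (intro nn_integral_mono mult_left_mono) (auto simp: indicator_def)
    then show ?thesis using N by auto
  qed
  have Sfin: "S m < top" if m: "N \<le> m" for m
  proof -
    let ?c = "ennreal ((2 * real m) ^ CARD('n))"
    have m0: "0 < 2 * real m" using m N by simp
    have "(U m / ?c) * (S m / ?c) epowr (q / conj_exponent p) < top"
      using le_less_trans[OF Apq_const_ge[OF m0, of g q "- (real m *\<^sub>R One)" p] fin] unfolding U_def S_def by simp
    moreover have "U m / ?c \<noteq> 0" using Upos[OF m] by (simp add: ennreal_divide_eq_0_iff)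
    ultimately have "(S m / ?c) epowr (q / conj_exponent p) < top"
      by (auto simp: ennreal_mult_less_top)
    then show ?thesis using p' pq m0 by (simp add: epowr_less_top_iff ennreal_divide_less_top)
  qed
  have "AE x in lborel. \<forall>m\<in>{N..}. x \<in> C m \<longrightarrow> 0 < g x"
  proof (subst AE_ball_countable)
    show "\<forall>m\<in>{N..}. AE x in lborel. x \<in> C m \<longrightarrow> 0 < g x"
    proof
      fix m assume "m \<in> {N..}"
      then have "S m \<noteq> \<infinity>" using Sfin by (auto simp: less_top)
      then have "AE x in lborel. ennreal (g x) epowr (- conj_exponent p) * indicator (C m) x \<noteq> \<infinity>"
        unfolding S_def cube_integral_def C_def by (intro nn_integral_PInf_AE) auto
      then show "AE x in lborel. x \<in> C m \<longrightarrow> 0 < g x"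
      proof eventually_elim
        case (elim x)
        show ?case
        proof
          assume "x \<in> C m"
          then have "ennreal (g x) epowr (- conj_exponent p) \<noteq> \<infinity>" using elim by simp
          then show "0 < g x" using p' by (auto simp: epowr_def ennreal_eq_0_iff split: if_splits)
        qed
      qed
    qed
  qed auto
  then show ?thesis
  proof eventually_elim
    case (elim x)
    have "eventually (\<lambda>m. x \<in> C m \<and> N \<le> m) sequentially"
      using Cev eventually_ge_at_top by (rule eventually_conj)
    then show ?case using elim by (auto simp: eventually_sequentially)
  qed
qed

text \<open>Both averages are positive and their product is finite, hence both are finite; the power \<open>1/q\<close> of the
  condition is the inequality required by the locale.\<close>
lemma cube_weight_Apq:
  fixes w :: "real ^ 'n \<Rightarrow> real"
  assumes [measurable]: "w \<in> borel_measurable borel" and w0: "\<And>x. 0 < w x"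
    and fin: "Apq_const p q w < \<infinity>" and pq: "1 < p" "1 < q" "1 / q + 1 / conj_exponent p < 1"
  shows "cube_weight w q (conj_exponent p) (enn2real (Apq_const p q w) powr (1 / q))"
proof -
  let ?p' = "conj_exponent p"
  have p': "1 < ?p'" using pq by (simp add: conj_exponent_def)
  define W where "W = enn2real (Apq_const p q w)"
  have W: "Apq_const p q w = ennreal W" "0 \<le> W" using fin by (auto simp: W_def)
  have ep: "ennreal (w x) epowr e = ennreal (w x powr e)" for x e
    using w0[of x] by (auto simp: epowr_def ennreal_eq_0_iff not_le)
  define U where "U a h = cube_integral (\<lambda>x. ennreal (w x powr q)) a h" for a h
  define S where "S a h = cube_integral (\<lambda>x. ennreal (w x powr (- ?p'))) a h" for a h
  have pos: "0 < U a h" "0 < S a h" if "0 < h" for a h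
    unfolding U_def S_def using that w0 by (auto intro!: cube_integral_pos AE_I2 simp: less_imp_neq[symmetric])
  have le: "(U a h / ennreal (h ^ CARD('n))) * (S a h / ennreal (h ^ CARD('n))) epowr (q / ?p') \<le> ennreal W" if "0 < h" for a h
    using Apq_const_ge[OF that, of w q a p] unfolding U_def S_def W ep .
  have finUS: "U a h < top" "S a h < top" if h: "0 < h" for a h
  proof -
    let ?c = "ennreal (h ^ CARD('n))"
    have c: "0 < h ^ CARD('n)" using h by simp
    have lt: "(U a h / ?c) * (S a h / ?c) epowr (q / ?p') < top"
      using le_less_trans[OF le[OF h] ennreal_less_top] .
    have nz: "U a h / ?c \<noteq> 0" "S a h / ?c \<noteq> 0" using pos[OF h, of a] by (auto simp: ennreal_divide_eq_0_iff)
    then have "(S a h / ?c) epowr (q / ?p') \<noteq> 0" using epowr_pos_iff[of "q / ?p'" "S a h / ?c"] pq p' by (auto simp: zero_less_iff_neq_zero)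
    with nz lt have "U a h / ?c < top" "(S a h / ?c) epowr (q / ?p') < top" by (auto simp: ennreal_mult_less_top)
    then show "U a h < top" "S a h < top" using c p' pq by (auto simp: epowr_less_top_iff ennreal_divide_less_top)
  qed
  have leU: "(\<integral>\<^sup>+x. ennreal (w x powr q) * indicator (hcube a h) x \<partial>lborel) \<le> U a h" for a h
    unfolding U_def cube_integral_def using hcube_sub(1)[of a h] by (intro nn_integral_mono mult_left_mono) (auto simp: indicator_def)
  have leS: "(\<integral>\<^sup>+x. ennreal (w x powr (- ?p')) * indicator (hcube a h) x \<partial>lborel) \<le> S a h" for a h
    unfolding S_def cube_integral_def using hcube_sub(1)[of a h] by (intro nn_integral_mono mult_left_mono) (auto simp: indicator_def)
  show ?thesis
  proof
    show "w \<in> borel_measurable borel" by simp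
    show "0 < w x" for x by (rule w0)
    show "1 < q" "1 < ?p'" "1 / q + 1 / ?p' < 1" using pq p' by auto
    fix a :: "real ^ 'n" and h :: real assume h: "0 < h"
    show "(\<integral>\<^sup>+x. ennreal (w x powr q) * indicator (hcube a h) x \<partial>lborel) < \<infinity>"
      using le_less_trans[OF leU finUS(1)[OF h]] by simp
    show "(\<integral>\<^sup>+x. ennreal (w x powr (- ?p')) * indicator (hcube a h) x \<partial>lborel) < \<infinity>"
      using le_less_trans[OF leS finUS(2)[OF h]] by simp
    define c u s where "c = h ^ CARD('n)" "u = enn2real (U a h)" "s = enn2real (S a h)"
    have c: "0 < c" using h by (simp add: c_u_s_def)
    have us: "U a h = ennreal u" "S a h = ennreal s" "0 \<le> u" "0 \<le> s" using finUS[OF h, of a] by (auto simp: c_u_s_def)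
    have "ennreal ((u / c) * (s / c) powr (q / ?p')) \<le> ennreal W"
    proof -
      have "ennreal ((u / c) * (s / c) powr (q / ?p')) = ennreal (u / c) * ennreal ((s / c) powr (q / ?p'))"
        using us c by (intro ennreal_mult) auto
      also have "\<dots> = (U a h / ennreal c) * (S a h / ennreal c) epowr (q / ?p')"
        using us c pq p' by (simp add: divide_ennreal epowr_ennreal)
      finally show ?thesis using le[OF h, of a] by (simp add: c_u_s_def(1))
    qed
    then have le2: "(u / c) * (s / c) powr (q / ?p') \<le> W" using W(2) by (subst (asm) ennreal_le_iff)
    have "((u / c) * (s / c) powr (q / ?p')) powr (1 / q) \<le> W powr (1 / q)"
      using pq us c by (intro powr_mono2 le2) auto
    moreover have "((u / c) * (s / c) powr (q / ?p')) powr (1 / q) = u powr (1 / q) * s powr (1 / ?p') / c powr (1 / q + 1 / ?p')"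
      using us c pq by (simp add: powr_mult powr_powr powr_divide powr_add)
    ultimately have "u powr (1 / q) * s powr (1 / ?p') \<le> W powr (1 / q) * c powr (1 / q + 1 / ?p')"
      using c by (simp add: pos_divide_le_eq)
    moreover have "enn2real (\<integral>\<^sup>+x. ennreal (w x powr q) * indicator (hcube a h) x \<partial>lborel) powr (1 / q) *
        enn2real (\<integral>\<^sup>+x. ennreal (w x powr (- ?p')) * indicator (hcube a h) x \<partial>lborel) powr (1 / ?p')
        \<le> u powr (1 / q) * s powr (1 / ?p')"
      using leU leS finUS[OF h] pq p' unfolding c_u_s_def
      by (intro mult_mono powr_mono2 enn2real_mono) auto
    ultimately show "enn2real (\<integral>\<^sup>+x. ennreal (w x powr q) * indicator (hcube a h) x \<partial>lborel) powr (1 / q) *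
        enn2real (\<integral>\<^sup>+x. ennreal (w x powr (- ?p')) * indicator (hcube a h) x \<partial>lborel) powr (1 / ?p')
        \<le> enn2real (Apq_const p q w) powr (1 / q) * (h ^ CARD('n)) powr (1 / q + 1 / ?p')"
      unfolding W_def[symmetric] c_u_s_def(1)[symmetric] by linarith
  qed
qed

lemma exponent_facts:
  fixes \<alpha> p q n :: real
  assumes "0 < \<alpha>" "\<alpha> < n" "1 < p" "p < n / \<alpha>" "1 / q = 1 / p - \<alpha> / n"
  shows "1 < q" "p < q" "1 / q + 1 / conj_exponent p = 1 - \<alpha> / n" "1 < conj_exponent p"
    "conj_exponent p / (conj_exponent p - 1) = p"
proof -
  have n: "0 < n" using assms by linarith
  have "\<alpha> / n < 1 / p" using assms n by (simp add: field_simps)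
  then have "0 < 1 / q" using assms by simp
  then have q0: "0 < q" by simp
  have "1 / q < 1 / p" using assms n by simp
  then show pq: "p < q" using q0 frac_le[of 1 1 q p] by linarith
  then show "1 < q" using assms by linarith
  show "1 / q + 1 / conj_exponent p = 1 - \<alpha> / n" using assms conj_exponent[of p] by simp
  show "1 < conj_exponent p" using assms by (simp add: conj_exponent_def)
  show "conj_exponent p / (conj_exponent p - 1) = p" using assms by (simp add: conj_exponent_def field_simps)
qed

lemma riesz_integrand_abs:
  "ennreal (norm (riesz_integrand \<alpha> f x y)) = ennreal (\<bar>f y\<bar> * norm (x - y) powr (- (real CARD('n) - \<alpha>)))"
  for x :: "real ^ 'n"
  unfolding riesz_integrand_def by (simp add: abs_mult powr_minus_divide[of "norm (x - y)" "real CARD('n) - \<alpha>"] del: minus_diff_eq)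

lemma riesz_integrand_measurable:
  fixes f :: "real ^ 'n \<Rightarrow> real"
  assumes [measurable]: "f \<in> borel_measurable lebesgue"
  shows "riesz_integrand \<alpha> f x \<in> borel_measurable lebesgue"
proof -
  have "(\<lambda>y. norm (x - y) powr (real CARD('n) - \<alpha>)) \<in> borel_measurable lborel" for x :: "real ^ 'n" by measurable
  from measurable_completion[OF this] show ?thesis
    unfolding riesz_integrand_def[abs_def] by (intro borel_measurable_divide assms) simp
qed

lemma Lp_norm_weighted:
  fixes f :: "real ^ 'n \<Rightarrow> real"
  assumes f: "f \<in> borel_measurable lebesgue" and w: "w \<in> borel_measurable lebesgue" "0 < t"
  shows "Lp_norm t (weighted_measure (\<lambda>x. w x powr t)) f = (\<integral>\<^sup>+x. ennreal (\<bar>f x\<bar> powr t * w x powr t) \<partial>lebesgue) epowr (1 / t)"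
  unfolding Lp_norm_def weighted_measure_def using assms
  by (subst nn_integral_density) (auto simp: epowr_ennreal ennreal_mult mult.commute)

text \<open>If \<open>w\<close> vanishes almost everywhere, both weighted spaces are trivial.  Otherwise \<open>w\<close> is positive almost everywhere and
  agrees almost everywhere with a Borel function that is positive everywhere, to which \<open>riesz_bound\<close> applies.
  Finiteness of the bound gives absolute convergence of the potential almost everywhere.\<close>
theorem riesz_norm_le:
  fixes w :: "real ^ 'n \<Rightarrow> real"
  assumes \<alpha>: "0 < \<alpha>" "\<alpha> < real CARD('n)" and p: "1 < p" "p < real CARD('n) / \<alpha>"
    and q: "1 / q = 1 / p - \<alpha> / real CARD('n)" and w: "w \<in> Apq p q"
  shows "riesz_norm \<alpha> p (weighted_measure (\<lambda>x. w x powr p)) q (weighted_measure (\<lambda>x. w x powr q))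
    \<le> ennreal (cube_weight.riesz_const TYPE('n) q (conj_exponent p)) *
       Apq_const p q w epowr ((1 - \<alpha> / real CARD('n)) * max 1 (conj_exponent p / q))"
proof -
  let ?p' = "conj_exponent p" and ?C = "cube_weight.riesz_const TYPE('n) q (conj_exponent p)"
  let ?\<mu> = "weighted_measure (\<lambda>x. w x powr p)" and ?\<nu> = "weighted_measure (\<lambda>x. w x powr q)"
  note ex = exponent_facts[OF \<alpha> p q]
  have q0: "0 < q" and p0: "0 < p" using ex p by auto
  have wt: "weight w" and fin: "Apq_const p q w < \<infinity>" using w by (auto simp: Apq_def)
  have w0: "0 \<le> w x" for x using wt by (simp add: weight_def)
  have wm: "w \<in> borel_measurable lebesgue" using wt by (rule weight_measurable)
  have wmq: "(\<lambda>x. ennreal (w x powr q)) \<in> borel_measurable lebesgue" using wm by simp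
  obtain g where g [measurable]: "g \<in> borel_measurable borel" and wg: "AE x in lborel. w x = g x"
    using lborel_version[OF wm] .
  show ?thesis
  proof (cases "AE x in lborel. w x = 0")
    case True
    have \<nu>: "?\<nu> = null_measure lebesgue"
      unfolding weighted_measure_def null_measure_eq_density
      using wm True by (intro density_cong) (auto simp: AE_completion_iff elim: eventually_mono)
    have ae: "AE x in null_measure lebesgue. P x" for P :: "real ^ 'n \<Rightarrow> bool"
      unfolding null_measure_eq_density by (subst AE_density) auto
    have "Lp_norm q (null_measure lebesgue) h = 0" for h :: "real ^ 'n \<Rightarrow> real"
      using q0 by (simp add: Lp_norm_def epowr_def)
    then have "riesz_norm \<alpha> p ?\<mu> q ?\<nu> \<le> 0"
      unfolding riesz_norm_def \<nu> using ae by (intro Inf_lower) auto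
    then show ?thesis by simp
  next
    case False
    \<comment> \<open>Any positive value would do where \<open>g\<close> is not positive, a null set.\<close>
    define v where "v x = (if 0 < g x then g x else 1)" for x
    have v [measurable]: "v \<in> borel_measurable borel" unfolding v_def[abs_def] by measurable
    have v0: "0 < v x" for x by (simp add: v_def)
    have const_cong: "Apq_const p q w = Apq_const p q w'" if "AE x in lborel. w x = w' x" for w'
    proof -
      have "average Q (\<lambda>x. ennreal (w x) epowr e) = average Q (\<lambda>x. ennreal (w' x) epowr e)" for Q e
        unfolding average_def using that
        by (intro arg_cong2[of _ _ _ _ "(/)"] nn_integral_cong_AE refl) (auto simp: AE_completion_iff elim: eventually_mono)
      then show ?thesis unfolding Apq_const_def by simp
    qed
    have "AE x in lborel. 0 < g x"
    proof (rule Apq_positive_AE[OF g])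
      show "AE x in lborel. 0 \<le> g x" using wg by eventually_elim (use w0 in metis)
      show "Apq_const p q g < \<infinity>" using fin const_cong[OF wg] by simp
      show "\<not> (AE x in lborel. g x = 0)"
      proof
        assume "AE x in lborel. g x = 0"
        with wg have "AE x in lborel. w x = 0" by eventually_elim simp
        with False show False by simp
      qed
    qed (use p q0 in auto)
    with wg have wv: "AE x in lborel. w x = v x" by eventually_elim (simp add: v_def)
    define W where "W = enn2real (Apq_const p q w)"
    have W: "Apq_const p q w = ennreal W" "0 \<le> W" using fin by (auto simp: W_def)
    have cw: "cube_weight v q ?p' (W powr (1 / q))"
      unfolding W_def const_cong[OF wv] using v0 fin[unfolded const_cong[OF wv]] ex p \<alpha>
      by (intro cube_weight_Apq) auto
    interpret cube_weight v q ?p' "W powr (1 / q)" by (rule cw)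
    have pp: "cube_weight.p ?p' = p" using ex by (simp add: p_def)
    have rr: "real CARD('n) * r = real CARD('n) - \<alpha>"
      using ex(3) \<alpha> by (simp add: r_def right_diff_distrib)
    let ?e = "(1 - \<alpha> / real CARD('n)) * max 1 (?p' / q)"
    have e0: "0 < ?e" using \<alpha> by (intro mult_pos_pos) auto
    have Ke: "(W powr (1 / q)) powr (r * max q ?p') = W powr ?e"
    proof -
      have "1 / q * (r * max q ?p') = r * max 1 (?p' / q)"
        using q0 by (simp add: max_def field_simps)
      then show ?thesis using ex(3) by (simp add: powr_powr r_def)
    qed
    have main: "(AE x in ?\<nu>. integrable lebesgue (riesz_integrand \<alpha> f x)) \<and>
           Lp_norm q ?\<nu> (riesz_potential \<alpha> f) \<le> ennreal (?C * W powr ?e) * Lp_norm p ?\<mu> f" if f: "f \<in> Lp_space p ?\<mu>" for f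
    proof -
      have fm: "f \<in> borel_measurable lebesgue" using f by (simp add: Lp_space_def weighted_measure_def)
      obtain F0 where F0 [measurable]: "F0 \<in> borel_measurable borel" and fF0: "AE x in lborel. f x = F0 x"
        using lborel_version[OF fm] .
      define F where "F x = \<bar>F0 x\<bar>" for x
      have F [measurable]: "F \<in> borel_measurable borel" unfolding F_def[abs_def] by measurable
      have F_nn: "0 \<le> F x" for x by (simp add: F_def)
      have fF: "AE x in lborel. \<bar>f x\<bar> = F x" using fF0 by eventually_elim (simp add: F_def)
      let ?Y = "\<integral>\<^sup>+x. ennreal (F x powr p * v x powr p) \<partial>lborel"
      have nf: "Lp_norm p ?\<mu> f = ?Y epowr (1 / p)"
      proof -
        have "(\<integral>\<^sup>+x. ennreal (\<bar>f x\<bar> powr p * w x powr p) \<partial>lborel) = ?Y"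
          using fF wv by (intro nn_integral_cong_AE) (auto elim: eventually_elim2)
        then show ?thesis using Lp_norm_weighted[OF fm wm p0] by (simp add: nn_integral_completion)
      qed
      have "?Y epowr (1 / p) < top" using f nf by (simp add: Lp_space_def)
      then have "?Y < top" using p0 by (simp add: epowr_less_top_iff)
      define Y where "Y = enn2real ?Y"
      have Y: "?Y = ennreal Y" "0 \<le> Y" using \<open>?Y < top\<close> by (auto simp: Y_def)
      define I where "I x = (\<integral>\<^sup>+y. ennreal (F y * norm (x - y) powr (- (real CARD('n) - \<alpha>))) \<partial>lborel)" for x
      define Z where "Z = ?C * W powr ?e * Y powr (1 / p)"
      have C0: "0 \<le> ?C" by (rule riesz_const_nonneg[OF F F_nn, unfolded pp, OF Y])
      have Z0: "0 \<le> Z" unfolding Z_def using C0 by simp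
      have bd: "(\<integral>\<^sup>+x. I x epowr q * ennreal (v x powr q) \<partial>lborel) \<le> ennreal (Z powr q)"
        using riesz_bound[OF F F_nn, unfolded pp, OF Y] unfolding rr Ke I_def Z_def .
      have Im: "I \<in> borel_measurable lborel"
      proof -
        have "(\<lambda>z. ennreal (F (snd z) * norm (fst z - snd z) powr (- (real CARD('n) - \<alpha>)))) \<in> borel_measurable (lborel \<Otimes>\<^sub>M lborel)"
          unfolding measurable_cong_sets[OF sets_pair_measure_cong[OF sets_lborel sets_lborel] refl] by measurable
        from lborel.borel_measurable_nn_integral_fst[OF this] show ?thesis
          unfolding I_def[abs_def] by (simp only: fst_conv snd_conv)
      qed
      have If: "I x = (\<integral>\<^sup>+y. ennreal (norm (riesz_integrand \<alpha> f x y)) \<partial>lebesgue)" for x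
        unfolding I_def nn_integral_completion riesz_integrand_abs using fF
        by (intro nn_integral_cong_AE) (auto elim: eventually_mono)
      have int: "integrable lebesgue (riesz_integrand \<alpha> f x) \<longleftrightarrow> I x < top" for x
        unfolding integrable_iff_bounded If using riesz_integrand_measurable[OF fm] by simp
      have pot: "ennreal \<bar>riesz_potential \<alpha> f x\<bar> \<le> I x" for x
      proof (cases "integrable lebesgue (riesz_integrand \<alpha> f x)")
        case True
        then show ?thesis unfolding If riesz_potential_def real_norm_def[symmetric] by (rule integral_norm_bound_ennreal)
      next
        case False
        then show ?thesis unfolding riesz_potential_def by (simp add: not_integrable_integral_eq)
      qed
      have "AE x in lborel. I x epowr q * ennreal (v x powr q) \<noteq> \<infinity>"
        using Im le_less_trans[OF bd ennreal_less_top] by (intro nn_integral_PInf_AE) auto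
      then have "AE x in lborel. I x < top"
      proof eventually_elim
        case (elim x)
        have "v x powr q \<noteq> 0" using v0[of x] by simp
        then have "I x epowr q < top" using elim by (auto simp: ennreal_mult_eq_top_iff ennreal_eq_0_iff less_top not_le)
        then show ?case using q0 by (simp add: epowr_less_top_iff)
      qed
      then have "AE x in ?\<nu>. integrable lebesgue (riesz_integrand \<alpha> f x)"
        unfolding weighted_measure_def AE_density[OF wmq] AE_completion_iff int by (auto elim: eventually_mono)
      moreover have "Lp_norm q ?\<nu> (riesz_potential \<alpha> f) \<le> ennreal (?C * W powr ?e) * Lp_norm p ?\<mu> f"
      proof -
        have "(\<integral>\<^sup>+x. ennreal \<bar>riesz_potential \<alpha> f x\<bar> epowr q \<partial>?\<nu>) \<le> (\<integral>\<^sup>+x. I x epowr q \<partial>?\<nu>)"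
          using q0 by (intro nn_integral_mono epowr_mono pot)
        also have "\<dots> = (\<integral>\<^sup>+x. ennreal (w x powr q) * I x epowr q \<partial>lebesgue)"
          unfolding weighted_measure_def
          by (intro nn_integral_density wmq measurable_epowr measurable_completion Im)
        also have "\<dots> = (\<integral>\<^sup>+x. I x epowr q * ennreal (v x powr q) \<partial>lborel)"
          unfolding nn_integral_completion using wv by (intro nn_integral_cong_AE) (auto simp: mult.commute elim: eventually_mono)
        also note bd
        finally have "Lp_norm q ?\<nu> (riesz_potential \<alpha> f) \<le> ennreal (Z powr q) epowr (1 / q)"
          unfolding Lp_norm_def using q0 by (intro epowr_mono) auto
        also have "\<dots> = ennreal Z" using q0 Z0 by (simp add: epowr_ennreal powr_powr)
        also have "\<dots> = ennreal (?C * W powr ?e) * ennreal (Y powr (1 / p))"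
          unfolding Z_def using C0 by (intro ennreal_mult) auto
        also have "ennreal (Y powr (1 / p)) = Lp_norm p ?\<mu> f" unfolding nf Y(1) using Y(2) p0 by (simp add: epowr_ennreal)
        finally show ?thesis .
      qed
      ultimately show ?thesis ..
    qed
    have C0: "0 \<le> ?C"
    proof -
      have "0 \<le> (0::real)" by simp
      show ?thesis using riesz_const_nonneg[of "\<lambda>_. 0" 0] by (simp add: p_def)
    qed
    have "riesz_norm \<alpha> p ?\<mu> q ?\<nu> \<le> ennreal (?C * W powr ?e)"
      unfolding riesz_norm_def using main by (intro Inf_lower) blast
    also have "\<dots> = ennreal ?C * Apq_const p q w epowr ?e"
      unfolding W(1) using C0 W(2) e0 by (simp add: epowr_ennreal ennreal_mult)
    finally show ?thesis .
  qed
qed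

section \<open>Integrals of radial powers\<close>

definition annulus :: "real \<Rightarrow> (real ^ 'n) set" where
  "annulus \<rho> = {x. \<rho> \<le> norm x \<and> norm x < 2 * \<rho>}"

text \<open>The volume of an annulus of inner radius one.\<close>
definition annulus_const :: "'n::finite itself \<Rightarrow> real" where
  "annulus_const _ = unit_ball_vol (real CARD('n)) * (2 ^ CARD('n) - 1)"

lemma annulus_const_pos: "0 < annulus_const TYPE('n::finite)"
  using one_less_power[of "2::real" "CARD('n)"] by (simp add: annulus_const_def unit_ball_vol_pos)

lemma annulus_sets [measurable]: "annulus \<rho> \<in> sets borel"
  unfolding annulus_def by measurable

lemma annulus_measure:
  assumes "0 < \<rho>" shows "emeasure lborel (annulus \<rho> :: (real ^ 'n) set) = ennreal (annulus_const TYPE('n) * \<rho> ^ CARD('n))"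
proof -
  have "annulus \<rho> = (ball 0 (2 * \<rho>) - ball 0 \<rho> :: (real ^ 'n) set)" by (auto simp: annulus_def)
  then have "emeasure lborel (annulus \<rho> :: (real ^ 'n) set) = emeasure lborel (ball 0 (2 * \<rho>) :: (real ^ 'n) set) - emeasure lborel (ball 0 \<rho> :: (real ^ 'n) set)"
    using assms by (simp add: emeasure_Diff emeasure_ball subset_ball)
  also have "\<dots> = ennreal (unit_ball_vol (real CARD('n)) * (2 * \<rho>) ^ CARD('n) - unit_ball_vol (real CARD('n)) * \<rho> ^ CARD('n))"
    using assms by (simp add: emeasure_ball ennreal_minus)
  also have "unit_ball_vol (real CARD('n)) * (2 * \<rho>) ^ CARD('n) - unit_ball_vol (real CARD('n)) * \<rho> ^ CARD('n) = annulus_const TYPE('n) * \<rho> ^ CARD('n)"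
    by (simp add: annulus_const_def power_mult_distrib algebra_simps)
  finally show ?thesis .
qed

lemma annulus_power_bounds:
  fixes x :: "real ^ 'n"
  assumes \<rho>: "0 < \<rho>" and x: "x \<in> annulus \<rho>"
  shows "2 powr (- \<bar>\<gamma>\<bar>) * \<rho> powr \<gamma> \<le> norm x powr \<gamma>" "norm x powr \<gamma> \<le> 2 powr \<bar>\<gamma>\<bar> * \<rho> powr \<gamma>"
proof -
  have n: "\<rho> \<le> norm x" "norm x \<le> 2 * \<rho>" using x by (auto simp: annulus_def)
  have one: "2 powr (- \<bar>\<gamma>\<bar>) \<le> (1::real)" "1 \<le> (2::real) powr \<bar>\<gamma>\<bar>"
    using powr_mono[of "- \<bar>\<gamma>\<bar>" 0 "2::real"] powr_mono[of 0 "\<bar>\<gamma>\<bar>" "2::real"] by auto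
  have a: "2 powr (- \<bar>\<gamma>\<bar>) * \<rho> powr \<gamma> \<le> 1 * \<rho> powr \<gamma>" "1 * \<rho> powr \<gamma> \<le> 2 powr \<bar>\<gamma>\<bar> * \<rho> powr \<gamma>"
    using one by (intro mult_right_mono; simp)+
  show "2 powr (- \<bar>\<gamma>\<bar>) * \<rho> powr \<gamma> \<le> norm x powr \<gamma>"
  proof (cases "0 \<le> \<gamma>")
    case True
    then have "\<rho> powr \<gamma> \<le> norm x powr \<gamma>" using \<rho> n by (intro powr_mono2) auto
    then show ?thesis using a by linarith
  next
    case False
    have "(2 * \<rho>) powr \<gamma> \<le> norm x powr \<gamma>" using False \<rho> n by (intro powr_mono2') auto
    then show ?thesis using False \<rho> by (simp add: powr_mult)
  qed
  show "norm x powr \<gamma> \<le> 2 powr \<bar>\<gamma>\<bar> * \<rho> powr \<gamma>"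
  proof (cases "0 \<le> \<gamma>")
    case True
    then have "norm x powr \<gamma> \<le> (2 * \<rho>) powr \<gamma>" using \<rho> n by (intro powr_mono2) auto
    then show ?thesis using True \<rho> by (simp add: powr_mult)
  next
    case False
    have "norm x powr \<gamma> \<le> \<rho> powr \<gamma>" using False \<rho> n by (intro powr_mono2') auto
    then show ?thesis using a by linarith
  qed
qed

text \<open>On each annulus the power is constant up to a factor \<open>2\<close> to the power \<open>\<bar>\<gamma>\<bar>\<close>, and the sum over the annuli is geometric.\<close>
lemma annuli_integral:
  fixes z \<rho> \<gamma> :: real
  assumes \<rho>: "0 < \<rho>" and z: "0 < z" and dis: "disjoint_family (\<lambda>j. annulus (\<rho> * z ^ j) :: (real ^ 'n) set)"
    and \<kappa>: "\<kappa> = \<gamma> + real CARD('n)" "z powr \<kappa> < 1"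
  defines "I \<equiv> (\<integral>\<^sup>+x. ennreal (norm x powr \<gamma>) * indicator (\<Union>j. annulus (\<rho> * z ^ j)) x \<partial>(lborel :: (real ^ 'n) measure))"
  shows "ennreal (2 powr (- \<bar>\<gamma>\<bar>) * annulus_const TYPE('n) * (\<rho> powr \<kappa> / (1 - z powr \<kappa>))) \<le> I"
    "I \<le> ennreal (2 powr \<bar>\<gamma>\<bar> * annulus_const TYPE('n) * (\<rho> powr \<kappa> / (1 - z powr \<kappa>)))"
proof -
  let ?A = "\<lambda>j. annulus (\<rho> * z ^ j) :: (real ^ 'n) set"
  have pos: "0 < \<rho> * z ^ j" for j using \<rho> z by simp
  have trm: "(\<integral>\<^sup>+x. ennreal (c * (\<rho> * z ^ j) powr \<gamma>) * indicator (?A j) x \<partial>lborel) = ennreal (c * annulus_const TYPE('n) * \<rho> powr \<kappa> * (z powr \<kappa>) ^ j)"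
    if "0 \<le> c" for c j
  proof -
    have "(\<integral>\<^sup>+x. ennreal (c * (\<rho> * z ^ j) powr \<gamma>) * indicator (?A j) x \<partial>lborel) = ennreal (c * (\<rho> * z ^ j) powr \<gamma>) * ennreal (annulus_const TYPE('n) * (\<rho> * z ^ j) ^ CARD('n))"
      by (subst nn_integral_cmult_indicator) (auto simp: annulus_measure[OF pos])
    also have "\<dots> = ennreal (c * annulus_const TYPE('n) * ((\<rho> * z ^ j) powr \<gamma> * (\<rho> * z ^ j) powr real CARD('n)))"
      using that pos[of j] annulus_const_pos[where ?'n='n] by (simp add: ennreal_mult[symmetric] powr_realpow mult_ac)
    also have "(\<rho> * z ^ j) powr \<gamma> * (\<rho> * z ^ j) powr real CARD('n) = \<rho> powr \<kappa> * (z powr \<kappa>) ^ j"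
      using \<rho> z by (simp add: \<kappa>(1) powr_mult powr_realpow[symmetric] powr_powr powr_add algebra_simps)
    finally show ?thesis by (simp add: mult.assoc)
  qed
  have sums: "(\<Sum>j. ennreal (c * annulus_const TYPE('n) * \<rho> powr \<kappa> * (z powr \<kappa>) ^ j)) = ennreal (c * annulus_const TYPE('n) * (\<rho> powr \<kappa> / (1 - z powr \<kappa>)))" if "0 \<le> c" for c
  proof -
    have "(\<lambda>j. c * annulus_const TYPE('n) * \<rho> powr \<kappa> * (z powr \<kappa>) ^ j) sums (c * annulus_const TYPE('n) * \<rho> powr \<kappa> * (1 / (1 - z powr \<kappa>)))"
      using \<kappa>(2) by (intro sums_mult geometric_sums) auto
    then show ?thesis using that annulus_const_pos[where ?'n='n]
      by (intro sums_unique[symmetric, OF sums_ennreal[THEN iffD2]]) (auto intro!: mult_nonneg_nonneg divide_nonneg_nonneg simp: less_imp_le \<kappa>(2))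
  qed
  have I: "I = (\<Sum>j. \<integral>\<^sup>+x. ennreal (norm x powr \<gamma>) * indicator (?A j) x \<partial>lborel)"
  proof -
    have pt: "ennreal (norm x powr \<gamma>) * indicator (\<Union>j. ?A j) x = (\<Sum>j. ennreal (norm x powr \<gamma>) * indicator (?A j) x)" for x
      using suminf_indicator[OF dis, of x] by simp
    show ?thesis unfolding I_def pt by (intro nn_integral_suminf) measurable
  qed
  have "ennreal (2 powr (- \<bar>\<gamma>\<bar>) * annulus_const TYPE('n) * (\<rho> powr \<kappa> / (1 - z powr \<kappa>))) = (\<Sum>j. \<integral>\<^sup>+x. ennreal (2 powr (- \<bar>\<gamma>\<bar>) * (\<rho> * z ^ j) powr \<gamma>) * indicator (?A j) x \<partial>lborel)"
    by (simp add: trm sums)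
  also have "\<dots> \<le> I" unfolding I
    by (intro suminf_le nn_integral_mono) (auto simp: indicator_def intro!: ennreal_leI annulus_power_bounds pos)
  finally show "ennreal (2 powr (- \<bar>\<gamma>\<bar>) * annulus_const TYPE('n) * (\<rho> powr \<kappa> / (1 - z powr \<kappa>))) \<le> I" .
  have "I \<le> (\<Sum>j. \<integral>\<^sup>+x. ennreal (2 powr \<bar>\<gamma>\<bar> * (\<rho> * z ^ j) powr \<gamma>) * indicator (?A j) x \<partial>lborel)" unfolding I
    by (intro suminf_le nn_integral_mono) (auto simp: indicator_def intro!: ennreal_leI annulus_power_bounds pos)
  also have "\<dots> = ennreal (2 powr \<bar>\<gamma>\<bar> * annulus_const TYPE('n) * (\<rho> powr \<kappa> / (1 - z powr \<kappa>)))"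
    by (simp add: trm sums)
  finally show "I \<le> ennreal (2 powr \<bar>\<gamma>\<bar> * annulus_const TYPE('n) * (\<rho> powr \<kappa> / (1 - z powr \<kappa>)))" .
qed

text \<open>Converts the geometric series of the two lemmas below into multiples of \<open>1/\<delta>\<close>.\<close>
lemma one_minus_two_powr:
  assumes "0 < \<delta>" "\<delta> < 1" shows "\<delta> / 2 \<le> 1 - 2 powr (- \<delta>)" "1 - 2 powr (- \<delta>) \<le> (\<delta> :: real)"
proof -
  have "(1/2) powr \<delta> * 1 powr (1 - \<delta>) \<le> \<delta> * (1/2) + (1 - \<delta>) * (1::real)"
    using assms by (intro weighted_mean_ineq) auto
  then show "\<delta> / 2 \<le> 1 - 2 powr (- \<delta>)" by (simp add: powr_divide powr_minus_divide)
  have "1 + (- \<delta> * ln 2) \<le> exp (- \<delta> * ln 2)" by (rule exp_ge_add_one_self)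
  moreover have "\<delta> * ln 2 \<le> \<delta> * 1" using assms ln_2_less_1 by (intro mult_left_mono) auto
  ultimately show "1 - 2 powr (- \<delta>) \<le> \<delta>" by (simp add: powr_def)
qed

lemma annuli_disjoint_up: "disjoint_family (\<lambda>j. annulus (\<rho> * 2 ^ j) :: (real ^ 'n) set)" if "0 < \<rho>"
proof -
  have *: "annulus (\<rho> * 2 ^ i) \<inter> annulus (\<rho> * 2 ^ j) = ({} :: (real ^ 'n) set)" if "i < j" for i j
  proof -
    have "(2::real) ^ Suc i \<le> 2 ^ j" using that by (intro power_increasing) auto
    then have "2 * (\<rho> * 2 ^ i) \<le> \<rho> * 2 ^ j" using \<open>0 < \<rho>\<close> by simp
    then show ?thesis by (auto simp: annulus_def)
  qed
  show ?thesis unfolding disjoint_family_on_def using * by (metis Int_commute linorder_neqE_nat)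
qed

lemma annuli_disjoint_down: "disjoint_family (\<lambda>j. annulus (\<rho> * (1/2) ^ j) :: (real ^ 'n) set)" if "0 < \<rho>"
proof -
  have *: "annulus (\<rho> * (1/2) ^ i) \<inter> annulus (\<rho> * (1/2) ^ j) = ({} :: (real ^ 'n) set)" if "i < j" for i j
  proof -
    have "(1/2::real) ^ j \<le> (1/2) ^ Suc i" using that by (intro power_decreasing) auto
    then have "2 * (\<rho> * (1/2) ^ j) \<le> \<rho> * (1/2) ^ i" using \<open>0 < \<rho>\<close> by simp
    then show ?thesis by (auto simp: annulus_def)
  qed
  show ?thesis unfolding disjoint_family_on_def using * by (metis Int_commute linorder_neqE_nat)
qed

lemma exists_dyadic_up:
  assumes "1 \<le> (t::real)" shows "\<exists>j. 2 ^ j \<le> t \<and> t < 2 * 2 ^ j"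
proof -
  obtain N where N: "t < 2 ^ N" using real_arch_pow[of 2 t] by auto
  define k where "k = (LEAST k. t < 2 ^ k)"
  have k: "t < 2 ^ k" unfolding k_def using N by (rule LeastI)
  have "k \<noteq> 0" using k assms by (intro notI) simp
  then obtain j where j: "k = Suc j" by (cases k) auto
  have "\<not> t < 2 ^ j" using not_less_Least[of j "\<lambda>k. t < 2 ^ k"] j unfolding k_def by simp
  then show ?thesis using k j by (intro exI[of _ j]) auto
qed

lemma Union_annuli_up: "(\<Union>j. annulus (1 * 2 ^ j)) = {x :: real ^ 'n. 1 \<le> norm x}"
proof (intro set_eqI iffI)
  fix x :: "real ^ 'n" assume "x \<in> (\<Union>j. annulus (1 * 2 ^ j))"
  then obtain j where "2 ^ j \<le> norm x" by (auto simp: annulus_def)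
  moreover have "1 \<le> (2::real) ^ j" by simp
  ultimately show "x \<in> {x. 1 \<le> norm x}" using order_trans by blast
next
  fix x :: "real ^ 'n" assume "x \<in> {x. 1 \<le> norm x}"
  then show "x \<in> (\<Union>j. annulus (1 * 2 ^ j))" using exists_dyadic_up[of "norm x"] by (auto simp: annulus_def)
qed

lemma Union_annuli_down:
  assumes "0 < M" shows "(\<Union>j. annulus (M / 2 * (1/2) ^ j)) = {x :: real ^ 'n. x \<noteq> 0 \<and> norm x < M}"
proof (intro set_eqI iffI)
  fix x :: "real ^ 'n" assume "x \<in> (\<Union>j. annulus (M / 2 * (1/2) ^ j))"
  then obtain j where j: "M / 2 * (1/2) ^ j \<le> norm x" "norm x < M * (1/2) ^ j" by (auto simp: annulus_def)
  have "M * (1/2) ^ j \<le> M * 1" using assms by (intro mult_left_mono power_le_one) auto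
  moreover have "0 < M / 2 * (1/2) ^ j" using assms by simp
  ultimately have "0 < norm x" "norm x < M" using j by linarith+
  then show "x \<in> {x. x \<noteq> 0 \<and> norm x < M}" by simp
next
  fix x :: "real ^ 'n" assume x: "x \<in> {x. x \<noteq> 0 \<and> norm x < M}"
  then have t: "1 < M / norm x" by simp
  define k where "k = (LEAST k. M / norm x \<le> 2 ^ k)"
  obtain N where N: "M / norm x < 2 ^ N" using real_arch_pow[of 2] by auto
  have k: "M / norm x \<le> 2 ^ k" unfolding k_def by (rule LeastI[of _ N]) (use N in simp)
  have "k \<noteq> 0" using k t by (intro notI) simp
  then obtain j where j: "k = Suc j" by (cases k) auto
  have "\<not> M / norm x \<le> 2 ^ j" using not_less_Least[of j "\<lambda>k. M / norm x \<le> 2 ^ k"] j unfolding k_def by simp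
  then have "M / 2 * (1/2) ^ j \<le> norm x" "norm x < M * (1/2) ^ j"
    using k j x by (auto simp: field_simps power_one_over)
  then show "x \<in> (\<Union>j. annulus (M / 2 * (1/2) ^ j))" by (auto simp: annulus_def)
qed

lemma inner_integral:
  assumes \<delta>: "0 < \<delta>" "\<delta> < 1" and M: "0 < M"
  defines "I \<equiv> (\<integral>\<^sup>+x. ennreal (norm x powr (\<delta> - real CARD('n))) * indicator {x. norm x < M} x \<partial>(lborel :: (real ^ 'n) measure))"
  shows "I \<le> ennreal (2 powr (real CARD('n) + 1) * annulus_const TYPE('n) * (M powr \<delta> / \<delta>))"
    "ennreal (2 powr (- real CARD('n) - 1) * annulus_const TYPE('n) * (M powr \<delta> / \<delta>)) \<le> I"
proof -
  let ?n = "real CARD('n)"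
  have n1: "1 \<le> ?n" using zero_less_card_finite[where ?'a='n] by linarith
  have abs: "\<bar>\<delta> - ?n\<bar> = ?n - \<delta>" using \<delta> n1 by linarith
  note om = one_minus_two_powr[OF \<delta>]
  have z: "(1/2) powr \<delta> = 2 powr (-\<delta>)" by (simp add: powr_divide powr_minus_divide)
  have z1: "(1/2) powr \<delta> < (1::real)" unfolding z using om \<delta> by linarith
  have I: "I = (\<integral>\<^sup>+x. ennreal (norm x powr (\<delta> - ?n)) * indicator (\<Union>j. annulus (M / 2 * (1/2) ^ j)) x \<partial>(lborel :: (real ^ 'n) measure))"
    unfolding I_def Union_annuli_down[OF M] by (intro nn_integral_cong) (auto simp: indicator_def)
  have dis: "disjoint_family (\<lambda>j. annulus (M / 2 * (1/2) ^ j) :: (real ^ 'n) set)" using M by (intro annuli_disjoint_down) simp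
  note an = annuli_integral[OF _ _ dis, of \<delta> "\<delta> - ?n", folded I]
  have q: "(M / 2) powr \<delta> = M powr \<delta> * 2 powr (- \<delta>)" using M by (simp add: powr_divide powr_minus_divide)
  have half: "1/2 \<le> 2 powr (-\<delta>)" "2 powr (-\<delta>) \<le> (1::real)"
    using z1[unfolded z] \<delta> powr_mono[of "-1" "-\<delta>" "2::real"] by (simp_all add: powr_minus_divide[of 2 1])
  have "I \<le> ennreal (2 powr (?n - \<delta>) * annulus_const TYPE('n) * ((M / 2) powr \<delta> / (1 - (1/2) powr \<delta>)))"
    using an(2) M z1 abs by simp
  also have "\<dots> \<le> ennreal (2 powr (?n + 1) * annulus_const TYPE('n) * (M powr \<delta> / \<delta>))"
  proof (rule ennreal_leI)
    have "(M / 2) powr \<delta> / (1 - (1/2) powr \<delta>) \<le> M powr \<delta> / (\<delta> / 2)"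
      unfolding q z using half om \<delta> by (intro frac_le) (auto simp: mult_left_le)
    then have "2 powr (?n - \<delta>) * annulus_const TYPE('n) * ((M / 2) powr \<delta> / (1 - (1/2) powr \<delta>)) \<le> 2 powr ?n * annulus_const TYPE('n) * (M powr \<delta> / (\<delta> / 2))"
      using \<delta> annulus_const_pos[where ?'n='n] z1 by (intro mult_mono powr_mono) auto
    also have "\<dots> = 2 powr (?n + 1) * annulus_const TYPE('n) * (M powr \<delta> / \<delta>)" by (simp add: powr_add)
    finally show "2 powr (?n - \<delta>) * annulus_const TYPE('n) * ((M / 2) powr \<delta> / (1 - (1/2) powr \<delta>)) \<le> 2 powr (?n + 1) * annulus_const TYPE('n) * (M powr \<delta> / \<delta>)" .
  qed
  finally show "I \<le> ennreal (2 powr (?n + 1) * annulus_const TYPE('n) * (M powr \<delta> / \<delta>))" .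
  have "ennreal (2 powr (- ?n - 1) * annulus_const TYPE('n) * (M powr \<delta> / \<delta>)) \<le> ennreal (2 powr (- (?n - \<delta>)) * annulus_const TYPE('n) * ((M / 2) powr \<delta> / (1 - (1/2) powr \<delta>)))"
  proof (rule ennreal_leI)
    have "(M powr \<delta> * (1/2)) / \<delta> \<le> (M / 2) powr \<delta> / (1 - (1/2) powr \<delta>)"
      unfolding q z using half om \<delta> by (intro frac_le mult_left_mono) auto
    then have "2 powr (- ?n) * annulus_const TYPE('n) * ((M powr \<delta> * (1/2)) / \<delta>) \<le> 2 powr (- (?n - \<delta>)) * annulus_const TYPE('n) * ((M / 2) powr \<delta> / (1 - (1/2) powr \<delta>))"
      using \<delta> annulus_const_pos[where ?'n='n] z1 by (intro mult_mono powr_mono) auto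
    moreover have "2 powr (- ?n - 1) * annulus_const TYPE('n) * (M powr \<delta> / \<delta>) = 2 powr (- ?n) * annulus_const TYPE('n) * ((M powr \<delta> * (1/2)) / \<delta>)"
      by (simp add: powr_diff)
    ultimately show "2 powr (- ?n - 1) * annulus_const TYPE('n) * (M powr \<delta> / \<delta>) \<le> 2 powr (- (?n - \<delta>)) * annulus_const TYPE('n) * ((M / 2) powr \<delta> / (1 - (1/2) powr \<delta>))"
      by linarith
  qed
  also have "\<dots> \<le> I" using an(1) M z1 abs by simp
  finally show "ennreal (2 powr (- ?n - 1) * annulus_const TYPE('n) * (M powr \<delta> / \<delta>)) \<le> I" .
qed

lemma outer_integral:
  assumes \<epsilon>: "0 < \<epsilon>" "\<epsilon> < 1"
  defines "I \<equiv> (\<integral>\<^sup>+x. ennreal (norm x powr (- real CARD('n) - \<epsilon>)) * indicator {x. 1 \<le> norm x} x \<partial>(lborel :: (real ^ 'n) measure))"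
  shows "I \<le> ennreal (2 powr (real CARD('n) + 2) * annulus_const TYPE('n) * (1 / \<epsilon>))"
    "ennreal (2 powr (- real CARD('n) - 1) * annulus_const TYPE('n) * (1 / \<epsilon>)) \<le> I"
proof -
  let ?n = "real CARD('n)"
  have abs: "\<bar>- ?n - \<epsilon>\<bar> = ?n + \<epsilon>" using \<epsilon> by simp
  note om = one_minus_two_powr[OF \<epsilon>]
  have z1: "2 powr (- \<epsilon>) < (1::real)" using om \<epsilon> by linarith
  note an = annuli_integral[OF _ _ annuli_disjoint_up[OF zero_less_one, where ?'n='n], where \<kappa>="-\<epsilon>" and \<gamma>="- ?n - \<epsilon>", unfolded Union_annuli_up, folded I_def]
  have "I \<le> ennreal (2 powr (?n + \<epsilon>) * annulus_const TYPE('n) * (1 / (1 - 2 powr (- \<epsilon>))))"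
    using an(2) z1 abs by simp
  also have "\<dots> \<le> ennreal (2 powr (?n + 2) * annulus_const TYPE('n) * (1 / \<epsilon>))"
  proof (rule ennreal_leI)
    have "1 / (1 - 2 powr (- \<epsilon>)) \<le> 1 / (\<epsilon> / 2)" using om \<epsilon> by (intro frac_le) auto
    then have "2 powr (?n + \<epsilon>) * annulus_const TYPE('n) * (1 / (1 - 2 powr (- \<epsilon>))) \<le> 2 powr (?n + 1) * annulus_const TYPE('n) * (1 / (\<epsilon> / 2))"
      using \<epsilon> annulus_const_pos[where ?'n='n] z1 by (intro mult_mono powr_mono) auto
    also have "\<dots> = 2 powr (?n + 2) * annulus_const TYPE('n) * (1 / \<epsilon>)" by (simp add: powr_add)
    finally show "2 powr (?n + \<epsilon>) * annulus_const TYPE('n) * (1 / (1 - 2 powr (- \<epsilon>))) \<le> 2 powr (?n + 2) * annulus_const TYPE('n) * (1 / \<epsilon>)" .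
  qed
  finally show "I \<le> ennreal (2 powr (?n + 2) * annulus_const TYPE('n) * (1 / \<epsilon>))" .
  have "ennreal (2 powr (- ?n - 1) * annulus_const TYPE('n) * (1 / \<epsilon>)) \<le> ennreal (2 powr (- (?n + \<epsilon>)) * annulus_const TYPE('n) * (1 / (1 - 2 powr (- \<epsilon>))))"
    using \<epsilon> annulus_const_pos[where ?'n='n] z1 om by (intro ennreal_leI mult_mono powr_mono frac_le) auto
  also have "\<dots> \<le> I" using an(1) z1 abs by simp
  finally show "ennreal (2 powr (- ?n - 1) * annulus_const TYPE('n) * (1 / \<epsilon>)) \<le> I" .
qed

section \<open>Radial weights\<close>

text \<open>The value at the origin only serves to make the weight positive everywhere, where extended and real powers
  agree.\<close>
definition radial_weight :: "real \<Rightarrow> real ^ 'n \<Rightarrow> real" where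
  "radial_weight \<kappa> x = (if x = 0 then 1 else norm x powr \<kappa>)"

lemma radial_weight_pos: "0 < radial_weight \<kappa> x" by (simp add: radial_weight_def)

lemma radial_weight_powr: "radial_weight \<kappa> x powr e = radial_weight (\<kappa> * e) x" by (simp add: radial_weight_def powr_powr)

lemma radial_weight_measurable [measurable]: "radial_weight \<kappa> \<in> borel_measurable borel"
  unfolding radial_weight_def[abs_def] by measurable

lemma radial_weight_AE: "AE x in lborel. radial_weight \<kappa> x = norm (x :: real ^ 'n) powr \<kappa>"
proof -
  have "AE x in lborel. x \<notin> {0 :: real ^ 'n}"
    by (intro AE_not_in) (simp add: null_sets_def)
  then show ?thesis by eventually_elim (simp add: radial_weight_def)
qed

lemma weight_of_local_bound:
  fixes w :: "real ^ 'n \<Rightarrow> real"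
  assumes [measurable]: "w \<in> borel_measurable borel" and w0: "\<And>x. 0 \<le> w x"
    and fin: "\<And>M. 0 < M \<Longrightarrow> (\<integral>\<^sup>+x. ennreal (w x) * indicator {x. norm x < M} x \<partial>lborel) < \<infinity>"
  shows "weight w"
  unfolding weight_def
proof (intro conjI allI impI)
  fix K :: "(real ^ 'n) set" assume "compact K"
  then obtain M0 where M0: "\<And>x. x \<in> K \<Longrightarrow> norm x \<le> M0" using compact_imp_bounded bounded_iff by metis
  define M where "M = \<bar>M0\<bar> + 1"
  have M: "0 < M" "\<And>x. x \<in> K \<Longrightarrow> norm x < M" using M0 by (force simp: M_def)+
  have K [measurable]: "K \<in> sets borel" using \<open>compact K\<close> by (simp add: borel_compact)
  have "integrable lborel (\<lambda>x. indicator K x *\<^sub>R w x)"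
    unfolding integrable_iff_bounded
  proof
    have "(\<integral>\<^sup>+x. ennreal (norm (indicator K x *\<^sub>R w x)) \<partial>lborel) \<le> (\<integral>\<^sup>+x. ennreal (w x) * indicator {x. norm x < M} x \<partial>lborel)"
      using w0 M by (intro nn_integral_mono) (auto simp: indicator_def)
    also have "\<dots> < \<infinity>" by (rule fin[OF M(1)])
    finally show "(\<integral>\<^sup>+x. ennreal (norm (indicator K x *\<^sub>R w x)) \<partial>lborel) < \<infinity>" .
  qed measurable
  then show "w absolutely_integrable_on K"
    unfolding set_integrable_def by (subst integrable_completion) auto
qed (rule w0)

text \<open>The local characteristic of any cube is at least \<open>1\<close>.\<close>
lemma one_le_Apq_const:
  fixes w :: "real ^ 'n \<Rightarrow> real"
  assumes "w \<in> borel_measurable borel" "\<And>x. 0 < w x" "Apq_const p q w < \<infinity>" "1 < p" "1 < q" "1 / q + 1 / conj_exponent p < 1"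
  shows "1 \<le> enn2real (Apq_const p q w)"
proof -
  interpret cube_weight w q "conj_exponent p" "enn2real (Apq_const p q w) powr (1 / q)"
    using assms by (rule cube_weight_Apq)
  interpret g: dyadic_weights "atoms 0" "generation 0" "2 * 0" "(1/2) ^ CARD('n)" "(2 ^ 0) ^ CARD('n)"
    "cell_mass (\<lambda>_. 1) 0 0" "cell_mass ws 0 0" "cell_mass wu 0 0" q "conj_exponent p" "enn2real (Apq_const p q w) powr (1 / q)" by (rule grid_tree)
  have "(0 :: int ^ 'n) \<in> atoms 0" by (simp add: atoms_def)
  then obtain Q where "Q \<in> g.\<Q>" unfolding g.\<Q>_def generation_def by blast
  then have "1 \<le> enn2real (Apq_const p q w) powr (1 / q)" using g.char_ratio_bounds by force
  then have "1 powr q \<le> (enn2real (Apq_const p q w) powr (1 / q)) powr q" using assms by (intro powr_mono2) auto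
  then show ?thesis using assms by (simp add: powr_powr)
qed

definition power_weight_const :: "'n::finite itself \<Rightarrow> real" where
  "power_weight_const _ = 2 powr (real CARD('n) + 1) * annulus_const TYPE('n) * (4 * real CARD('n)) powr real CARD('n) + 4 powr real CARD('n)"

lemma power_weight_const_pos: "0 < power_weight_const TYPE('n::finite)"
  unfolding power_weight_const_def using annulus_const_pos[where ?'n='n] by (intro add_nonneg_pos) auto

lemma norm_cube_le:
  fixes x :: "real ^ 'n"
  assumes "x \<in> cbox a (a + h *\<^sub>R One)" shows "norm (x - a) \<le> real CARD('n) * h"
proof -
  have "norm (x - a) \<le> (\<Sum>i\<in>UNIV. \<bar>(x - a) $ i\<bar>)" by (rule norm_le_l1_cart)
  also have "\<dots> \<le> (\<Sum>i\<in>(UNIV :: 'n set). h)"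
  proof (rule sum_mono)
    fix i
    have "a $ i \<le> x $ i" "x $ i \<le> a $ i + h" using assms by (auto simp: mem_box_cart)
    then show "\<bar>(x - a) $ i\<bar> \<le> h" by simp
  qed
  finally show ?thesis by simp
qed

text \<open>A cube whose distance from the origin is large compared to its size sees two almost constant functions that are powers of
  each other.  Any other cube lies in a ball of comparable volume around the origin, where the singular power
  has integral of order \<open>1/\<delta>\<close> and the other one is bounded by its value on the boundary.\<close>
lemma power_weight_cube:
  fixes a :: "real ^ 'n"
  assumes \<delta>: "0 < \<delta>" "\<delta> < 1" and s: "0 < s" and h: "0 < h"
  shows "(cube_integral (\<lambda>x. ennreal (radial_weight (\<delta> - real CARD('n)) x)) a h / ennreal (h ^ CARD('n))) *
    (cube_integral (\<lambda>x. ennreal (radial_weight ((real CARD('n) - \<delta>) * s) x)) a h / ennreal (h ^ CARD('n))) epowr (1 / s)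
    \<le> ennreal (power_weight_const TYPE('n) / \<delta>)"
proof -
  let ?n = "real CARD('n)"
  have n1: "1 \<le> ?n" using zero_less_card_finite[where ?'a='n] by linarith
  have n\<delta>: "\<delta> \<le> ?n" using n1 \<delta> by linarith
  \<comment> \<open>The diameter of the cube is at most \<open>D\<close>.\<close>
  define D where "D = ?n * h"
  have D: "0 < D" using n1 h by (simp add: D_def)
  let ?Q = "cbox a (a + h *\<^sub>R One)"
  have hn: "0 < h ^ CARD('n)" using h by simp
  have Qm: "emeasure lborel ?Q = ennreal (h ^ CARD('n))"
    using h by (subst emeasure_lborel_cbox) (auto simp: inner_simps)
  have avg_le: "cube_integral g a h / ennreal (h ^ CARD('n)) \<le> ennreal c"
    if "\<And>x. x \<in> ?Q \<Longrightarrow> x \<noteq> 0 \<Longrightarrow> g x \<le> ennreal c" "0 \<le> c" for g c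
  proof -
    have "AE x in lborel. x \<notin> {0 :: real ^ 'n}" by (intro AE_not_in) (simp add: null_sets_def)
    then have "cube_integral g a h \<le> (\<integral>\<^sup>+x. ennreal c * indicator ?Q x \<partial>lborel)"
      unfolding cube_integral_def using that(1)
      by (intro nn_integral_mono_AE) (auto simp: indicator_def elim: eventually_mono)
    also have "\<dots> = ennreal (c * h ^ CARD('n))" using that(2) h by (simp add: nn_integral_cmult_indicator Qm ennreal_mult)
    finally have "cube_integral g a h / ennreal (h ^ CARD('n)) \<le> ennreal (c * h ^ CARD('n)) / ennreal (h ^ CARD('n))"
      by (rule divide_right_mono_ennreal)
    also have "\<dots> = ennreal c" using hn h that(2) by (simp add: divide_ennreal)
    finally show ?thesis .
  qed
  have second: "(cube_integral (\<lambda>x. ennreal (radial_weight ((?n - \<delta>) * s) x)) a h / ennreal (h ^ CARD('n))) epowr (1 / s) \<le> ennreal (M powr (?n - \<delta>))"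
    if M: "\<And>x. x \<in> ?Q \<Longrightarrow> norm x \<le> M" "0 < M" for M
  proof -
    have "cube_integral (\<lambda>x. ennreal (radial_weight ((?n - \<delta>) * s) x)) a h / ennreal (h ^ CARD('n)) \<le> ennreal (M powr ((?n - \<delta>) * s))"
    proof (rule avg_le)
      fix x assume "x \<in> ?Q" "x \<noteq> 0"
      then show "ennreal (radial_weight ((?n - \<delta>) * s) x) \<le> ennreal (M powr ((?n - \<delta>) * s))"
        using M(1)[of x] n\<delta> s by (auto simp: radial_weight_def intro!: ennreal_leI powr_mono2 mult_nonneg_nonneg)
    qed simp
    then have "(cube_integral (\<lambda>x. ennreal (radial_weight ((?n - \<delta>) * s) x)) a h / ennreal (h ^ CARD('n))) epowr (1 / s) \<le> ennreal (M powr ((?n - \<delta>) * s)) epowr (1 / s)"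
      using s by (intro epowr_mono) auto
    also have "\<dots> = ennreal (M powr (?n - \<delta>))" using s by (simp add: epowr_ennreal powr_powr)
    finally show ?thesis .
  qed
  show ?thesis
  proof (cases "norm a \<le> 2 * D")
    case True
    have M: "norm x < 4 * D" if "x \<in> ?Q" for x
      using norm_cube_le[OF that] norm_triangle_ineq[of "x - a" a] True D unfolding D_def by simp
    have "cube_integral (\<lambda>x. ennreal (radial_weight (\<delta> - ?n) x)) a h = cube_integral (\<lambda>x. ennreal (norm x powr (\<delta> - ?n))) a h"
      by (intro cint_cong_AE) (use radial_weight_AE[of "\<delta> - ?n"] in \<open>auto elim: eventually_mono\<close>)
    also have "\<dots> \<le> (\<integral>\<^sup>+x. ennreal (norm x powr (\<delta> - ?n)) * indicator {x. norm x < 4 * D} x \<partial>(lborel :: (real ^ 'n) measure))"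
      unfolding cube_integral_def using M by (intro nn_integral_mono) (auto simp: indicator_def)
    also have "\<dots> \<le> ennreal (2 powr (?n + 1) * annulus_const TYPE('n) * ((4 * D) powr \<delta> / \<delta>))"
      using \<delta> D by (intro inner_integral) auto
    finally have "cube_integral (\<lambda>x. ennreal (radial_weight (\<delta> - ?n) x)) a h / ennreal (h ^ CARD('n)) \<le> ennreal (2 powr (?n + 1) * annulus_const TYPE('n) * ((4 * D) powr \<delta> / \<delta>)) / ennreal (h ^ CARD('n))"
      by (rule divide_right_mono_ennreal)
    also have "\<dots> = ennreal (2 powr (?n + 1) * annulus_const TYPE('n) * ((4 * D) powr \<delta> / \<delta>) / h ^ CARD('n))"
      using hn \<delta> annulus_const_pos[where ?'n='n] by (intro divide_ennreal) auto
    finally have "(cube_integral (\<lambda>x. ennreal (radial_weight (\<delta> - ?n) x)) a h / ennreal (h ^ CARD('n))) *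
      (cube_integral (\<lambda>x. ennreal (radial_weight ((?n - \<delta>) * s) x)) a h / ennreal (h ^ CARD('n))) epowr (1 / s)
      \<le> ennreal (2 powr (?n + 1) * annulus_const TYPE('n) * ((4 * D) powr \<delta> / \<delta>) / h ^ CARD('n)) * ennreal ((4 * D) powr (?n - \<delta>))"
      using M D by (intro mult_mono second) (auto intro: less_imp_le)
    also have "\<dots> = ennreal (2 powr (?n + 1) * annulus_const TYPE('n) * (((4 * D) powr \<delta> * (4 * D) powr (?n - \<delta>)) / h ^ CARD('n)) / \<delta>)"
      using hn \<delta> annulus_const_pos[where ?'n='n] by (subst ennreal_mult[symmetric]) (auto simp: mult_ac)
    also have "(4 * D) powr \<delta> * (4 * D) powr (?n - \<delta>) = (4 * ?n) powr ?n * h ^ CARD('n)"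
    proof -
      have "(4 * D) powr \<delta> * (4 * D) powr (?n - \<delta>) = ((4 * ?n) * h) powr ?n"
        unfolding powr_add[symmetric] by (simp add: D_def mult.assoc)
      also have "\<dots> = (4 * ?n) powr ?n * h powr ?n" by (rule powr_mult)
      finally show ?thesis using h by (simp add: powr_realpow)
    qed
    also have "2 powr (?n + 1) * annulus_const TYPE('n) * (((4 * ?n) powr ?n * h ^ CARD('n)) / h ^ CARD('n)) / \<delta> \<le> power_weight_const TYPE('n) / \<delta>"
      using h \<delta> unfolding power_weight_const_def by (intro divide_right_mono) auto
    finally show ?thesis by (simp add: ennreal_leI)
  next
    case False
    have M: "norm x \<le> 2 * norm a" "norm a / 2 \<le> norm x" if "x \<in> ?Q" for x
      using norm_cube_le[OF that] norm_triangle_ineq[of "x - a" a] norm_triangle_ineq2[of a x] False D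
      unfolding D_def by (simp_all add: norm_minus_commute)
    have a0: "0 < norm a" using False D by linarith
    have first: "cube_integral (\<lambda>x. ennreal (radial_weight (\<delta> - ?n) x)) a h / ennreal (h ^ CARD('n)) \<le> ennreal ((norm a / 2) powr (\<delta> - ?n))"
    proof (rule avg_le)
      fix x assume "x \<in> ?Q" "x \<noteq> 0"
      then show "ennreal (radial_weight (\<delta> - ?n) x) \<le> ennreal ((norm a / 2) powr (\<delta> - ?n))"
        using M(2)[of x] a0 n\<delta> by (auto simp: radial_weight_def intro!: ennreal_leI powr_mono2')
    qed simp
    have "(cube_integral (\<lambda>x. ennreal (radial_weight (\<delta> - ?n) x)) a h / ennreal (h ^ CARD('n))) *
      (cube_integral (\<lambda>x. ennreal (radial_weight ((?n - \<delta>) * s) x)) a h / ennreal (h ^ CARD('n))) epowr (1 / s)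
      \<le> ennreal ((norm a / 2) powr (\<delta> - ?n)) * ennreal ((2 * norm a) powr (?n - \<delta>))"
      using M(1) a0 by (intro mult_mono second first) auto
    also have "\<dots> = ennreal (4 powr (?n - \<delta>))"
    proof -
      have "(norm a / 2) powr (\<delta> - ?n) * (2 * norm a) powr (?n - \<delta>) = ((2 * norm a) / (norm a / 2)) powr (?n - \<delta>)"
      proof -
        have "(norm a / 2) powr (\<delta> - ?n) = 1 / (norm a / 2) powr (?n - \<delta>)"
          using powr_minus_divide[of "norm a / 2" "?n - \<delta>"] by (simp only: minus_diff_eq)
        then have "(norm a / 2) powr (\<delta> - ?n) * (2 * norm a) powr (?n - \<delta>) = (2 * norm a) powr (?n - \<delta>) / (norm a / 2) powr (?n - \<delta>)"
          by (simp only: times_divide_eq_left mult_1_left)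
        then show ?thesis using a0 by (simp only: powr_divide)
      qed
      also have "(2 * norm a) / (norm a / 2) = 4" using a0 by simp
      finally show ?thesis by (simp add: ennreal_mult[symmetric])
    qed
    also have "\<dots> \<le> ennreal (power_weight_const TYPE('n) / \<delta>)"
    proof (rule ennreal_leI)
      have "4 powr (?n - \<delta>) \<le> 4 powr ?n * (1::real)" using \<delta> by simp
      also have "\<dots> \<le> power_weight_const TYPE('n) * (1 / \<delta>)" using \<delta> annulus_const_pos[where ?'n='n]
        by (intro mult_mono) (auto simp: power_weight_const_def)
      finally show "4 powr (?n - \<delta>) \<le> power_weight_const TYPE('n) / \<delta>" by simp
    qed
    finally show ?thesis .
  qed
qed

text \<open>An admissible bound makes the potential of \<open>f\<close> absolutely convergent almost everywhere, so that it
  coincides there with the integral in \<open>[0, \<infinity>]\<close> and is at least \<open>\<phi>\<close>.\<close>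
lemma riesz_norm_ge:
  fixes w :: "real ^ 'n \<Rightarrow> real" and f :: "real ^ 'n \<Rightarrow> real"
  assumes [measurable]: "w \<in> borel_measurable borel" "f \<in> borel_measurable borel" and w0: "\<And>x. 0 < w x" and f0: "\<And>x. 0 \<le> f x"
    and pq: "0 < p" "0 < q"
    and nf: "(\<integral>\<^sup>+x. ennreal (f x powr p * w x powr p) \<partial>lborel) \<le> ennreal (F powr p)" "0 < F"
    and E [measurable]: "E \<in> sets borel" and \<phi> [measurable]: "\<phi> \<in> borel_measurable borel" "\<And>x. 0 \<le> \<phi> x"
    and low: "\<And>x. x \<in> E \<Longrightarrow> ennreal (\<phi> x) \<le> (\<integral>\<^sup>+y. ennreal (f y * norm (x - y) powr (- (real CARD('n) - \<alpha>))) \<partial>lborel)"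
    and L: "ennreal (L powr q) \<le> (\<integral>\<^sup>+x. ennreal (\<phi> x powr q * w x powr q) * indicator E x \<partial>lborel)" "0 \<le> L"
  shows "ennreal (L / F) \<le> riesz_norm \<alpha> p (weighted_measure (\<lambda>x. w x powr p)) q (weighted_measure (\<lambda>x. w x powr q))"
  unfolding riesz_norm_def
proof (rule Inf_greatest, clarify)
  let ?\<mu> = "weighted_measure (\<lambda>x. w x powr p)" and ?\<nu> = "weighted_measure (\<lambda>x. w x powr q)"
  fix C assume C: "\<forall>f\<in>Lp_space p ?\<mu>. (AE x in ?\<nu>. integrable lebesgue (riesz_integrand \<alpha> f x)) \<and>
           Lp_norm q ?\<nu> (riesz_potential \<alpha> f) \<le> C * Lp_norm p ?\<mu> f"
  have m: "w \<in> borel_measurable lebesgue" "f \<in> borel_measurable lebesgue" by (auto intro: measurable_completion)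
  have "Lp_norm p ?\<mu> f = (\<integral>\<^sup>+x. ennreal (f x powr p * w x powr p) \<partial>lborel) epowr (1 / p)"
    using Lp_norm_weighted[OF m(2,1) pq(1)] f0 by (simp add: nn_integral_completion)
  also have "\<dots> \<le> ennreal (F powr p) epowr (1 / p)" using nf pq by (intro epowr_mono) auto
  also have "\<dots> = ennreal F" using nf(2) pq by (simp add: epowr_ennreal powr_powr)
  finally have nF: "Lp_norm p ?\<mu> f \<le> ennreal F" .
  have "f \<in> Lp_space p ?\<mu>"
    using m(2) le_less_trans[OF nF ennreal_less_top] by (simp add: Lp_space_def weighted_measure_def)
  with C have ae: "AE x in ?\<nu>. integrable lebesgue (riesz_integrand \<alpha> f x)" and le: "Lp_norm q ?\<nu> (riesz_potential \<alpha> f) \<le> C * Lp_norm p ?\<mu> f"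
    by auto
  have pot: "ennreal (\<phi> x) \<le> ennreal \<bar>riesz_potential \<alpha> f x\<bar>" if "x \<in> E" "integrable lebesgue (riesz_integrand \<alpha> f x)" for x
  proof -
    have nn: "0 \<le> riesz_integrand \<alpha> f x y" for y using f0 by (simp add: riesz_integrand_def)
    have "(\<integral>\<^sup>+y. ennreal (f y * norm (x - y) powr (- (real CARD('n) - \<alpha>))) \<partial>lborel) = (\<integral>\<^sup>+y. ennreal (norm (riesz_integrand \<alpha> f x y)) \<partial>lebesgue)"
      unfolding riesz_integrand_abs nn_integral_completion using f0 by simp
    also have "\<dots> = ennreal (riesz_potential \<alpha> f x)"
      unfolding riesz_potential_def using nn_integral_eq_integral[OF that(2)] nn by simp
    also have "\<dots> \<le> ennreal \<bar>riesz_potential \<alpha> f x\<bar>" by (intro ennreal_leI) simp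
    finally show ?thesis by (rule order_trans[OF low[OF that(1)]])
  qed
  have "ennreal L = ennreal (L powr q) epowr (1 / q)" using L(2) pq by (simp add: epowr_ennreal powr_powr)
  also have "\<dots> \<le> (\<integral>\<^sup>+x. ennreal (\<phi> x powr q * w x powr q) * indicator E x \<partial>lborel) epowr (1 / q)"
    using L pq by (intro epowr_mono) auto
  also have "(\<integral>\<^sup>+x. ennreal (\<phi> x powr q * w x powr q) * indicator E x \<partial>lborel)
     = (\<integral>\<^sup>+x. ennreal (w x powr q) * (ennreal (\<phi> x) epowr q * indicator E x) \<partial>lebesgue)"
    unfolding nn_integral_completion using \<phi>(2) pq
    by (intro nn_integral_cong) (simp add: epowr_ennreal ennreal_mult mult_ac)
  also have "\<dots> = (\<integral>\<^sup>+x. ennreal (\<phi> x) epowr q * indicator E x \<partial>?\<nu>)"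
  proof -
    have "(\<lambda>x. ennreal (\<phi> x) epowr q * indicator E x) \<in> borel_measurable lborel" by measurable
    then have "(\<lambda>x. ennreal (\<phi> x) epowr q * indicator E x) \<in> borel_measurable lebesgue" by (rule measurable_completion)
    then show ?thesis unfolding weighted_measure_def using m by (subst nn_integral_density) auto
  qed
  also have "\<dots> epowr (1 / q) \<le> Lp_norm q ?\<nu> (riesz_potential \<alpha> f)"
    unfolding Lp_norm_def
  proof (intro epowr_mono nn_integral_mono_AE)
    show "AE x in ?\<nu>. ennreal (\<phi> x) epowr q * indicator E x \<le> ennreal \<bar>riesz_potential \<alpha> f x\<bar> epowr q"
      using ae by eventually_elim (use pq in \<open>auto simp: indicator_def intro!: epowr_mono pot\<close>)
  qed (use pq in auto)
  also note le
  also have "C * Lp_norm p ?\<mu> f \<le> C * ennreal F" using nF by (intro mult_left_mono) auto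
  finally have "ennreal L / ennreal F \<le> C * ennreal F / ennreal F" by (rule divide_right_mono_ennreal)
  also have "C * ennreal F / ennreal F = C" using nf(2)
    by (cases C) (auto simp: ennreal_mult[symmetric] divide_ennreal ennreal_top_mult ennreal_top_divide)
  finally show "ennreal (L / F) \<le> C" using nf(2) L(2) by (simp add: divide_ennreal)
qed

section \<open>Failure of smaller powers\<close>

lemma epowr_mult: "0 < r \<Longrightarrow> (x * y) epowr r = x epowr r * y epowr r"
  using epowr_ennreal[of 0 r]
  by (cases x; cases y) (auto simp: epowr_ennreal epowr_top ennreal_mult[symmetric] powr_mult ennreal_top_mult ennreal_mult_top)

lemma epowr_pos: "0 < a \<Longrightarrow> ennreal a epowr e = ennreal (a powr e)"
  by (simp add: epowr_def ennreal_eq_0_iff)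

text \<open>For \<open>\<beta> \<ge> 0\<close> compare powers of \<open>\<delta>\<close> as \<open>\<delta> \<rightarrow> 0\<close>.  A negative \<open>\<beta>\<close> may be replaced by
  \<open>0\<close>, since the constant of the weight is at least \<open>1\<close>.\<close>
lemma no_smaller_power:
  fixes N P :: "'w \<Rightarrow> ennreal"
  assumes fam: "\<And>\<delta>. 0 < \<delta> \<Longrightarrow> \<delta> \<le> dmax \<Longrightarrow>
      \<exists>w\<in>S. ennreal (a * \<delta> powr (- r)) \<le> N w \<and> (\<exists>W\<ge>1. P w = ennreal W \<and> W \<le> (C / \<delta>) powr t)"
    and pos: "0 < dmax" "0 < a" "0 < C" "0 < t" "0 < r" and \<beta>: "\<beta> * t < r"
  shows "\<not> (\<exists>c::real. \<forall>w\<in>S. N w \<le> ennreal c * P w epowr \<beta>)"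
proof
  assume "\<exists>c::real. \<forall>w\<in>S. N w \<le> ennreal c * P w epowr \<beta>"
  then obtain c :: real where c: "\<And>w. w \<in> S \<Longrightarrow> N w \<le> ennreal c * P w epowr \<beta>" by blast
  define b where "b = max \<beta> 0"
  define \<eta> where "\<eta> = r - b * t"
  have \<eta>: "0 < \<eta>" using \<beta> pos by (auto simp: \<eta>_def b_def max_def)
  have b: "0 \<le> b" "\<beta> \<le> b" by (auto simp: b_def)
  define c' where "c' = \<bar>c\<bar> * C powr (t * b)"
  have c': "0 \<le> c'" by (simp add: c'_def)
  have key: "a \<le> c' * \<delta> powr \<eta>" if \<delta>: "0 < \<delta>" "\<delta> \<le> dmax" for \<delta>
  proof -
    obtain w W where w: "w \<in> S" "ennreal (a * \<delta> powr (- r)) \<le> N w" "1 \<le> W" "P w = ennreal W" "W \<le> (C / \<delta>) powr t"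
      using fam[OF \<delta>] by blast
    have "ennreal (a * \<delta> powr (- r)) \<le> ennreal c * ennreal (W powr \<beta>)"
      using w(2) c[OF w(1)] w(3,4) by (simp add: epowr_pos)
    also have "\<dots> \<le> ennreal \<bar>c\<bar> * ennreal (W powr \<beta>)" by (intro mult_right_mono ennreal_leI) auto
    also have "\<dots> = ennreal (\<bar>c\<bar> * W powr \<beta>)" by (simp add: ennreal_mult)
    finally have "a * \<delta> powr (- r) \<le> \<bar>c\<bar> * W powr \<beta>" by (subst (asm) ennreal_le_iff) auto
    also have "\<dots> \<le> \<bar>c\<bar> * ((C / \<delta>) powr t) powr b"
    proof (rule mult_left_mono)
      have "W powr \<beta> \<le> W powr b" using w(3) b by (intro powr_mono) auto
      also have "\<dots> \<le> ((C / \<delta>) powr t) powr b" using w b by (intro powr_mono2) auto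
      finally show "W powr \<beta> \<le> ((C / \<delta>) powr t) powr b" .
    qed simp
    also have "\<dots> = c' * \<delta> powr (- (b * t))"
      using pos \<delta> by (simp add: c'_def powr_powr powr_divide powr_minus_divide mult.commute)
    finally have "(a * \<delta> powr (- r)) * \<delta> powr r \<le> (c' * \<delta> powr (- (b * t))) * \<delta> powr r" by (rule mult_right_mono) simp
    moreover have "(a * \<delta> powr (- r)) * \<delta> powr r = a" using \<delta> by (simp add: mult.assoc flip: powr_add)
    moreover have "(c' * \<delta> powr (- (b * t))) * \<delta> powr r = c' * \<delta> powr \<eta>" by (simp add: mult.assoc \<eta>_def flip: powr_add)
    ultimately show ?thesis by simp
  qed
  \<comment> \<open>Small enough to contradict \<open>key\<close> when the power \<open>\<eta>\<close> of \<open>\<delta>\<close> is at most \<open>e\<close>; the \<open>1\<close> covers the case \<open>c' = 0\<close>.\<close>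
  define e where "e = a / (2 * (c' + 1))"
  have e: "0 < e" using pos c' by (simp add: e_def)
  define \<delta> where "\<delta> = min dmax (e powr (1 / \<eta>))"
  have \<delta>: "0 < \<delta>" "\<delta> \<le> dmax" using pos e by (auto simp: \<delta>_def)
  have "\<delta> powr \<eta> \<le> (e powr (1 / \<eta>)) powr \<eta>" using \<delta> \<eta> by (intro powr_mono2) (auto simp: \<delta>_def)
  also have "\<dots> = e" using \<eta> e by (simp add: powr_powr)
  finally have "a \<le> c' * e" using key[OF \<delta>] c' by (meson mult_left_mono order_trans)
  also have "\<dots> \<le> (c' + 1) * e" using e by (intro mult_right_mono) auto
  also have "\<dots> = a / 2" using c' by (simp add: e_def field_simps)
  finally show False using pos by simp
qed

lemma Apq_const_radial_le:
  fixes B :: ennreal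
  assumes "\<And>(a :: real ^ 'n) h. 0 < h \<Longrightarrow>
     (cube_integral (\<lambda>x. ennreal (radial_weight (\<kappa> * q) x)) a h / ennreal (h ^ CARD('n))) *
     (cube_integral (\<lambda>x. ennreal (radial_weight (- \<kappa> * conj_exponent p) x)) a h / ennreal (h ^ CARD('n))) epowr (q / conj_exponent p) \<le> B"
  shows "Apq_const p q (radial_weight \<kappa> :: real ^ 'n \<Rightarrow> real) \<le> B"
  unfolding Apq_const_def
proof (rule SUP_least)
  fix Q :: "(real ^ 'n) set" assume "Q \<in> cubes"
  then obtain a h where Q: "Q = cbox a (a + h *\<^sub>R One)" "0 < h" by (auto simp: cubes_def)
  show "average Q (\<lambda>x. ennreal (radial_weight \<kappa> x) epowr q) * average Q (\<lambda>x. ennreal (radial_weight \<kappa> x) epowr - conj_exponent p) epowr (q / conj_exponent p) \<le> B"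
    using assms[OF Q(2), of a] unfolding Q(1) average_cube[OF Q(2)] epowr_pos[OF radial_weight_pos] radial_weight_powr by simp
qed

text \<open>On a bounded set the power with exponent \<open>\<delta> - n\<close>, which is integrable there, dominates a multiple of every larger power.\<close>
lemma weight_radial:
  assumes \<delta>: "0 < \<delta>" "\<delta> < 1" and \<kappa>: "\<delta> - real CARD('n) \<le> \<kappa>"
  shows "weight (radial_weight \<kappa> :: real ^ 'n \<Rightarrow> real)"
proof (rule weight_of_local_bound)
  fix M :: real assume M: "0 < M"
  let ?\<tau> = "\<kappa> - (\<delta> - real CARD('n))"
  have "(\<integral>\<^sup>+x. ennreal (radial_weight \<kappa> x) * indicator {x. norm x < M} x \<partial>(lborel :: (real ^ 'n) measure))
    \<le> (\<integral>\<^sup>+x. ennreal (M powr ?\<tau>) * (ennreal (norm x powr (\<delta> - real CARD('n))) * indicator {x. norm x < M} x) \<partial>(lborel :: (real ^ 'n) measure))"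
  proof (rule nn_integral_mono_AE)
    show "AE x in lborel. ennreal (radial_weight \<kappa> x) * indicator {x. norm x < M} x
      \<le> ennreal (M powr ?\<tau>) * (ennreal (norm (x :: real ^ 'n) powr (\<delta> - real CARD('n))) * indicator {x. norm x < M} x)"
      using radial_weight_AE[of \<kappa>]
    proof eventually_elim
      case (elim x)
      have "norm x powr \<kappa> = norm x powr ?\<tau> * norm x powr (\<delta> - real CARD('n))" by (simp flip: powr_add)
      also have "\<dots> \<le> M powr ?\<tau> * norm x powr (\<delta> - real CARD('n))" if "norm x < M"
        using that \<kappa> by (intro mult_right_mono powr_mono2) auto
      finally show ?case unfolding elim by (auto simp: indicator_def ennreal_mult[symmetric] intro!: ennreal_leI)
    qed
  qed
  also have "\<dots> = ennreal (M powr ?\<tau>) * (\<integral>\<^sup>+x. ennreal (norm x powr (\<delta> - real CARD('n))) * indicator {x. norm x < M} x \<partial>(lborel :: (real ^ 'n) measure))"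
    by (rule nn_integral_cmult) measurable
  also have "\<dots> < \<infinity>"
    using le_less_trans[OF inner_integral(1)[OF \<delta> M, where ?'n='n] ennreal_less_top] by (simp add: ennreal_mult_less_top)
  finally show "(\<integral>\<^sup>+x. ennreal (radial_weight \<kappa> x) * indicator {x. norm x < M} x \<partial>(lborel :: (real ^ 'n) measure)) < \<infinity>" .
qed (auto intro: less_imp_le radial_weight_pos)

lemma quotient_powers:
  fixes \<delta> :: real
  assumes "0 < \<delta>" "0 < X" "0 < Y" "0 < Z"
  shows "(X / \<delta>) * (Y / \<delta>) powr (1 / q) / (Z / \<delta>) powr (1 / p) = X * Y powr (1 / q) / Z powr (1 / p) * \<delta> powr (- (1 + 1 / q - 1 / p))"
proof -
  have "ln ((X / \<delta>) * (Y / \<delta>) powr (1 / q) / (Z / \<delta>) powr (1 / p)) = ln (X * Y powr (1 / q) / Z powr (1 / p) * \<delta> powr (- (1 + 1 / q - 1 / p)))"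
    using assms by (simp add: ln_mult ln_div ln_powr) (simp add: algebra_simps diff_divide_distrib)
  then show ?thesis using assms by (subst (asm) ln_inj_iff) auto
qed

text \<open>Here \<open>\<sigma> = |x|\<^bsup>\<delta>-n\<^esup>\<close>, and \<open>f\<close> is \<open>\<sigma>\<close> restricted to the unit ball.  Its mass is of order \<open>1/\<delta>\<close>, so the potential is at
  least a multiple of \<open>\<delta>\<^bsup>-1\<^esup> |x|\<^bsup>\<alpha>-n\<^esup>\<close> outside the ball, where \<open>|x|\<^bsup>(\<alpha>-n)q\<^esup> w\<^sup>q\<close> equals \<open>|x|\<^bsup>-n-\<epsilon>\<^esup>\<close> with \<open>\<epsilon> = \<delta> q/p'\<close> and has
  integral of order \<open>1/\<delta>\<close>.  The norm of \<open>f\<close> is of order \<open>\<delta>\<^bsup>-1/p\<^esup>\<close>, and the quotient is of order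
  \<open>\<delta>\<close> to the power \<open>-(1 + 1/q - 1/p) = -r\<close>.\<close>
lemma growing_family:
  fixes \<alpha> p q :: real
  assumes \<alpha>: "0 < \<alpha>" "\<alpha> < real CARD('n)" and p: "1 < p" "p < real CARD('n) / \<alpha>"
    and q: "1 / q = 1 / p - \<alpha> / real CARD('n)"
    and \<delta>: "0 < \<delta>" "\<delta> < 1" "\<delta> * (q / conj_exponent p) < 1"
  defines "w \<equiv> radial_weight ((real CARD('n) - \<delta>) / conj_exponent p) :: real ^ 'n \<Rightarrow> real"
    and "c \<equiv> 2 powr (- real CARD('n) - 1) * annulus_const TYPE('n)"
  shows "weight w" "Apq_const p q w \<le> ennreal ((power_weight_const TYPE('n) / \<delta>) powr (q / conj_exponent p))"
    "ennreal (2 powr (- (real CARD('n) - \<alpha>)) * c * (c * (conj_exponent p / q)) powr (1 / q) / (2 powr (real CARD('n) + 1) * annulus_const TYPE('n)) powr (1 / p) * \<delta> powr (- (1 + 1 / q - 1 / p)))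
     \<le> riesz_norm \<alpha> p (weighted_measure (\<lambda>x. w x powr p)) q (weighted_measure (\<lambda>x. w x powr q))"
proof -
  let ?n = "real CARD('n)" and ?p' = "conj_exponent p"
  note ex = exponent_facts[OF \<alpha> p q]
  have n1: "\<delta> \<le> ?n" using zero_less_card_finite[where ?'a='n] \<delta> by linarith
  have p'0: "0 < ?p'" and q0: "0 < q" and p0: "0 < p" using ex p by auto
  have c0: "0 < c" unfolding c_def using annulus_const_pos[where ?'n='n] by simp
  let ?\<kappa> = "(?n - \<delta>) / ?p'"
  have "0 \<le> ?\<kappa>" using n1 p'0 by simp
  then have "\<delta> - ?n \<le> ?\<kappa>" using n1 by linarith
  then show "weight w" unfolding w_def using \<delta> by (intro weight_radial[of \<delta>])
  show "Apq_const p q w \<le> ennreal ((power_weight_const TYPE('n) / \<delta>) powr (q / ?p'))" unfolding w_def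
  proof (rule Apq_const_radial_le)
    fix a :: "real ^ 'n" and h :: real assume h: "0 < h"
    define X Y where "X = cube_integral (\<lambda>x. ennreal (radial_weight (\<delta> - ?n) x)) a h / ennreal (h ^ CARD('n))"
      "Y = cube_integral (\<lambda>x. ennreal (radial_weight ((?n - \<delta>) * (q / ?p')) x)) a h / ennreal (h ^ CARD('n))"
    have s: "0 < q / ?p'" using q0 p'0 by simp
    have "X * Y epowr (1 / (q / ?p')) \<le> ennreal (power_weight_const TYPE('n) / \<delta>)"
      unfolding X_Y_def by (rule power_weight_cube[OF \<delta>(1,2) s h])
    then have "(X * Y epowr (1 / (q / ?p'))) epowr (q / ?p') \<le> ennreal (power_weight_const TYPE('n) / \<delta>) epowr (q / ?p')"
      using s by (rule epowr_mono)
    also have "\<dots> = ennreal ((power_weight_const TYPE('n) / \<delta>) powr (q / ?p'))"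
      using \<delta> power_weight_const_pos[where ?'n='n] by (intro epowr_pos) simp
    also have "(X * Y epowr (1 / (q / ?p'))) epowr (q / ?p') = Y * X epowr (q / ?p')"
      unfolding epowr_mult[OF s] epowr_inverse(2)[OF s] by (rule mult.commute)
    finally show "cube_integral (\<lambda>x. ennreal (radial_weight (?\<kappa> * q) x)) a h / ennreal (h ^ CARD('n)) *
        (cube_integral (\<lambda>x. ennreal (radial_weight (- ?\<kappa> * ?p') x)) a h / ennreal (h ^ CARD('n))) epowr (q / ?p') \<le> ennreal ((power_weight_const TYPE('n) / \<delta>) powr (q / ?p'))"
      using p'0 unfolding X_Y_def by simp
  qed
  define f :: "real ^ 'n \<Rightarrow> real" where "f x = norm x powr (\<delta> - ?n) * indicator {x. norm x < 1} x" for x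
  have f [measurable]: "f \<in> borel_measurable borel" unfolding f_def[abs_def] by measurable
  have f0: "0 \<le> f x" for x by (simp add: f_def)
  let ?s = "?n - \<alpha>"
  define b1 where "b1 = 2 powr (?n + 1) * annulus_const TYPE('n)"
  have b1: "0 < b1" unfolding b1_def using annulus_const_pos[where ?'n='n] by simp
  define b where "b = 2 powr (- ?s) * c / \<delta>"
  have b: "0 < b" using c0 \<delta> by (simp add: b_def)
  define \<epsilon> where "\<epsilon> = \<delta> * (q / ?p')"
  have \<epsilon>: "0 < \<epsilon>" "\<epsilon> < 1" using \<delta> q0 p'0 by (auto simp: \<epsilon>_def)
  define \<phi> :: "real ^ 'n \<Rightarrow> real" where "\<phi> x = b * norm x powr (- ?s)" for x
  have int_f: "(\<integral>\<^sup>+y. ennreal (f y) \<partial>lborel) = (\<integral>\<^sup>+x. ennreal (norm x powr (\<delta> - ?n)) * indicator {x. norm x < 1} x \<partial>(lborel :: (real ^ 'n) measure))"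
    unfolding f_def by (intro nn_integral_cong) (simp add: indicator_def)
  have "ennreal (b * (c * (?p' / q) / \<delta>) powr (1 / q) / (b1 / \<delta>) powr (1 / p))
     \<le> riesz_norm \<alpha> p (weighted_measure (\<lambda>x. w x powr p)) q (weighted_measure (\<lambda>x. w x powr q))"
  proof (rule riesz_norm_ge[where f = f and \<phi> = \<phi> and E = "{x. 1 \<le> norm x}"])
    show "w \<in> borel_measurable borel" "\<And>x. 0 < w x" unfolding w_def by (auto intro: radial_weight_pos)
    show "0 < (b1 / \<delta>) powr (1 / p)" using b1 \<delta> by simp
    show "\<phi> \<in> borel_measurable borel" unfolding \<phi>_def[abs_def] by measurable
    show "0 \<le> \<phi> x" for x using b by (simp add: \<phi>_def)
    show "0 \<le> b * (c * (?p' / q) / \<delta>) powr (1 / q)" using b by simp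
    show "(\<integral>\<^sup>+x. ennreal (f x powr p * w x powr p) \<partial>lborel) \<le> ennreal (((b1 / \<delta>) powr (1 / p)) powr p)"
    proof -
      have pp: "p / ?p' = p - 1" using p by (simp add: conj_exponent_def)
      have "(\<integral>\<^sup>+x. ennreal (f x powr p * w x powr p) \<partial>lborel) = (\<integral>\<^sup>+x. ennreal (norm x powr (\<delta> - ?n)) * indicator {x. norm x < 1} x \<partial>(lborel :: (real ^ 'n) measure))"
      proof (rule nn_integral_cong_AE)
        show "AE x in lborel. ennreal (f x powr p * w x powr p) = ennreal (norm x powr (\<delta> - ?n)) * indicator {x. norm x < 1} x"
          using radial_weight_AE[of ?\<kappa>]
        proof eventually_elim
          case (elim x)
          have "(norm x powr (\<delta> - ?n)) powr p * (norm x powr ?\<kappa>) powr p = norm x powr ((\<delta> - ?n) * p + (?n - \<delta>) * (p / ?p'))"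
            by (simp add: powr_powr powr_add)
          also have "(\<delta> - ?n) * p + (?n - \<delta>) * (p / ?p') = \<delta> - ?n" unfolding pp by (simp add: algebra_simps)
          finally show ?case unfolding f_def w_def elim by (simp add: indicator_def)
        qed
      qed
      also have "\<dots> \<le> ennreal (2 powr (?n + 1) * annulus_const TYPE('n) * (1 powr \<delta> / \<delta>))"
        by (rule inner_integral[OF \<delta>(1,2)]) simp
      also have "2 powr (?n + 1) * annulus_const TYPE('n) * (1 powr \<delta> / \<delta>) = ((b1 / \<delta>) powr (1 / p)) powr p"
        using b1 \<delta> p by (simp add: powr_powr b1_def)
      finally show ?thesis .
    qed
    show "ennreal (\<phi> x) \<le> (\<integral>\<^sup>+y. ennreal (f y * norm (x - y) powr (- ?s)) \<partial>lborel)" if x: "x \<in> {x. 1 \<le> norm x}" for x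
    proof -
      have "ennreal (\<phi> x) = ennreal ((2 * norm x) powr (- ?s)) * ennreal (c * (1 powr \<delta> / \<delta>))"
        using c0 \<delta> by (subst ennreal_mult[symmetric]) (auto simp: \<phi>_def b_def powr_mult)
      also have "\<dots> \<le> ennreal ((2 * norm x) powr (- ?s)) * (\<integral>\<^sup>+y. ennreal (f y) \<partial>lborel)"
        unfolding int_f c_def using \<delta> by (intro mult_left_mono inner_integral(2)) auto
      also have "\<dots> = (\<integral>\<^sup>+y. ennreal ((2 * norm x) powr (- ?s)) * ennreal (f y) \<partial>lborel)"
        by (rule nn_integral_cmult[symmetric]) measurable
      also have "\<dots> \<le> (\<integral>\<^sup>+y. ennreal (f y * norm (x - y) powr (- ?s)) \<partial>lborel)"
      proof (rule nn_integral_mono)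
        fix y
        have "(2 * norm x) powr (- ?s) * f y \<le> f y * norm (x - y) powr (- ?s)"
        proof (cases "norm y < 1")
          case True
          have "norm (x - y) \<le> 2 * norm x" using norm_triangle_ineq4[of x y] True x by simp
          moreover have "0 < norm (x - y)" using True x by auto
          ultimately have "(2 * norm x) powr (- ?s) \<le> norm (x - y) powr (- ?s)" using \<alpha> by (intro powr_mono2') auto
          then show ?thesis using f0[of y] by (subst mult.commute) (rule mult_left_mono)
        qed (simp add: f_def)
        then show "ennreal ((2 * norm x) powr (- ?s)) * ennreal (f y) \<le> ennreal (f y * norm (x - y) powr (- ?s))"
          using f0 by (simp add: ennreal_mult[symmetric] ennreal_leI)
      qed
      finally show ?thesis .
    qed
    show "ennreal ((b * (c * (?p' / q) / \<delta>) powr (1 / q)) powr q) \<le> (\<integral>\<^sup>+x. ennreal (\<phi> x powr q * w x powr q) * indicator {x. 1 \<le> norm x} x \<partial>lborel)"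
    proof -
      have e: "- ?s * q + (?n - \<delta>) * (q / ?p') = - ?n - \<epsilon>"
      proof -
        have "?n * (1 / q + 1 / ?p') = ?s" using ex(3) \<alpha> by (simp add: right_diff_distrib)
        then have "?n * (1 / q + 1 / ?p') * q = ?s * q" by simp
        moreover have "?n * (1 / q + 1 / ?p') * q = ?n + ?n * (q / ?p')" using q0 by (simp add: algebra_simps)
        ultimately show ?thesis by (simp add: \<epsilon>_def algebra_simps)
      qed
      have "(b * (c * (?p' / q) / \<delta>) powr (1 / q)) powr q = b powr q * (c * (1 / \<epsilon>))"
        using b c0 q0 p'0 \<delta> by (simp add: powr_mult powr_powr \<epsilon>_def)
      then have "ennreal ((b * (c * (?p' / q) / \<delta>) powr (1 / q)) powr q) = ennreal (b powr q) * ennreal (c * (1 / \<epsilon>))"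
        using c0 \<epsilon> by (simp only:) (intro ennreal_mult; simp)
      also have "\<dots> \<le> ennreal (b powr q) * (\<integral>\<^sup>+x. ennreal (norm x powr (- ?n - \<epsilon>)) * indicator {x. 1 \<le> norm x} x \<partial>(lborel :: (real ^ 'n) measure))"
        unfolding c_def using \<epsilon> by (intro mult_left_mono outer_integral(2)) auto
      also have "\<dots> = (\<integral>\<^sup>+x. ennreal (b powr q) * (ennreal (norm x powr (- ?n - \<epsilon>)) * indicator {x. 1 \<le> norm x} x) \<partial>(lborel :: (real ^ 'n) measure))"
        by (rule nn_integral_cmult[symmetric]) measurable
      also have "\<dots> = (\<integral>\<^sup>+x. ennreal (\<phi> x powr q * w x powr q) * indicator {x. 1 \<le> norm x} x \<partial>lborel)"
      proof (intro nn_integral_cong)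
        fix x :: "real ^ 'n"
        show "ennreal (b powr q) * (ennreal (norm x powr (- ?n - \<epsilon>)) * indicator {x. 1 \<le> norm x} x) = ennreal (\<phi> x powr q * w x powr q) * indicator {x. 1 \<le> norm x} x"
        proof (cases "1 \<le> norm x")
          case True
          then have "x \<noteq> 0" by auto
          have "\<phi> x powr q * w x powr q = b powr q * norm x powr (- ?s * q + (?n - \<delta>) * (q / ?p'))"
            using b \<open>x \<noteq> 0\<close> by (simp add: \<phi>_def w_def radial_weight_def powr_mult powr_powr powr_add mult.assoc)
          then show ?thesis using True unfolding e by (simp add: ennreal_mult)
        qed simp
      qed
      finally show ?thesis .
    qed
  qed (use p0 q0 f0 in auto)
  also have "b * (c * (?p' / q) / \<delta>) powr (1 / q) / (b1 / \<delta>) powr (1 / p) =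
    2 powr (- ?s) * c * (c * (?p' / q)) powr (1 / q) / b1 powr (1 / p) * \<delta> powr (- (1 + 1 / q - 1 / p))"
    unfolding b_def using \<delta> c0 b1 p'0 q0 by (intro quotient_powers) auto
  finally show "ennreal (2 powr (- ?s) * c * (c * (?p' / q)) powr (1 / q) / (2 powr (?n + 1) * annulus_const TYPE('n)) powr (1 / p) * \<delta> powr (- (1 + 1 / q - 1 / p)))
     \<le> riesz_norm \<alpha> p (weighted_measure (\<lambda>x. w x powr p)) q (weighted_measure (\<lambda>x. w x powr q))"
    unfolding b1_def .
qed

text \<open>The dual situation, with \<open>u = |x|\<^bsup>\<delta>-n\<^esup>\<close> and \<open>f\<close> supported outside the unit ball.  The exponent of \<open>f\<close> is the
  one for which \<open>f |x|\<^bsup>\<alpha>-n\<^esup>\<close> and \<open>f\<^sup>p w\<^sup>p\<close> are the same power \<open>|x|\<^bsup>-n-\<epsilon>\<^esup>\<close>, with \<open>\<epsilon> = \<delta> p'/q\<close>; this is the case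
  of equality in Hoelder's inequality.\<close>
lemma singular_family:
  fixes \<alpha> p q :: real
  assumes \<alpha>: "0 < \<alpha>" "\<alpha> < real CARD('n)" and p: "1 < p" "p < real CARD('n) / \<alpha>"
    and q: "1 / q = 1 / p - \<alpha> / real CARD('n)"
    and \<delta>: "0 < \<delta>" "\<delta> < 1" "\<delta> * (conj_exponent p / q) < 1"
  defines "w \<equiv> radial_weight (- (real CARD('n) - \<delta>) / q) :: real ^ 'n \<Rightarrow> real"
    and "c \<equiv> 2 powr (- real CARD('n) - 1) * annulus_const TYPE('n)"
    and "k \<equiv> q / conj_exponent p"
  shows "weight w" "Apq_const p q w \<le> ennreal ((power_weight_const TYPE('n) / \<delta>) powr 1)"
    "ennreal (2 powr (- (real CARD('n) - \<alpha>)) * c * k * c powr (1 / q) / (2 powr (real CARD('n) + 2) * annulus_const TYPE('n) * k) powr (1 / p) * \<delta> powr (- (1 + 1 / q - 1 / p)))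
     \<le> riesz_norm \<alpha> p (weighted_measure (\<lambda>x. w x powr p)) q (weighted_measure (\<lambda>x. w x powr q))"
proof -
  let ?n = "real CARD('n)" and ?p' = "conj_exponent p"
  note ex = exponent_facts[OF \<alpha> p q]
  have n1: "\<delta> \<le> ?n" using zero_less_card_finite[where ?'a='n] \<delta> by linarith
  have p'0: "0 < ?p'" and q0: "0 < q" and p0: "0 < p" using ex p by auto
  have c0: "0 < c" unfolding c_def using annulus_const_pos[where ?'n='n] by simp
  have k0: "0 < k" unfolding k_def using p'0 q0 by simp
  let ?\<kappa> = "- (?n - \<delta>) / q"
  have "(?n - \<delta>) / q \<le> (?n - \<delta>) / 1" using ex n1 by (intro divide_left_mono) auto
  then have "- ((?n - \<delta>) / 1) \<le> - ((?n - \<delta>) / q)" by (rule le_imp_neg_le)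
  also have "- ((?n - \<delta>) / q) = ?\<kappa>" by (rule minus_divide_left)
  also have "- ((?n - \<delta>) / 1) = \<delta> - ?n" by simp
  finally have "\<delta> - ?n \<le> ?\<kappa>" .
  then show "weight w" unfolding w_def using \<delta> by (intro weight_radial[of \<delta>])
  show "Apq_const p q w \<le> ennreal ((power_weight_const TYPE('n) / \<delta>) powr 1)" unfolding w_def
  proof (rule Apq_const_radial_le)
    fix a :: "real ^ 'n" and h :: real assume h: "0 < h"
    have s: "0 < ?p' / q" using q0 p'0 by simp
    show "cube_integral (\<lambda>x. ennreal (radial_weight (?\<kappa> * q) x)) a h / ennreal (h ^ CARD('n)) *
        (cube_integral (\<lambda>x. ennreal (radial_weight (- ?\<kappa> * ?p') x)) a h / ennreal (h ^ CARD('n))) epowr (q / ?p') \<le> ennreal ((power_weight_const TYPE('n) / \<delta>) powr 1)"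
    proof -
      have e: "?\<kappa> * q = \<delta> - ?n" "- ?\<kappa> * ?p' = (?n - \<delta>) * (?p' / q)" "q / ?p' = 1 / (?p' / q)"
        using q0 by (simp_all add: field_simps)
      have "(power_weight_const TYPE('n) / \<delta>) powr 1 = power_weight_const TYPE('n) / \<delta>" using \<delta> power_weight_const_pos[where ?'n='n] by simp
      then show ?thesis unfolding e using power_weight_cube[OF \<delta>(1,2) s h, of a] by (simp only:)
    qed
  qed
  define \<epsilon> where "\<epsilon> = \<delta> / k"
  have \<epsilon>: "0 < \<epsilon>" "\<epsilon> < 1" "\<epsilon> = \<delta> * (?p' / q)" using \<delta> k0 p'0 q0 by (auto simp: \<epsilon>_def k_def)
  define f :: "real ^ 'n \<Rightarrow> real" where "f x = norm x powr (- \<alpha> - \<epsilon>) * indicator {x. 1 \<le> norm x} x" for x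
  have f [measurable]: "f \<in> borel_measurable borel" unfolding f_def[abs_def] by measurable
  have f0: "0 \<le> f x" for x by (simp add: f_def)
  let ?s = "?n - \<alpha>"
  define b1 where "b1 = 2 powr (?n + 2) * annulus_const TYPE('n)"
  have b1: "0 < b1" unfolding b1_def using annulus_const_pos[where ?'n='n] by simp
  define b where "b = 2 powr (- ?s) * (c * (1 / \<epsilon>))"
  have b: "0 < b" using c0 \<epsilon>(1) by (simp add: b_def)
  have "ennreal (b * (c / \<delta>) powr (1 / q) / (b1 * k / \<delta>) powr (1 / p))
     \<le> riesz_norm \<alpha> p (weighted_measure (\<lambda>x. w x powr p)) q (weighted_measure (\<lambda>x. w x powr q))"
  proof (rule riesz_norm_ge[where f = f and \<phi> = "\<lambda>_. b" and E = "{x. norm x < 1}"])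
    show "w \<in> borel_measurable borel" "\<And>x. 0 < w x" unfolding w_def by (auto intro: radial_weight_pos)
    show "0 < (b1 * k / \<delta>) powr (1 / p)" using b1 \<delta> k0 by simp
    show "0 \<le> b * (c / \<delta>) powr (1 / q)" using b by simp
    show "(\<integral>\<^sup>+x. ennreal (f x powr p * w x powr p) \<partial>lborel) \<le> ennreal (((b1 * k / \<delta>) powr (1 / p)) powr p)"
    proof -
      have e: "(- \<alpha> - \<epsilon>) * p + ?\<kappa> * p = - ?n - \<epsilon>"
      proof -
        have "?n * (1 / q) = ?n / p - \<alpha>" unfolding q using \<alpha> by (simp add: right_diff_distrib)
        then have "?n * (1 / q) * p = (?n / p - \<alpha>) * p" by simp
        then have a: "?n * p / q = ?n - \<alpha> * p" using p0 by (simp add: left_diff_distrib)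
        have d: "\<epsilon> * p - \<epsilon> = \<delta> * p / q"
        proof -
          have "?p' * (p - 1) = p" using p by (simp add: conj_exponent_def)
          moreover have "\<epsilon> * p - \<epsilon> = \<delta> * (?p' * (p - 1)) / q" unfolding \<epsilon>(3) by (simp add: algebra_simps diff_divide_distrib)
          ultimately show ?thesis by simp
        qed
        have "(- \<alpha> - \<epsilon>) * p + ?\<kappa> * p = - \<alpha> * p - \<epsilon> * p - ?n * p / q + \<delta> * p / q"
          by (simp add: algebra_simps diff_divide_distrib)
        then show ?thesis using a d by simp
      qed
      have "(\<integral>\<^sup>+x. ennreal (f x powr p * w x powr p) \<partial>lborel) = (\<integral>\<^sup>+x. ennreal (norm x powr (- ?n - \<epsilon>)) * indicator {x. 1 \<le> norm x} x \<partial>(lborel :: (real ^ 'n) measure))"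
      proof (rule nn_integral_cong)
        fix x :: "real ^ 'n"
        show "ennreal (f x powr p * w x powr p) = ennreal (norm x powr (- ?n - \<epsilon>)) * indicator {x. 1 \<le> norm x} x"
        proof (cases "1 \<le> norm x")
          case True
          then have "x \<noteq> 0" by auto
          have "(norm x powr (- \<alpha> - \<epsilon>)) powr p * (norm x powr ?\<kappa>) powr p = norm x powr ((- \<alpha> - \<epsilon>) * p + ?\<kappa> * p)"
            by (simp only: powr_powr powr_add)
          then show ?thesis using True \<open>x \<noteq> 0\<close> unfolding e by (simp add: f_def w_def radial_weight_def)
        qed (simp add: f_def)
      qed
      also have "\<dots> \<le> ennreal (2 powr (?n + 2) * annulus_const TYPE('n) * (1 / \<epsilon>))"
        by (rule outer_integral[OF \<epsilon>(1,2)])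
      also have "2 powr (?n + 2) * annulus_const TYPE('n) * (1 / \<epsilon>) = ((b1 * k / \<delta>) powr (1 / p)) powr p"
        using b1 \<delta> p k0 by (simp add: powr_powr b1_def \<epsilon>_def)
      finally show ?thesis .
    qed
    show "ennreal b \<le> (\<integral>\<^sup>+y. ennreal (f y * norm (x - y) powr (- ?s)) \<partial>lborel)" if x: "x \<in> {x. norm x < 1}" for x
    proof -
      have "ennreal b = ennreal (2 powr (- ?s)) * ennreal (c * (1 / \<epsilon>))"
        unfolding b_def using c0 \<epsilon>(1) by (intro ennreal_mult) auto
      also have "\<dots> \<le> ennreal (2 powr (- ?s)) * (\<integral>\<^sup>+x. ennreal (norm x powr (- ?n - \<epsilon>)) * indicator {x. 1 \<le> norm x} x \<partial>(lborel :: (real ^ 'n) measure))"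
        unfolding c_def using \<epsilon> by (intro mult_left_mono outer_integral(2)) auto
      also have "\<dots> = (\<integral>\<^sup>+y. ennreal (2 powr (- ?s)) * (ennreal (norm y powr (- ?n - \<epsilon>)) * indicator {x. 1 \<le> norm x} y) \<partial>(lborel :: (real ^ 'n) measure))"
        by (rule nn_integral_cmult[symmetric]) measurable
      also have "\<dots> \<le> (\<integral>\<^sup>+y. ennreal (f y * norm (x - y) powr (- ?s)) \<partial>lborel)"
      proof (rule nn_integral_mono)
        fix y :: "real ^ 'n"
        show "ennreal (2 powr (- ?s)) * (ennreal (norm y powr (- ?n - \<epsilon>)) * indicator {x. 1 \<le> norm x} y) \<le> ennreal (f y * norm (x - y) powr (- ?s))"
        proof (cases "1 \<le> norm y")
          case True
          have "norm (x - y) \<le> 2 * norm y" using norm_triangle_ineq4[of x y] True x by simp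
          moreover have "0 < norm (x - y)" using True x by auto
          ultimately have "(2 * norm y) powr (- ?s) \<le> norm (x - y) powr (- ?s)" using \<alpha> by (intro powr_mono2') auto
          then have "norm y powr (- \<alpha> - \<epsilon>) * (2 * norm y) powr (- ?s) \<le> norm y powr (- \<alpha> - \<epsilon>) * norm (x - y) powr (- ?s)"
            by (rule mult_left_mono) simp
          moreover have "norm y powr (- \<alpha> - \<epsilon>) * (2 * norm y) powr (- ?s) = 2 powr (- ?s) * norm y powr (- ?n - \<epsilon>)"
          proof -
            have "norm y powr (- \<alpha> - \<epsilon>) * norm y powr (- ?s) = norm y powr (- ?n - \<epsilon>)"
              unfolding powr_add[symmetric] by (rule arg_cong[where f = "(powr) (norm y)"]) simp
            from this[symmetric] show ?thesis by (simp only: powr_mult mult_ac)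
          qed
          ultimately show ?thesis using True by (simp add: f_def ennreal_mult[symmetric] ennreal_leI)
        qed simp
      qed
      finally show ?thesis .
    qed
    show "ennreal ((b * (c / \<delta>) powr (1 / q)) powr q) \<le> (\<integral>\<^sup>+x. ennreal (b powr q * w x powr q) * indicator {x. norm x < 1} x \<partial>lborel)"
    proof -
      have "(b * (c / \<delta>) powr (1 / q)) powr q = b powr q * (c * (1 powr \<delta> / \<delta>))"
        using b c0 q0 \<delta> by (simp add: powr_mult powr_powr)
      then have "ennreal ((b * (c / \<delta>) powr (1 / q)) powr q) = ennreal (b powr q) * ennreal (c * (1 powr \<delta> / \<delta>))"
        using c0 \<delta> by (simp only:) (intro ennreal_mult; simp)
      also have "\<dots> \<le> ennreal (b powr q) * (\<integral>\<^sup>+x. ennreal (norm x powr (\<delta> - ?n)) * indicator {x. norm x < 1} x \<partial>(lborel :: (real ^ 'n) measure))"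
        unfolding c_def using \<delta> by (intro mult_left_mono inner_integral(2)) auto
      also have "\<dots> = (\<integral>\<^sup>+x. ennreal (b powr q) * (ennreal (norm x powr (\<delta> - ?n)) * indicator {x. norm x < 1} x) \<partial>(lborel :: (real ^ 'n) measure))"
        by (rule nn_integral_cmult[symmetric]) measurable
      also have "\<dots> = (\<integral>\<^sup>+x. ennreal (b powr q * w x powr q) * indicator {x. norm x < 1} x \<partial>lborel)"
      proof (rule nn_integral_cong_AE)
        show "AE x in lborel. ennreal (b powr q) * (ennreal (norm x powr (\<delta> - ?n)) * indicator {x. norm x < 1} x) = ennreal (b powr q * w (x :: real ^ 'n) powr q) * indicator {x. norm x < 1} x"
          using radial_weight_AE[of "\<delta> - ?n"]
        proof eventually_elim
          case (elim x)
          have "w x powr q = radial_weight (\<delta> - ?n) x" unfolding w_def radial_weight_powr using q0 by simp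
          then show ?case unfolding elim by (simp add: ennreal_mult mult.assoc)
        qed
      qed
      finally show ?thesis .
    qed
  qed (use p0 q0 f0 b in auto)
  also have "b * (c / \<delta>) powr (1 / q) / (b1 * k / \<delta>) powr (1 / p) = (2 powr (- ?s) * c * k / \<delta>) * (c / \<delta>) powr (1 / q) / (b1 * k / \<delta>) powr (1 / p)"
    unfolding b_def \<epsilon>_def by simp
  also have "\<dots> = 2 powr (- ?s) * c * k * c powr (1 / q) / (b1 * k) powr (1 / p) * \<delta> powr (- (1 + 1 / q - 1 / p))"
    using \<delta> c0 b1 k0 by (intro quotient_powers) auto
  finally show "ennreal (2 powr (- ?s) * c * k * c powr (1 / q) / (2 powr (?n + 2) * annulus_const TYPE('n) * k) powr (1 / p) * \<delta> powr (- (1 + 1 / q - 1 / p)))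
     \<le> riesz_norm \<alpha> p (weighted_measure (\<lambda>x. w x powr p)) q (weighted_measure (\<lambda>x. w x powr q))"
    unfolding b1_def .
qed

theorem theorem2p6:
  fixes \<alpha> p q :: real
  assumes "0 < \<alpha>" and "\<alpha> < real CARD('n::finite)"
    and "1 < p" and "p < real CARD('n) / \<alpha>"
    and "1 / q = 1 / p - \<alpha> / real CARD('n)"
  shows
    "(\<exists>c::real. \<forall>w \<in> (Apq p q :: (real ^ 'n \<Rightarrow> real) set).
        riesz_norm \<alpha> p (weighted_measure (\<lambda>x. w x powr p)) q (weighted_measure (\<lambda>x. w x powr q))
          \<le> ennreal c * Apq_const p q w epowr
              ((1 - \<alpha> / real CARD('n)) * max 1 (conj_exponent p / q))) \<and>
     (\<forall>\<beta> < (1 - \<alpha> / real CARD('n)) * max 1 (conj_exponent p / q).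
        \<not> (\<exists>c::real. \<forall>w \<in> (Apq p q :: (real ^ 'n \<Rightarrow> real) set).
            riesz_norm \<alpha> p (weighted_measure (\<lambda>x. w x powr p)) q (weighted_measure (\<lambda>x. w x powr q))
              \<le> ennreal c * Apq_const p q w epowr \<beta>))"
proof (intro conjI allI impI)
  show "\<exists>c::real. \<forall>w \<in> (Apq p q :: (real ^ 'n \<Rightarrow> real) set).
        riesz_norm \<alpha> p (weighted_measure (\<lambda>x. w x powr p)) q (weighted_measure (\<lambda>x. w x powr q))
          \<le> ennreal c * Apq_const p q w epowr
              ((1 - \<alpha> / real CARD('n)) * max 1 (conj_exponent p / q))"
    using riesz_norm_le[OF assms] by blast
next
  fix \<beta> assume \<beta>: "\<beta> < (1 - \<alpha> / real CARD('n)) * max 1 (conj_exponent p / q)"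
  let ?n = "real CARD('n)" and ?p' = "conj_exponent p"
  let ?r = "1 - \<alpha> / ?n"
  note ex = exponent_facts[OF assms]
  have r0: "0 < ?r" using assms by simp
  have r1: "1 / q + 1 / ?p' < 1" unfolding ex(3) using assms by simp
  have rr: "1 + 1 / q - 1 / p = ?r" using assms(5) by simp
  have p'0: "0 < ?p'" and q0: "0 < q" using ex by auto
  have a0: "0 < annulus_const TYPE('n)" and cap0: "0 < power_weight_const TYPE('n)" by (rule annulus_const_pos, rule power_weight_const_pos)
  have in_class: "w \<in> Apq p q" "\<exists>W\<ge>1. Apq_const p q w = ennreal W \<and> W \<le> b"
    if "weight w" "Apq_const p q w \<le> ennreal b" "0 \<le> b" "w = radial_weight \<kappa>" for w :: "real ^ 'n \<Rightarrow> real" and b \<kappa>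
  proof -
    have fin: "Apq_const p q w < \<infinity>" using le_less_trans[OF that(2) ennreal_less_top] by simp
    then show "w \<in> Apq p q" using that by (simp add: Apq_def)
    let ?W = "enn2real (Apq_const p q w)"
    have "1 \<le> ?W" using fin ex r1 assms unfolding that(4) by (intro one_le_Apq_const radial_weight_pos) auto
    moreover have W: "Apq_const p q w = ennreal ?W" using fin by simp
    moreover have "?W \<le> b" using that(2,3) by (subst (asm) W) (simp add: ennreal_le_iff)
    ultimately show "\<exists>W\<ge>1. Apq_const p q w = ennreal W \<and> W \<le> b" by blast
  qed
  show "\<not> (\<exists>c::real. \<forall>w \<in> (Apq p q :: (real ^ 'n \<Rightarrow> real) set).
            riesz_norm \<alpha> p (weighted_measure (\<lambda>x. w x powr p)) q (weighted_measure (\<lambda>x. w x powr q))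
              \<le> ennreal c * Apq_const p q w epowr \<beta>)"
  proof (cases "1 \<le> ?p' / q")
    case True
    let ?t = "q / ?p'"
    let ?\<delta>0 = "min (1/2) (1 / (2 * ?t))"
    let ?c = "2 powr (- ?n - 1) * annulus_const TYPE('n)"
    show ?thesis
    proof (rule no_smaller_power[where t = ?t and dmax = ?\<delta>0 and r = ?r and C = "power_weight_const TYPE('n)" and
        a = "2 powr (- (?n - \<alpha>)) * ?c * (?c * (?p' / q)) powr (1 / q) / (2 powr (?n + 1) * annulus_const TYPE('n)) powr (1 / p)"])
      have t0: "0 < ?t" using q0 p'0 by simp
      then show "0 < ?t" .
      show "0 < ?\<delta>0" using q0 p'0 by simp
      show "0 < ?r" by (rule r0)
      show "\<beta> * ?t < ?r"
      proof -
        have "\<beta> * ?t < (?r * (?p' / q)) * ?t" using \<beta> True t0 by (intro mult_strict_right_mono) auto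
        also have "\<dots> = ?r" using q0 p'0 by simp
        finally show ?thesis .
      qed
      show "0 < power_weight_const TYPE('n)" by (rule cap0)
      show "0 < 2 powr (- (?n - \<alpha>)) * ?c * (?c * (?p' / q)) powr (1 / q) / (2 powr (?n + 1) * annulus_const TYPE('n)) powr (1 / p)"
        using a0 q0 p'0 by simp
      fix \<delta> assume \<delta>: "0 < \<delta>" "\<delta> \<le> ?\<delta>0"
      have d1: "\<delta> < 1" using \<delta> by simp
      have "\<delta> * ?t \<le> (1 / (2 * ?t)) * ?t" using \<delta> t0 by (intro mult_right_mono) auto
      also have "\<dots> < 1" using t0 by simp
      finally have d2: "\<delta> * ?t < 1" .
      note fam = growing_family[OF assms \<delta>(1) d1 d2]
      show "\<exists>w\<in>Apq p q :: (real ^ 'n \<Rightarrow> real) set.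
          ennreal (2 powr (- (?n - \<alpha>)) * ?c * (?c * (?p' / q)) powr (1 / q) / (2 powr (?n + 1) * annulus_const TYPE('n)) powr (1 / p) * \<delta> powr (- ?r))
            \<le> riesz_norm \<alpha> p (weighted_measure (\<lambda>x. w x powr p)) q (weighted_measure (\<lambda>x. w x powr q)) \<and>
          (\<exists>W\<ge>1. Apq_const p q w = ennreal W \<and> W \<le> (power_weight_const TYPE('n) / \<delta>) powr ?t)"
        using fam(3)[unfolded rr] in_class[OF fam(1,2) _ refl] by (intro bexI[of _ "radial_weight ((?n - \<delta>) / ?p')"]) auto
    qed
  next
    case False
    let ?t = "?p' / q"
    let ?\<delta>0 = "min (1/2) (1 / (2 * ?t))"
    let ?k = "q / ?p'"
    let ?c = "2 powr (- ?n - 1) * annulus_const TYPE('n)"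
    show ?thesis
    proof (rule no_smaller_power[where t = 1 and dmax = ?\<delta>0 and r = ?r and C = "power_weight_const TYPE('n)" and
        a = "2 powr (- (?n - \<alpha>)) * ?c * ?k * ?c powr (1 / q) / (2 powr (?n + 2) * annulus_const TYPE('n) * ?k) powr (1 / p)"])
      have t0: "0 < ?t" using q0 p'0 by simp
      show "0 < ?\<delta>0" using q0 p'0 by simp
      show "0 < ?r" by (rule r0)
      show "\<beta> * 1 < ?r" using \<beta> False by simp
      show "0 < power_weight_const TYPE('n)" by (rule cap0)
      show "0 < 2 powr (- (?n - \<alpha>)) * ?c * ?k * ?c powr (1 / q) / (2 powr (?n + 2) * annulus_const TYPE('n) * ?k) powr (1 / p)"
        using a0 q0 p'0 by simp
      fix \<delta> assume \<delta>: "0 < \<delta>" "\<delta> \<le> ?\<delta>0"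
      have d1: "\<delta> < 1" using \<delta> by simp
      have "\<delta> * ?t \<le> (1 / (2 * ?t)) * ?t" using \<delta> t0 by (intro mult_right_mono) auto
      also have "\<dots> < 1" using t0 by simp
      finally have d2: "\<delta> * ?t < 1" .
      note fam = singular_family[OF assms \<delta>(1) d1 d2]
      show "\<exists>w\<in>Apq p q :: (real ^ 'n \<Rightarrow> real) set.
          ennreal (2 powr (- (?n - \<alpha>)) * ?c * ?k * ?c powr (1 / q) / (2 powr (?n + 2) * annulus_const TYPE('n) * ?k) powr (1 / p) * \<delta> powr (- ?r))
            \<le> riesz_norm \<alpha> p (weighted_measure (\<lambda>x. w x powr p)) q (weighted_measure (\<lambda>x. w x powr q)) \<and>
          (\<exists>W\<ge>1. Apq_const p q w = ennreal W \<and> W \<le> (power_weight_const TYPE('n) / \<delta>) powr 1)"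
        using fam(3)[unfolded rr] in_class[OF fam(1,2) _ refl] by (intro bexI[of _ "radial_weight (- (?n - \<delta>) / q)"]) auto
    qed simp
  qed
qed

end
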